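(* Let $q\in L_{1,loc}(\mathbb{R}_+)$ be a complex-valued function, $\mathbb{R}_+=[0,+\infty)$, and suppose that for some $x_0>0$ we have $|q(x)|\ge1$ for all $x\ge x_0$ and additionally: (i) $q\in AC_{loc}[x_0,+\infty)$; (ii) for some $0<\varkappa<\pi$, $-\pi+\varkappa<\arg q(x)<\pi-\varkappa$ for all $x\ge x_0$; (iii) for some $0<\delta<1$, $\dfrac{|q'(x)|}{|q(x)|^{3/2}}<4\delta\sin\dfrac{\varkappa}{2}$ for all $x\ge x_0$. Let $l(y)=-y''+qy$, $\mathscr{D}=\{y\in L_2(\mathbb{R}_+):\ y,y'\in AC_{loc}(\mathbb{R}_+),\ l(y)\in L_2(\mathbb{R}_+)\}$, and for fixed $A,B\in\mathbb{C}$ with $|A|+|B|>0$ let $L_U$ be the operator in $L_2(\mathbb{R}_+)$ with domain $\{y\in\mathscr{D}:\ Ay(0)+By'(0)=0\}$ acting by $L_Uy=l(y)$. If for every infinite system of pairwise disjoint intervals $D_n\subset\mathbb{R}_+$ of equal length $$\int_{D_n}|q(x)|^{1/2}\,dx\to+\infty\quad\text{as } n\to\infty,$$ then $L_U$ has compact resolvent.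
   Context: $AC_{loc}$ denotes functions absolutely continuous on every compact subinterval. An operator has compact resolvent if its resolvent set is nonempty and its resolvent is a compact operator. *)

theory Defs
  imports "HOL-Analysis.Analysis"
begin

definition abs_cont_on_interval :: "(real \<Rightarrow> 'a::real_normed_vector) \<Rightarrow> real \<Rightarrow> real \<Rightarrow> bool" where
  "abs_cont_on_interval f a b \<longleftrightarrow>
     (\<forall>\<epsilon>>0. \<exists>\<delta>>0. \<forall>(n::nat) (s::nat \<Rightarrow> real) (t::nat \<Rightarrow> real).
        (\<forall>i<n. a \<le> s i \<and> s i \<le> t i \<and> t i \<le> b) \<and>
        (\<forall>i<n. \<forall>j<n. i \<noteq> j \<longrightarrow> {s i<..<t i} \<inter> {s j<..<t j} = {}) \<and>
        (\<Sum>i<n. t i - s i) < \<delta>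
        \<longrightarrow> (\<Sum>i<n. norm (f (t i) - f (s i))) < \<epsilon>)"

definition AC_loc :: "(real \<Rightarrow> 'a::real_normed_vector) \<Rightarrow> real set \<Rightarrow> bool" where
  "AC_loc f S \<longleftrightarrow> (\<forall>a b. a \<le> b \<longrightarrow> {a..b} \<subseteq> S \<longrightarrow> abs_cont_on_interval f a b)"

definition L1_loc_Rplus :: "(real \<Rightarrow> complex) \<Rightarrow> bool" where
  "L1_loc_Rplus q \<longleftrightarrow> (\<forall>b\<ge>0. set_integrable lborel {0..b} q)"

definition L2_Rplus :: "(real \<Rightarrow> complex) \<Rightarrow> bool" where
  "L2_Rplus y \<longleftrightarrow> set_borel_measurable lborel {0..} y \<and>
                  set_integrable lborel {0..} (\<lambda>x. (cmod (y x))\<^sup>2)"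

definition L2_norm_Rplus :: "(real \<Rightarrow> complex) \<Rightarrow> real" where
  "L2_norm_Rplus y = sqrt (LINT x:{0..}|lborel. (cmod (y x))\<^sup>2)"

definition LU_graph :: "(real \<Rightarrow> complex) \<Rightarrow> complex \<Rightarrow> complex \<Rightarrow> (real \<Rightarrow> complex) \<Rightarrow> (real \<Rightarrow> complex) \<Rightarrow> bool" where
  "LU_graph q A B y g \<longleftrightarrow>
     L2_Rplus y \<and> L2_Rplus g \<and> AC_loc y {0..} \<and>
     (\<exists>y1 y2.
        (\<forall>x\<ge>0. (y has_vector_derivative y1 x) (at x within {0..})) \<and>
        AC_loc y1 {0..} \<and>
        (AE x in lborel. x \<ge> 0 \<longrightarrow> (y1 has_vector_derivative y2 x) (at x within {0..})) \<and>
        (AE x in lborel. x \<ge> 0 \<longrightarrow> g x = - y2 x + q x * y x) \<and>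
        A * y 0 + B * y1 0 = 0)"

text \<open>L_U has compact resolvent: some \<lambda> lies in the resolvent set (L_U - \<lambda> is a bijection
  of its domain onto L_2(R_+), modulo a.e. equality) and the inverse maps bounded sets to
  relatively compact sets.\<close>
definition LU_compact_resolvent :: "(real \<Rightarrow> complex) \<Rightarrow> complex \<Rightarrow> complex \<Rightarrow> bool" where
  "LU_compact_resolvent q A B \<longleftrightarrow>
     (\<exists>mu::complex.
        (\<forall>f. L2_Rplus f \<longrightarrow> (\<exists>y. LU_graph q A B y (\<lambda>x. f x + mu * y x))) \<and>
        (\<forall>y. LU_graph q A B y (\<lambda>x. mu * y x) \<longrightarrow> (AE x in lborel. x \<ge> 0 \<longrightarrow> y x = 0)) \<and>
        (\<forall>(ys::nat \<Rightarrow> real \<Rightarrow> complex) (fs::nat \<Rightarrow> real \<Rightarrow> complex) C.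
           (\<forall>n. L2_Rplus (fs n) \<and> L2_norm_Rplus (fs n) \<le> C \<and>
                LU_graph q A B (ys n) (\<lambda>x. fs n x + mu * ys n x))
           \<longrightarrow> (\<exists>r z. strict_mono r \<and> L2_Rplus z \<and>
                  (\<lambda>n. L2_norm_Rplus (\<lambda>x. ys (r n) x - z x)) \<longlonglongrightarrow> 0)))"

end

(* The phase P = exp(i Arg(q)/2) of the principal square root of q satisfies Re P >= sin(kappa/2) and
   Re(P cnj q) >= sin(kappa/2) |q|, and hypothesis (iii) says exactly that
   |P'| <= |q'|/(2|q|) <= 2 delta sin(kappa/2) |q|^(1/2).  Hence for -y'' + (q + t) y = f the function
   W = Re(P y cnj y') obeys
     W' >= (1 - delta) sin(kappa/2) (|y'|^2 + |q||y|^2) + t sin(kappa/2) |y|^2 - |y||f|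
   beyond x0, while on [0, x0] the potential and the boundary term are absorbed by taking t large.
   Integrating (1 - x/R)^2 W and letting R grow bounds the integrals of |y'|^2, |q||y|^2 and |y|^2 by that
   of |f|^2; this gives uniqueness.  Integrating W over [0, R] for solutions with y(R) = 0 gives the
   same bound uniformly in R, and a limit R -> infinity of such solutions proves existence.
   The hypothesis on intervals makes the integral of |q| over windows of any fixed length tend to
   infinity, so the bound on |q||y|^2 controls the tails in L2 and yields compactness, as in
   Molchanov's criterion.
   Since q is only absolutely continuous, W is absolutely continuous and its increments are integrals
   of the derivative, which exists almost everywhere: the Radon-Nikodym theorem provides a density for
   a monotone absolutely continuous function, and Lebesgue differentiation identifies it. *)
theory Submission
  imports Defs "HOL-Complex_Analysis.Great_Picard"
begin

section \<open>Absolutely continuous functions\<close>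

text \<open>The values of q lie in a sector of opening 2\<pi> - 2\<kappa>, which may exceed \<pi>,
  so Re q need not have a sign and pairing the equation with y alone gives no bound. Half the
  argument serves both terms at once: P |y'|^2 has phase arg(q)/2 and P cnj(q) |y|^2 has phase
  -arg(q)/2, and both directions stay at an angle of at least \<kappa>/2 from the imaginary axis.
  The price is the term P' y cnj y'. The constant 4 in (iii) is the one for which 2ab \<le> a^2 +
  b^2 lets this term consume exactly the fraction \<delta> of the coercivity. An L2 solution brings
  no information on y' at infinity, hence the weight: (1 - x/R)^2 removes the boundary term at R,
  and its derivative costs only a multiple of R^(-2) times the integral of |y|^2. In the existence
  proof the solutions satisfying the boundary condition at 0 form a family p + a u with one complex
  parameter, so passing to the limit R -> infinity only takes a bounded sequence of numbers
  a.\<close>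

definition nonoverlapping :: "real \<Rightarrow> real \<Rightarrow> (real \<times> real) set \<Rightarrow> bool" where
  "nonoverlapping a b P \<longleftrightarrow> finite P \<and> (\<forall>(s,t)\<in>P. a \<le> s \<and> s < t \<and> t \<le> b) \<and>
     pairwise (\<lambda>p p'. {fst p<..<snd p} \<inter> {fst p'<..<snd p'} = {}) P"

lemma nonoverlappingD:
  assumes "nonoverlapping a b P"
  shows "finite P" "p \<in> P \<Longrightarrow> a \<le> fst p" "p \<in> P \<Longrightarrow> fst p < snd p" "p \<in> P \<Longrightarrow> snd p \<le> b"
    "p \<in> P \<Longrightarrow> p' \<in> P \<Longrightarrow> p \<noteq> p' \<Longrightarrow> {fst p<..<snd p} \<inter> {fst p'<..<snd p'} = {}"
  using assms unfolding nonoverlapping_def pairwise_def by auto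

lemma nonoverlappingI:
  assumes "finite P" "\<And>p. p \<in> P \<Longrightarrow> a \<le> fst p \<and> fst p < snd p \<and> snd p \<le> b"
    "\<And>p p'. p \<in> P \<Longrightarrow> p' \<in> P \<Longrightarrow> p \<noteq> p' \<Longrightarrow> {fst p<..<snd p} \<inter> {fst p'<..<snd p'} = {}"
  shows "nonoverlapping a b P"
  using assms unfolding nonoverlapping_def pairwise_def by (auto split: prod.splits)

text \<open>Indexed families, with degenerate intervals allowed, match the quantifiers of
  \<open>abs_cont_on_interval\<close>. The set form \<open>nonoverlapping\<close> requires s < t, so
  each member has a nonempty interior and distinct members share no interior point; cutting,
  inserting and taking unions are easier there.\<close>

definition interval_family :: "real \<Rightarrow> real \<Rightarrow> nat \<Rightarrow> (nat \<Rightarrow> real) \<Rightarrow> (nat \<Rightarrow> real) \<Rightarrow> bool" where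
  "interval_family a b n s t \<longleftrightarrow> (\<forall>i<n. a \<le> s i \<and> s i \<le> t i \<and> t i \<le> b) \<and>
     (\<forall>i<n. \<forall>j<n. i \<noteq> j \<longrightarrow> {s i<..<t i} \<inter> {s j<..<t j} = {})"

lemma abs_cont_on_interval_iff:
  "abs_cont_on_interval f a b \<longleftrightarrow>
     (\<forall>\<epsilon>>0. \<exists>\<delta>>0. \<forall>n s t. interval_family a b n s t \<longrightarrow> (\<Sum>i<n. t i - s i) < \<delta>
        \<longrightarrow> (\<Sum>i<n. norm (f (t i) - f (s i))) < \<epsilon>)"
  unfolding abs_cont_on_interval_def interval_family_def by (simp add: imp_conjL)

lemma abs_cont_on_interval_pairs:
  assumes "abs_cont_on_interval f a b" "\<epsilon> > 0"
  obtains \<delta> where "\<delta> > 0"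
    "\<And>P. nonoverlapping a b P \<Longrightarrow> (\<Sum>p\<in>P. snd p - fst p) < \<delta> \<Longrightarrow> (\<Sum>p\<in>P. norm (f (snd p) - f (fst p))) < \<epsilon>"
proof -
  obtain \<delta> where \<delta>: "\<delta> > 0" and ac: "\<And>n s t. interval_family a b n s t \<Longrightarrow> (\<Sum>i<n. t i - s i) < \<delta>
      \<Longrightarrow> (\<Sum>i<n. norm (f (t i) - f (s i))) < \<epsilon>"
    using assms unfolding abs_cont_on_interval_iff by meson
  show thesis
  proof (rule that[OF \<delta>])
    fix P assume P: "nonoverlapping a b P" and l: "(\<Sum>p\<in>P. snd p - fst p) < \<delta>"
    note PD = nonoverlappingD[OF P]
    obtain h where h: "bij_betw h {0..<card P} P" using ex_bij_betw_nat_finite[OF PD(1)] by blast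
    then have h': "bij_betw h {..<card P} P" by (simp add: atLeast0LessThan)
    have hP: "h i \<in> P" if "i < card P" for i using h' that bij_betwE by blast
    have inj: "h i \<noteq> h j" if "i < card P" "j < card P" "i \<noteq> j" for i j
      using h' that unfolding bij_betw_def inj_on_def by auto
    have sm: "(\<Sum>i<card P. g (h i)) = (\<Sum>p\<in>P. g p)" for g :: "real \<times> real \<Rightarrow> real"
      using sum.reindex_bij_betw[OF h'] .
    have "(\<Sum>i<card P. norm (f ((snd \<circ> h) i) - f ((fst \<circ> h) i))) < \<epsilon>"
    proof (rule ac)
      show "interval_family a b (card P) (fst \<circ> h) (snd \<circ> h)"
        unfolding interval_family_def o_def using PD(2,3,4) hP PD(5)[OF hP hP inj] by (simp add: less_imp_le)
      show "(\<Sum>i<card P. (snd \<circ> h) i - (fst \<circ> h) i) < \<delta>" using sm[of "\<lambda>p. snd p - fst p"] l by simp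
    qed
    then show "(\<Sum>p\<in>P. norm (f (snd p) - f (fst p))) < \<epsilon>"
      using sm[of "\<lambda>p. norm (f (snd p) - f (fst p))"] by simp
  qed
qed

text \<open>Closed intervals with disjoint interiors meet in endpoints only, so they form a division
  of their union and the integrals over them add up.\<close>

lemma nonoverlapping_sum_integral_le:
  fixes r :: "real \<Rightarrow> real"
  assumes P: "nonoverlapping a b P" and r: "r integrable_on {a..b}" and pos: "\<And>x. x \<in> {a..b} \<Longrightarrow> r x \<ge> 0"
  shows "(\<Sum>p\<in>P. integral {fst p..snd p} r) \<le> integral {a..b} r"
proof -
  note PD = nonoverlappingD[OF P]
  let ?I = "\<lambda>p::real\<times>real. {fst p..snd p}"
  have inj: "inj_on ?I P"
  proof (rule inj_onI)
    fix p p' assume *: "p \<in> P" "p' \<in> P" "?I p = ?I p'"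
    then show "p = p'" using PD(3)[OF *(1)] PD(3)[OF *(2)] by (metis Icc_eq_Icc not_less_iff_gr_or_eq order_less_le prod.collapse)
  qed
  have div: "(?I ` P) division_of \<Union>(?I ` P)"
  proof (rule division_ofI)
    show "finite (?I ` P)" using PD(1) by simp
    fix K assume "K \<in> ?I ` P"
    then obtain p where p: "p \<in> P" "K = ?I p" by auto
    show "K \<subseteq> \<Union>(?I ` P)" using p by auto
    show "K \<noteq> {}" using p PD(3)[OF p(1)] by auto
    show "\<exists>a b. K = cbox a b" using p by auto
    fix K' assume "K' \<in> ?I ` P" "K \<noteq> K'"
    then obtain p' where p': "p' \<in> P" "K' = ?I p'" by auto
    then show "interior K \<inter> interior K' = {}" using p PD(5)[OF p(1) p'(1)] \<open>K \<noteq> K'\<close>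
      by (auto simp: interior_atLeastAtMost_real)
  qed auto
  have int: "r integrable_on ?I p" if "p \<in> P" for p
    using PD(2,4)[OF that] by (intro integrable_subinterval_real[OF r]) auto
  have sub: "\<Union>(?I ` P) \<subseteq> {a..b}" using PD(2,4) by fastforce
  have "(\<Sum>p\<in>P. integral (?I p) r) = (\<Sum>K\<in>?I ` P. integral K r)"
    by (simp add: sum.reindex[OF inj])
  also have "\<dots> = integral (\<Union>(?I ` P)) r"
    by (rule integral_combine_division_bottomup[OF div, symmetric]) (use int in auto)
  also have "\<dots> \<le> integral {a..b} r"
    by (rule integral_subset_le[OF sub _ r]) (use int pos in \<open>auto intro!: integrable_combine_division[OF div]\<close>)
  finally show ?thesis .
qed

lemma nonoverlapping_length_le:
  assumes "nonoverlapping a b P" "a \<le> b"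
  shows "(\<Sum>p\<in>P. snd p - fst p) \<le> b - a"
proof -
  have "(\<Sum>p\<in>P. snd p - fst p) = (\<Sum>p\<in>P. integral {fst p..snd p} (\<lambda>x. 1::real))"
    using nonoverlappingD(3)[OF assms(1)] by (intro sum.cong) (auto simp: less_imp_le)
  also have "\<dots> \<le> integral {a..b} (\<lambda>x. 1::real)"
    by (rule nonoverlapping_sum_integral_le[OF assms(1)]) auto
  finally show ?thesis using assms(2) by simp
qed

text \<open>An interval with c in its interior is replaced by its two pieces, at the price of one
  triangle inequality through \<open>f c\<close>; every other interval goes to one side.
  \<open>L\<close> and \<open>R\<close> do this by truncation at c.\<close>

lemma nonoverlapping_cut:
  fixes f :: "real \<Rightarrow> 'a::real_normed_vector"
  assumes P: "nonoverlapping a b P" and c: "a \<le> c" "c \<le> b"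
  obtains P1 P2 where "nonoverlapping a c P1" "nonoverlapping c b P2"
    "(\<Sum>p\<in>P. norm (f (snd p) - f (fst p))) \<le>
       (\<Sum>p\<in>P1. norm (f (snd p) - f (fst p))) + (\<Sum>p\<in>P2. norm (f (snd p) - f (fst p)))"
proof -
  note PD = nonoverlappingD[OF P]
  let ?v = "\<lambda>p. norm (f (snd p) - f (fst p))"
  define L where "L = (\<lambda>p::real\<times>real. (fst p, min (snd p) c))"
  define R where "R = (\<lambda>p::real\<times>real. (max (fst p) c, snd p))"
  define A where "A = {p\<in>P. fst p < c}"
  define B where "B = {p\<in>P. c < snd p}"
  have nonempty: "{max u u'<..<min v v'} = {} \<longleftrightarrow> \<not> (u < v \<and> u < v' \<and> u' < v \<and> u' < v')" for u v u' v' :: real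
    by auto
  have PD5: "\<not> (fst p < snd p \<and> fst p < snd p' \<and> fst p' < snd p \<and> fst p' < snd p')"
    if "p \<in> P" "p' \<in> P" "p \<noteq> p'" for p p'
    using PD(5)[OF that] nonempty[of "fst p" "fst p'" "snd p" "snd p'"] by (auto simp: greaterThanLessThan_def)
  \<comment> \<open>Equal truncations have the same left endpoint, so the two intervals overlap and
    \<open>PD5\<close> makes them equal.\<close>
  have injL: "inj_on L A"
  proof (rule inj_onI)
    fix p p' assume "p \<in> A" "p' \<in> A" "L p = L p'"
    then show "p = p'" using PD5[of p p'] PD(3)[of p] PD(3)[of p'] by (auto simp: A_def L_def)
  qed
  have injR: "inj_on R B"
  proof (rule inj_onI)
    fix p p' assume "p \<in> B" "p' \<in> B" "R p = R p'"
    then show "p = p'" using PD5[of p p'] PD(3)[of p] PD(3)[of p'] by (auto simp: B_def R_def)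
  qed
  have fin: "finite A" "finite B" using PD(1) by (auto simp: A_def B_def)
  show thesis
  proof (rule that)
    show "nonoverlapping a c (L ` A)"
    proof (rule nonoverlappingI)
      fix p p' assume "p \<in> L ` A" "p' \<in> L ` A" "p \<noteq> p'"
      then obtain u u' where "u \<in> A" "u' \<in> A" "u \<noteq> u'" "p = L u" "p' = L u'" by auto
      then show "{fst p<..<snd p} \<inter> {fst p'<..<snd p'} = {}"
        using PD(5)[of u u'] by (auto simp: A_def L_def)
    qed (use fin PD(2,3) in \<open>auto simp: A_def L_def\<close>)
    show "nonoverlapping c b (R ` B)"
    proof (rule nonoverlappingI)
      fix p p' assume "p \<in> R ` B" "p' \<in> R ` B" "p \<noteq> p'"
      then obtain u u' where "u \<in> B" "u' \<in> B" "u \<noteq> u'" "p = R u" "p' = R u'" by auto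
      then show "{fst p<..<snd p} \<inter> {fst p'<..<snd p'} = {}"
        using PD(5)[of u u'] by (auto simp: B_def R_def)
    qed (use fin PD(3,4) in \<open>auto simp: B_def R_def\<close>)
    have "(\<Sum>p\<in>P. ?v p) \<le> (\<Sum>p\<in>P. (if p \<in> A then ?v (L p) else 0) + (if p \<in> B then ?v (R p) else 0))"
    proof (rule sum_mono)
      fix p assume p: "p \<in> P"
      have tri: "norm (f (snd p) - f (fst p)) \<le> norm (f c - f (fst p)) + norm (f (snd p) - f c)"
        by (metis add.commute norm_triangle_sub diff_add_cancel norm_diff_triangle_le order_refl)
      consider "fst p < c" "c < snd p" | "snd p \<le> c" | "c \<le> fst p" by linarith
      then show "?v p \<le> (if p \<in> A then ?v (L p) else 0) + (if p \<in> B then ?v (R p) else 0)"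
        using p PD(3)[OF p] tri by cases (auto simp: A_def B_def L_def R_def min_def max_def)
    qed
    also have "\<dots> = (\<Sum>p\<in>A. ?v (L p)) + (\<Sum>p\<in>B. ?v (R p))"
      using PD(1) by (auto simp: sum.distrib sum.If_cases A_def B_def Int_def intro!: arg_cong2[where f="(+)"] sum.cong)
    also have "\<dots> = (\<Sum>p\<in>L ` A. ?v p) + (\<Sum>p\<in>R ` B. ?v p)"
      by (simp add: sum.reindex[OF injL] sum.reindex[OF injR])
    finally show "(\<Sum>p\<in>P. ?v p) \<le> (\<Sum>p\<in>L ` A. ?v p) + (\<Sum>p\<in>R ` B. ?v p)" .
  qed
qed

lemma abs_cont_on_interval_subset:
  assumes "abs_cont_on_interval f a b" "a \<le> c" "d \<le> b"
  shows "abs_cont_on_interval f c d"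
proof -
  have "interval_family a b n s t" if "interval_family c d n s t" for n s t
    using that assms(2,3) unfolding interval_family_def by force
  then show ?thesis using assms(1) unfolding abs_cont_on_interval_iff by meson
qed

text \<open>Boundedness of the variation passes to the union of two adjacent intervals, and it holds
  with bound 1 on every interval shorter than the \<delta> belonging to \<epsilon> = 1. Bisection
  (\<open>Bolzano\<close>) carries it to the whole interval.\<close>

lemma abs_cont_on_interval_bounded_variation:
  fixes f :: "real \<Rightarrow> 'a::real_normed_vector"
  assumes ac: "abs_cont_on_interval f a b" and "a \<le> b"
  obtains M where "\<And>P. nonoverlapping a b P \<Longrightarrow> (\<Sum>p\<in>P. norm (f (snd p) - f (fst p))) \<le> M"
proof -
  let ?S = "\<lambda>P. \<Sum>p\<in>P. norm (f (snd p) - f (fst p))"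
  define Q where "Q u v \<longleftrightarrow> (a \<le> u \<and> v \<le> b \<longrightarrow> (\<exists>M. \<forall>P. nonoverlapping u v P \<longrightarrow> ?S P \<le> M))" for u v
  obtain \<delta> where \<delta>: "\<delta> > 0" "\<And>P. nonoverlapping a b P \<Longrightarrow> (\<Sum>p\<in>P. snd p - fst p) < \<delta> \<Longrightarrow> ?S P < 1"
    using abs_cont_on_interval_pairs[OF ac zero_less_one] by blast
  have "Q a b"
  proof (rule Bolzano[OF \<open>a \<le> b\<close>])
    fix u v w assume Q: "Q u v" "Q v w" "u \<le> v" "v \<le> w"
    show "Q u w" unfolding Q_def
    proof
      assume uw: "a \<le> u \<and> w \<le> b"
      obtain M1 M2 where M: "\<And>P. nonoverlapping u v P \<Longrightarrow> ?S P \<le> M1" "\<And>P. nonoverlapping v w P \<Longrightarrow> ?S P \<le> M2"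
        using Q uw unfolding Q_def by force
      have "?S P \<le> M1 + M2" if "nonoverlapping u w P" for P
        using nonoverlapping_cut[OF that Q(3,4), of f] M by (smt (verit))
      then show "\<exists>M. \<forall>P. nonoverlapping u w P \<longrightarrow> ?S P \<le> M" by blast
    qed
  next
    fix x assume "a \<le> x" "x \<le> b"
    have "Q u v" if uv: "u \<le> x" "x \<le> v" "v - u < \<delta>" for u v
      unfolding Q_def
    proof (intro impI exI allI)
      fix P assume "a \<le> u \<and> v \<le> b" "nonoverlapping u v P"
      moreover from this have "nonoverlapping a b P" unfolding nonoverlapping_def by force
      ultimately show "?S P \<le> 1" using \<delta>(2)[of P] nonoverlapping_length_le[of u v P] uv by fastforce
    qed
    with \<delta>(1) show "\<exists>d>0. \<forall>u v. u \<le> x \<and> x \<le> v \<and> v - u < d \<longrightarrow> Q u v" by blast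
  qed
  then show thesis using that unfolding Q_def by blast
qed

lemma abs_cont_on_interval_imp_continuous_on:
  fixes f :: "real \<Rightarrow> 'a::real_normed_vector"
  assumes ac: "abs_cont_on_interval f a b"
  shows "continuous_on {a..b} f"
  unfolding continuous_on_iff
proof (intro ballI allI impI)
  fix x \<epsilon> :: real assume x: "x \<in> {a..b}" and "\<epsilon> > 0"
  obtain \<delta> where \<delta>: "\<delta> > 0" "\<And>P. nonoverlapping a b P \<Longrightarrow> (\<Sum>p\<in>P. snd p - fst p) < \<delta> \<Longrightarrow> (\<Sum>p\<in>P. norm (f (snd p) - f (fst p))) < \<epsilon>"
    using abs_cont_on_interval_pairs[OF ac \<open>\<epsilon> > 0\<close>] by blast
  have "dist (f y) (f x) < \<epsilon>" if y: "y \<in> {a..b}" "dist y x < \<delta>" for y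
  proof (cases "x = y")
    case False
    have "nonoverlapping a b {(min x y, max x y)}" using x y False by (intro nonoverlappingI) (auto simp: min_def max_def)
    from \<delta>(2)[OF this] y show ?thesis by (auto simp: dist_norm min_def max_def abs_if norm_minus_commute split: if_splits)
  qed (use \<open>\<epsilon> > 0\<close> in auto)
  then show "\<exists>d>0. \<forall>x'\<in>{a..b}. dist x' x < d \<longrightarrow> dist (f x') (f x) < \<epsilon>" using \<delta>(1) by blast
qed

text \<open>One comparison principle covers real and imaginary parts, products, conjugates, linear
  combinations and compositions with a Lipschitz map: only increments matter.\<close>

lemma abs_cont_on_interval_dominated:
  assumes f: "abs_cont_on_interval f a b" and g: "abs_cont_on_interval g a b"
    and le: "\<And>s t. a \<le> s \<Longrightarrow> s \<le> t \<Longrightarrow> t \<le> b \<Longrightarrow> norm (F t - F s) \<le> K * (norm (f t - f s) + norm (g t - g s))"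
  shows "abs_cont_on_interval F a b"
  unfolding abs_cont_on_interval_iff
proof (intro allI impI)
  fix \<epsilon> :: real assume "\<epsilon> > 0"
  \<comment> \<open>K may be zero or negative, and \<epsilon> is divided by it below; hence the
    maximum with 1.\<close>
  define K' where "K' = max K 1"
  define e where "e = \<epsilon> / (2 * K')"
  have K': "K' > 0" "K \<le> K'" "e > 0" using \<open>\<epsilon> > 0\<close> by (auto simp: K'_def e_def)
  obtain \<delta>1 where \<delta>1: "\<delta>1 > 0" and ac1: "\<And>n s t. interval_family a b n s t \<Longrightarrow> (\<Sum>i<n. t i - s i) < \<delta>1
      \<Longrightarrow> (\<Sum>i<n. norm (f (t i) - f (s i))) < e"
    using f \<open>e > 0\<close> unfolding abs_cont_on_interval_iff by meson
  obtain \<delta>2 where \<delta>2: "\<delta>2 > 0" and ac2: "\<And>n s t. interval_family a b n s t \<Longrightarrow> (\<Sum>i<n. t i - s i) < \<delta>2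
      \<Longrightarrow> (\<Sum>i<n. norm (g (t i) - g (s i))) < e"
    using g \<open>e > 0\<close> unfolding abs_cont_on_interval_iff by meson
  show "\<exists>\<delta>>0. \<forall>n s t. interval_family a b n s t \<longrightarrow> (\<Sum>i<n. t i - s i) < \<delta> \<longrightarrow>
        (\<Sum>i<n. norm (F (t i) - F (s i))) < \<epsilon>"
  proof (intro exI[of _ "min \<delta>1 \<delta>2"] conjI allI impI)
    fix n s t
    assume fam: "interval_family a b n s t" and *: "(\<Sum>i<n. t i - s i) < min \<delta>1 \<delta>2"
    have "(\<Sum>i<n. norm (F (t i) - F (s i))) \<le> (\<Sum>i<n. K' * (norm (f (t i) - f (s i)) + norm (g (t i) - g (s i))))"
    proof (rule sum_mono)
      fix i assume "i \<in> {..<n}"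
      then have "norm (F (t i) - F (s i)) \<le> K * (norm (f (t i) - f (s i)) + norm (g (t i) - g (s i)))"
        using fam by (intro le) (auto simp: interval_family_def)
      also have "\<dots> \<le> K' * (norm (f (t i) - f (s i)) + norm (g (t i) - g (s i)))"
        using K' by (intro mult_right_mono) auto
      finally show "norm (F (t i) - F (s i)) \<le> K' * (norm (f (t i) - f (s i)) + norm (g (t i) - g (s i)))" .
    qed
    also have "\<dots> = K' * ((\<Sum>i<n. norm (f (t i) - f (s i))) + (\<Sum>i<n. norm (g (t i) - g (s i))))"
      by (simp add: sum_distrib_left sum.distrib distrib_left)
    also have "\<dots> < K' * (e + e)"
      using * K' by (intro mult_strict_left_mono add_strict_mono ac1[OF fam] ac2[OF fam]) auto
    also have "\<dots> = \<epsilon>" using K' by (simp add: e_def)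
    finally show "(\<Sum>i<n. norm (F (t i) - F (s i))) < \<epsilon>" .
  qed (use \<delta>1 \<delta>2 in auto)
qed

section \<open>Total variation and the density of an absolutely continuous function\<close>

text \<open>The supremum runs over all non-overlapping families, gaps allowed, rather than over
  partitions. For a \<le> b this is the usual total variation, since filling a gap only adds a
  nonnegative term; a competitor can be enlarged by simply inserting an interval.\<close>

definition variation :: "(real \<Rightarrow> 'a::real_normed_vector) \<Rightarrow> real \<Rightarrow> real \<Rightarrow> real" where
  "variation f a b = (SUP P\<in>{P. nonoverlapping a b P}. \<Sum>p\<in>P. norm (f (snd p) - f (fst p)))"

lemma nonoverlapping_empty: "nonoverlapping a b {}"
  by (simp add: nonoverlapping_def)

lemma variation_upper:
  assumes "abs_cont_on_interval f a b" "a \<le> b" "nonoverlapping a b P"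
  shows "(\<Sum>p\<in>P. norm (f (snd p) - f (fst p))) \<le> variation f a b"
proof -
  obtain M where "\<And>P. nonoverlapping a b P \<Longrightarrow> (\<Sum>p\<in>P. norm (f (snd p) - f (fst p))) \<le> M"
    using abs_cont_on_interval_bounded_variation[OF assms(1,2)] by blast
  then show ?thesis unfolding variation_def using assms(3)
    by (intro cSUP_upper bdd_aboveI2[where M=M]) auto
qed

lemma variation_least:
  assumes "\<And>P. nonoverlapping a b P \<Longrightarrow> (\<Sum>p\<in>P. norm (f (snd p) - f (fst p))) \<le> M"
  shows "variation f a b \<le> M"
  unfolding variation_def using assms nonoverlapping_empty by (intro cSUP_least) auto

lemma variation_approx:
  assumes "\<epsilon> > 0"
  shows "\<exists>P. nonoverlapping a b P \<and> variation f a b < (\<Sum>p\<in>P. norm (f (snd p) - f (fst p))) + \<epsilon>"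
proof (rule ccontr)
  assume *: "\<not> ?thesis"
  then have "(\<Sum>p\<in>P. norm (f (snd p) - f (fst p))) \<le> variation f a b - \<epsilon>" if "nonoverlapping a b P" for P
    using * that by force
  from variation_least[of a b f, OF this] show False using assms by auto
qed

lemma variation_cut:
  assumes ac: "abs_cont_on_interval f a b" and c: "a \<le> c" "c \<le> b"
  shows "variation f a b \<le> variation f a c + variation f c b"
proof (rule variation_least)
  fix P assume "nonoverlapping a b P"
  then obtain P1 P2 where P: "nonoverlapping a c P1" "nonoverlapping c b P2"
    "(\<Sum>p\<in>P. norm (f (snd p) - f (fst p))) \<le>
       (\<Sum>p\<in>P1. norm (f (snd p) - f (fst p))) + (\<Sum>p\<in>P2. norm (f (snd p) - f (fst p)))"
    using nonoverlapping_cut[OF _ c] by blast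
  then show "(\<Sum>p\<in>P. norm (f (snd p) - f (fst p))) \<le> variation f a c + variation f c b"
    using variation_upper[OF abs_cont_on_interval_subset[OF ac order_refl c(2)] c(1) P(1)]
      variation_upper[OF abs_cont_on_interval_subset[OF ac c(1) order_refl] c(2) P(2)] by linarith
qed

text \<open>Adding the interval (c, b) to a family in [a, c] gives a competitor on [a, b]. The
  consequence used later is that the variation function V and the difference V - f are both
  nondecreasing.\<close>

lemma variation_increment:
  assumes ac: "abs_cont_on_interval f a b" and c: "a \<le> c" "c \<le> b"
  shows "variation f a c + norm (f b - f c) \<le> variation f a b"
proof (cases "c = b")
  case False
  have "variation f a c \<le> variation f a b - norm (f b - f c)"
  proof (rule variation_least)
    fix P assume P: "nonoverlapping a c P"
    note PD = nonoverlappingD[OF P]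
    have "(c, b) \<notin> P" using PD(4)[of "(c,b)"] False c by auto
    have "nonoverlapping a b (insert (c, b) P)"
    proof (rule nonoverlappingI)
      fix p p' assume *: "p \<in> insert (c, b) P" "p' \<in> insert (c, b) P" "p \<noteq> p'"
      then show "{fst p<..<snd p} \<inter> {fst p'<..<snd p'} = {}"
        using PD(4)[of p] PD(4)[of p'] PD(5)[of p p'] by fastforce
    next
      fix p assume "p \<in> insert (c, b) P"
      then show "a \<le> fst p \<and> fst p < snd p \<and> snd p \<le> b" using PD(2,3,4)[of p] c False by auto
    qed (use PD(1) in auto)
    from variation_upper[OF ac _ this] c \<open>(c, b) \<notin> P\<close> PD(1)
    show "(\<Sum>p\<in>P. norm (f (snd p) - f (fst p))) \<le> variation f a b - norm (f b - f c)" by simp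
  qed
  then show ?thesis by simp
qed simp

text \<open>Each interval of the family is replaced by a nearly optimal family inside it. The union
  is again non-overlapping and not longer in total, so the \<delta> of f applies to it.\<close>

lemma variation_absolutely_continuous:
  assumes ac: "abs_cont_on_interval f a b" and "\<epsilon> > 0"
  obtains \<delta> where "\<delta> > 0"
    "\<And>P. nonoverlapping a b P \<Longrightarrow> (\<Sum>p\<in>P. snd p - fst p) < \<delta>
       \<Longrightarrow> (\<Sum>p\<in>P. variation f a (snd p) - variation f a (fst p)) < \<epsilon>"
proof -
  obtain \<delta> where \<delta>: "\<delta> > 0" "\<And>P. nonoverlapping a b P \<Longrightarrow> (\<Sum>p\<in>P. snd p - fst p) < \<delta>
      \<Longrightarrow> (\<Sum>p\<in>P. norm (f (snd p) - f (fst p))) < \<epsilon>/2"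
    using abs_cont_on_interval_pairs[OF ac half_gt_zero[OF \<open>\<epsilon> > 0\<close>]] by blast
  show thesis
  proof (rule that[OF \<delta>(1)])
    fix P assume P: "nonoverlapping a b P" and len: "(\<Sum>p\<in>P. snd p - fst p) < \<delta>"
    note PD = nonoverlappingD[OF P]
    \<comment> \<open>The defects of the \<open>card P\<close> choices add up to at most
      \<epsilon>/2, and the sum over the union is below \<epsilon>/2. The added 1 covers the empty
      family.\<close>
    define e where "e = \<epsilon> / (2 * (card P + 1))"
    have "e > 0" using \<open>\<epsilon> > 0\<close> by (simp add: e_def)
    have "\<exists>Q. nonoverlapping (fst p) (snd p) Q \<and> variation f (fst p) (snd p) < (\<Sum>p\<in>Q. norm (f (snd p) - f (fst p))) + e" for p
      using variation_approx[OF \<open>e > 0\<close>] by metis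
    then obtain Q where Q: "\<And>p. nonoverlapping (fst p) (snd p) (Q p)"
      "\<And>p. variation f (fst p) (snd p) < (\<Sum>p\<in>Q p. norm (f (snd p) - f (fst p))) + e" by metis
    note QD = nonoverlappingD[OF Q(1)]
    have sub: "{fst u<..<snd u} \<subseteq> {fst p<..<snd p}" if "u \<in> Q p" for u p
      using QD(2,4)[OF that] by auto
    have cross: "{fst u<..<snd u} \<inter> {fst v<..<snd v} = {}" if "u \<in> Q p" "v \<in> Q p'" "p \<in> P" "p' \<in> P" "p \<noteq> p'" for u v p p'
      using sub[OF that(1)] sub[OF that(2)] PD(5)[OF that(3-5)] by blast
    have disj: "Q p \<inter> Q p' = {}" if "p \<in> P" "p' \<in> P" "p \<noteq> p'" for p p'
    proof (rule ccontr)
      assume "Q p \<inter> Q p' \<noteq> {}"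
      then obtain u where "u \<in> Q p" "u \<in> Q p'" by blast
      with cross[OF this that] QD(3)[of u p] show False by simp
    qed
    have un: "(\<Sum>u\<in>(\<Union>p\<in>P. Q p). g u) = (\<Sum>p\<in>P. \<Sum>u\<in>Q p. g u)" for g :: "real \<times> real \<Rightarrow> real"
      using PD(1) QD(1) disj by (intro sum.UNION_disjoint) auto
    have N: "nonoverlapping a b (\<Union>p\<in>P. Q p)"
    proof (rule nonoverlappingI)
      fix u assume "u \<in> (\<Union>p\<in>P. Q p)"
      then obtain p where "p \<in> P" "u \<in> Q p" by blast
      then show "a \<le> fst u \<and> fst u < snd u \<and> snd u \<le> b" using PD(2,4)[of p] QD(2,3,4)[of u p] by auto
    next
      fix u v assume "u \<in> (\<Union>p\<in>P. Q p)" "v \<in> (\<Union>p\<in>P. Q p)" "u \<noteq> v"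
      then obtain p p' where *: "p \<in> P" "u \<in> Q p" "p' \<in> P" "v \<in> Q p'" by blast
      show "{fst u<..<snd u} \<inter> {fst v<..<snd v} = {}"
      proof (cases "p = p'")
        case True
        with * \<open>u \<noteq> v\<close> QD(5)[of u p v] show ?thesis by blast
      next
        case False
        with * cross show ?thesis by blast
      qed
    qed (use PD(1) QD(1) in auto)
    have "(\<Sum>u\<in>(\<Union>p\<in>P. Q p). snd u - fst u) = (\<Sum>p\<in>P. \<Sum>u\<in>Q p. snd u - fst u)" by (rule un)
    also have "\<dots> \<le> (\<Sum>p\<in>P. snd p - fst p)"
      using nonoverlapping_length_le[OF Q(1)] PD(3) by (intro sum_mono) (auto simp: less_imp_le)
    finally have *: "(\<Sum>u\<in>(\<Union>p\<in>P. Q p). norm (f (snd u) - f (fst u))) < \<epsilon>/2"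
      using \<delta>(2)[OF N] len by linarith
    have "(\<Sum>p\<in>P. variation f a (snd p) - variation f a (fst p)) \<le> (\<Sum>p\<in>P. (\<Sum>u\<in>Q p. norm (f (snd u) - f (fst u))) + e)"
    proof (rule sum_mono)
      fix p assume p: "p \<in> P"
      have "variation f a (snd p) \<le> variation f a (fst p) + variation f (fst p) (snd p)"
        using PD(2,3,4)[OF p] by (intro variation_cut abs_cont_on_interval_subset[OF ac]) auto
      then show "variation f a (snd p) - variation f a (fst p) \<le> (\<Sum>u\<in>Q p. norm (f (snd u) - f (fst u))) + e"
        using Q(2)[of p] by linarith
    qed
    also have "\<dots> = (\<Sum>u\<in>(\<Union>p\<in>P. Q p). norm (f (snd u) - f (fst u))) + card P * e"
      by (simp add: un sum.distrib)
    also have "card P * e \<le> \<epsilon>/2" using \<open>\<epsilon> > 0\<close> by (simp add: e_def field_simps)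
    finally show "(\<Sum>p\<in>P. variation f a (snd p) - variation f a (fst p)) < \<epsilon>" using * by linarith
  qed
qed

text \<open>A nondecreasing function that is absolutely continuous induces a measure dominated by
  Lebesgue measure; its Radon--Nikodym density is the derivative.\<close>
lemma mono_absolutely_continuous_density:
  fixes F :: "real \<Rightarrow> real"
  assumes "a \<le> b" and mono: "\<And>x y. a \<le> x \<Longrightarrow> x \<le> y \<Longrightarrow> y \<le> b \<Longrightarrow> F x \<le> F y"
    and ac: "\<And>\<epsilon>. \<epsilon> > 0 \<Longrightarrow> \<exists>\<delta>>0. \<forall>P. nonoverlapping a b P \<longrightarrow> (\<Sum>p\<in>P. snd p - fst p) < \<delta>
       \<longrightarrow> (\<Sum>p\<in>P. F (snd p) - F (fst p)) < \<epsilon>"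
  obtains h where "h absolutely_integrable_on {a..b}"
    "\<And>x. x \<in> {a..b} \<Longrightarrow> (h has_integral F x - F a) {a..x}"
proof -
  \<comment> \<open>F is extended by its end values, so the Stieltjes measure of \<open>G\<close> is
    defined on the whole line but has no mass outside [a, b].\<close>
  define G where "G x = F (max a (min b x))" for x
  define \<mu> where "\<mu> = interval_measure G"
  have clamp: "max a (min b x) \<in> {a..b}" for x using \<open>a \<le> b\<close> by auto
  have Gmono: "G x \<le> G y" if "x \<le> y" for x y
    unfolding G_def using that \<open>a \<le> b\<close> by (intro mono) auto
  have contF: "continuous_on {a..b} F"
    unfolding continuous_on_iff
  proof (intro ballI allI impI)
    fix x \<epsilon> :: real assume x: "x \<in> {a..b}" and "\<epsilon> > 0"
    obtain \<delta> where \<delta>: "\<delta> > 0" "\<And>P. nonoverlapping a b P \<Longrightarrow> (\<Sum>p\<in>P. snd p - fst p) < \<delta> \<Longrightarrow> (\<Sum>p\<in>P. F (snd p) - F (fst p)) < \<epsilon>"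
      using ac[OF \<open>\<epsilon> > 0\<close>] by blast
    have "dist (F y) (F x) < \<epsilon>" if y: "y \<in> {a..b}" "dist y x < \<delta>" for y
    proof (cases "x = y")
      case False
      have "nonoverlapping a b {(min x y, max x y)}" using x y False by (intro nonoverlappingI) (auto simp: min_def max_def)
      from \<delta>(2)[OF this] y mono[of x y] mono[of y x] x show ?thesis
        by (auto simp: dist_norm min_def max_def abs_if split: if_splits)
    qed (use \<open>\<epsilon> > 0\<close> in auto)
    then show "\<exists>d>0. \<forall>x'\<in>{a..b}. dist x' x < d \<longrightarrow> dist (F x') (F x) < \<epsilon>" using \<delta>(1) by blast
  qed
  have contG: "continuous_on UNIV G"
    unfolding G_def
    by (rule continuous_on_compose2[OF contF]) (use clamp in \<open>auto intro!: continuous_intros\<close>)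
  then have contG': "continuous (at_right x) G" for x
    by (metis UNIV_I continuous_at_imp_continuous_within continuous_on_eq_continuous_at open_UNIV)
  have ivl: "emeasure \<mu> {x<..y} = G y - G x" if "x \<le> y" for x y
    unfolding \<mu>_def using emeasure_interval_measure_Ioc[OF that Gmono contG'] .
  have ivlc: "emeasure \<mu> {x..y} = G y - G x" if "x \<le> y" for x y
    unfolding \<mu>_def by (rule emeasure_interval_measure_Icc[OF that Gmono contG])
  have sets\<mu>: "sets \<mu> = sets lborel" by (simp add: \<mu>_def)
  have outside: "emeasure \<mu> {..<a} = 0" "emeasure \<mu> {b<..} = 0"
  proof -
    have "{..<a} \<subseteq> (\<Union>n::nat. {a - real n..a})"
    proof
      fix x assume "x \<in> {..<a}"
      moreover obtain n where "a - x \<le> real n" using real_arch_simple by blast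
      ultimately show "x \<in> (\<Union>n::nat. {a - real n..a})" by (auto intro!: exI[of _ n])
    qed
    moreover have "emeasure \<mu> (\<Union>n::nat. {a - real n..a}) = 0"
      using ivlc[of "a - real n" a for n] \<open>a \<le> b\<close> sets\<mu>
      by (intro emeasure_UN_eq_0) (auto simp: G_def min_def max_def)
    ultimately have "emeasure \<mu> {..<a} \<le> 0"
      using emeasure_mono[of "{..<a}" "\<Union>n::nat. {a - real n..a}" \<mu>] sets\<mu> by simp
    then show "emeasure \<mu> {..<a} = 0" by simp
    have "{b<..} \<subseteq> (\<Union>n::nat. {b..b + real n})"
    proof
      fix x assume "x \<in> {b<..}"
      moreover obtain n where "x - b \<le> real n" using real_arch_simple by blast
      ultimately show "x \<in> (\<Union>n::nat. {b..b + real n})" by (auto intro!: exI[of _ n])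
    qed
    moreover have "emeasure \<mu> (\<Union>n::nat. {b..b + real n}) = 0"
      using ivlc[of b "b + real n" for n] \<open>a \<le> b\<close> sets\<mu>
      by (intro emeasure_UN_eq_0) (auto simp: G_def min_def max_def)
    ultimately have "emeasure \<mu> {b<..} \<le> 0"
      using emeasure_mono[of "{b<..}" "\<Union>n::nat. {b..b + real n}" \<mu>] sets\<mu> by simp
    then show "emeasure \<mu> {b<..} = 0" by simp
  qed
  \<comment> \<open>A null subset of [a, b] is covered by countably many closed intervals with
    disjoint interiors and total length below \<delta>. Every finite subfamily has measure at most
    \<epsilon> by \<open>ac\<close>, and continuity from below extends this to the whole
    cover.\<close>
  have "absolutely_continuous lborel \<mu>"
    unfolding absolutely_continuous_def
  proof
    fix N assume N: "N \<in> null_sets (lborel :: real measure)"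
    then have Nb: "N \<in> sets borel" by auto
    let ?N = "N \<inter> {a..b}"
    have Ns: "?N \<in> sets \<mu>" using Nb sets\<mu> by auto
    have "?N \<in> null_sets lborel" using N by (simp add: null_set_Int2)
    then have "negligible ?N" by (simp add: negligible_iff_null_sets null_sets_completionI)
    then have Nl: "?N \<in> lmeasurable" "measure lebesgue ?N = 0"
      using negligible_imp_measurable negligible_imp_measure0 by blast+
    have "emeasure \<mu> ?N \<le> ennreal \<epsilon>" if "\<epsilon> > 0" for \<epsilon> :: real
    proof -
      obtain \<delta> where \<delta>: "\<delta> > 0" "\<And>P. nonoverlapping a b P \<Longrightarrow> (\<Sum>p\<in>P. snd p - fst p) < \<delta> \<Longrightarrow> (\<Sum>p\<in>P. F (snd p) - F (fst p)) < \<epsilon>"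
        using ac[OF \<open>\<epsilon> > 0\<close>] by blast
      show ?thesis
      \<comment> \<open>For a = b the covering intervals may be single points, which
        \<open>nonoverlapping\<close> excludes. There it suffices that \<open>G\<close> is
        continuous, so that points have measure zero.\<close>
      proof (cases "a = b")
        case True
        have "?N \<subseteq> {a..a}" using True by auto
        then have "emeasure \<mu> ?N \<le> emeasure \<mu> {a..a}" by (rule emeasure_mono) (simp add: sets\<mu>)
        then show ?thesis using ivlc[of a a] by (simp del: atLeastAtMost_singleton atLeastAtMost_singleton_iff)
      next
        case False
        obtain \<D> where D: "countable \<D>"
          "\<And>K. K \<in> \<D> \<Longrightarrow> K \<subseteq> cbox a b \<and> K \<noteq> {} \<and> (\<exists>c d. K = cbox c d)"
          "pairwise (\<lambda>A B. interior A \<inter> interior B = {}) \<D>"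
          "\<And>u v. cbox u v \<in> \<D> \<Longrightarrow> \<exists>n. \<forall>i\<in>Basis. v \<bullet> i - u \<bullet> i = (b \<bullet> i - a \<bullet> i) / 2 ^ n"
          "\<And>K. \<lbrakk>K \<in> \<D>; box a b \<noteq> {}\<rbrakk> \<Longrightarrow> interior K \<noteq> {}"
          "?N \<subseteq> \<Union>\<D>" "\<Union>\<D> \<in> lmeasurable" "measure lebesgue (\<Union>\<D>) \<le> measure lebesgue ?N + \<delta>/2"
          by (rule measurable_outer_intervals_bounded[OF Nl(1) _ _ that, of a b "\<delta>/2"]) (use \<delta>(1) in auto)
        have DK: "K = {Inf K..Sup K} \<and> a \<le> Inf K \<and> Inf K < Sup K \<and> Sup K \<le> b" if K: "K \<in> \<D>" for K
        proof -
          obtain c d where cd: "K = {c..d}" using D(2)[OF K] by auto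
          moreover have "interior K \<noteq> {}" using D(5)[OF K] False \<open>a \<le> b\<close> by auto
          ultimately have "c < d" by (auto simp: interior_atLeastAtMost_real)
          then show ?thesis using cd D(2)[OF K] by auto
        qed
        have fin: "(\<Sum>K\<in>\<F>. emeasure \<mu> K) \<le> ennreal \<epsilon>" if F: "finite \<F>" "\<F> \<subseteq> \<D>" for \<F>
        proof -
          let ?p = "\<lambda>K::real set. (Inf K, Sup K)"
          have inj: "inj_on ?p \<F>"
            using DK F(2) by (intro inj_onI) (metis (no_types, lifting) Pair_inject subsetD)
          have DK': "K = {Inf K..Sup K}" "a \<le> Inf K" "Inf K < Sup K" "Sup K \<le> b" if "K \<in> \<F>" for K
            using DK F(2) that by blast+
          have no: "nonoverlapping a b (?p ` \<F>)"
          proof (rule nonoverlappingI)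
            fix p p' assume "p \<in> ?p ` \<F>" "p' \<in> ?p ` \<F>" "p \<noteq> p'"
            then obtain K K' where K: "K \<in> \<F>" "K' \<in> \<F>" "K \<noteq> K'" "p = ?p K" "p' = ?p K'" by auto
            then have "interior K \<inter> interior K' = {}" using D(3) F(2) unfolding pairwise_def by blast
            then show "{fst p<..<snd p} \<inter> {fst p'<..<snd p'} = {}"
              using DK'(1)[OF K(1)] DK'(1)[OF K(2)] K(4,5) interior_atLeastAtMost_real by (metis fst_conv snd_conv)
          qed (use F(1) DK'(2-4) in auto)
          have "(\<Sum>p\<in>?p ` \<F>. snd p - fst p) = (\<Sum>K\<in>\<F>. measure lebesgue K)"
            unfolding sum.reindex[OF inj]
          proof (rule sum.cong[OF refl])
            fix K assume K: "K \<in> \<F>"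
            have "measure lebesgue K = measure lebesgue {Inf K..Sup K}" using DK'(1)[OF K] by simp
            then show "((\<lambda>p. snd p - fst p) \<circ> ?p) K = measure lebesgue K"
              using DK'(3)[OF K] by simp
          qed
          also have "\<dots> = measure lebesgue (\<Union>\<F>)"
          proof -
            have "negligible (K \<inter> K')" if "K \<in> \<F>" "K' \<in> \<F>" "K \<noteq> K'" for K K'
            proof -
              have "interior (K \<inter> K') = {}" using D(3) F(2) that unfolding pairwise_def by auto
              moreover have "convex (K \<inter> K')" using DK'(1)[OF that(1)] DK'(1)[OF that(2)]
                by (metis convex_Int convex_closed_interval convex_box(1) cbox_interval convex_real_interval(5))
              ultimately show ?thesis by (simp add: negligible_convex_interior)
            qed
            moreover have "\<And>K. K \<in> \<F> \<Longrightarrow> K \<in> lmeasurable" using DK'(1) by (metis cbox_interval lmeasurable_cbox)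
            ultimately show ?thesis
              by (intro measure_negligible_finite_Union[symmetric] F(1)) (auto simp: pairwise_def)
          qed
          also have "\<dots> \<le> measure lebesgue (\<Union>\<D>)"
            using F D(7) DK'(1) by (intro measure_mono_fmeasurable) (auto intro!: sets.finite_Union, metis cbox_interval lmeasurable_cbox fmeasurableD)
          also have "\<dots> < \<delta>" using D(8) Nl(2) \<delta>(1) by simp
          finally have *: "(\<Sum>p\<in>?p ` \<F>. F (snd p) - F (fst p)) < \<epsilon>" using \<delta>(2)[OF no] by blast
          have "(\<Sum>K\<in>\<F>. emeasure \<mu> K) = (\<Sum>K\<in>\<F>. ennreal (F (Sup K) - F (Inf K)))"
          proof (rule sum.cong[OF refl])
            fix K assume K: "K \<in> \<F>"
            have "emeasure \<mu> K = emeasure \<mu> {Inf K..Sup K}" using DK'(1)[OF K] by simp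
            also have "\<dots> = ennreal (F (Sup K) - F (Inf K))"
              using DK'(2-4)[OF K] by (subst ivlc) (auto simp: G_def min_def max_def)
            finally show "emeasure \<mu> K = ennreal (F (Sup K) - F (Inf K))" .
          qed
          also have "\<dots> = ennreal (\<Sum>K\<in>\<F>. F (Sup K) - F (Inf K))"
            using DK'(2-4) mono by (intro sum_ennreal) (simp add: less_imp_le)
          also have "(\<Sum>K\<in>\<F>. F (Sup K) - F (Inf K)) = (\<Sum>p\<in>?p ` \<F>. F (snd p) - F (fst p))"
            by (simp add: sum.reindex[OF inj])
          finally show ?thesis using * by (simp add: ennreal_leI less_imp_le)
        qed
        have Ks: "K \<in> sets \<mu>" if "K \<in> \<D>" for K
          using DK[OF that] sets\<mu> by (metis borel_closed closed_atLeastAtMost sets_lborel)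
        have "emeasure \<mu> ?N \<le> emeasure \<mu> (\<Union>\<D>)"
          using D(6) Ks D(1) by (intro emeasure_mono sets.countable_Union) auto
        also have "\<dots> \<le> ennreal \<epsilon>"
        proof (cases "\<D> = {}")
          case False
          define A where "A n = \<Union>(from_nat_into \<D> ` {..<n})" for n
          have fD: "from_nat_into \<D> i \<in> \<D>" for i using from_nat_into[OF False] .
          have "\<Union>\<D> = \<Union>(range (from_nat_into \<D>))"
            using range_from_nat_into[OF False D(1)] by simp
          also have "\<dots> = (\<Union>n. A n)"
            unfolding A_def by (auto intro: lessI)
          finally have "\<Union>\<D> = (\<Union>n. A n)" .
          moreover have "emeasure \<mu> (\<Union>n. A n) = (SUP n. emeasure \<mu> (A n))"
          proof (rule SUP_emeasure_incseq[symmetric])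
            show "range A \<subseteq> sets \<mu>" using Ks fD by (auto simp: A_def)
            show "incseq A" by (intro incseq_SucI) (auto simp: A_def lessThan_Suc)
          qed
          moreover have "emeasure \<mu> (A n) \<le> ennreal \<epsilon>" for n
          proof -
            have "emeasure \<mu> (A n) \<le> (\<Sum>K\<in>from_nat_into \<D> ` {..<n}. emeasure \<mu> K)"
              using emeasure_subadditive_finite[of "from_nat_into \<D> ` {..<n}" id \<mu>] Ks fD
              by (auto simp: A_def)
            also have "\<dots> \<le> ennreal \<epsilon>" using fD by (intro fin) auto
            finally show ?thesis .
          qed
          ultimately show ?thesis by (simp add: SUP_le_iff)
        qed simp
        finally show ?thesis .
      qed
    qed
    then have "emeasure \<mu> ?N \<le> 0 + ennreal \<epsilon>" if "\<epsilon> > 0" for \<epsilon> :: real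
      using that by simp
    then have "emeasure \<mu> ?N \<le> 0" by (rule ennreal_le_epsilon)
    then have "emeasure \<mu> ?N = 0" by simp
    then have "?N \<in> null_sets \<mu>" using Ns by (rule null_setsI)
    moreover have "{..<a} \<in> sets \<mu>" "{b<..} \<in> sets \<mu>" unfolding sets\<mu> by simp_all
    then have "{..<a} \<in> null_sets \<mu>" "{b<..} \<in> null_sets \<mu>"
      using outside null_setsI by blast+
    ultimately have "?N \<union> {..<a} \<union> {b<..} \<in> null_sets \<mu>" by (intro null_sets.Un)
    then show "N \<in> null_sets \<mu>"
      by (rule null_sets_subset) (use Nb sets\<mu> in auto)
  qed
  then obtain g where g: "g \<in> borel_measurable lborel" "density lborel g = \<mu>"
    using sigma_finite_measure.Radon_Nikodym[OF sigma_finite_lborel _ sets\<mu>] by blast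
  have gint: "(\<integral>\<^sup>+y. g y * indicator {a..x} y \<partial>lborel) = ennreal (F x - F a)" if x: "x \<in> {a..b}" for x
    using emeasure_density[OF g(1), of "{a..x}"] ivlc[of a x] x unfolding g(2)
    by (auto simp: G_def min_def max_def split: if_splits)
  have fin: "AE y in lborel. g y * indicator {a..b} y \<noteq> \<infinity>"
    using gint[of b] \<open>a \<le> b\<close> g(1) by (intro nn_integral_PInf_AE) auto
  \<comment> \<open>The density \<open>g\<close> takes extended values; its integral over [a, b] is
    finite, so on [a, b] it is finite, and equal to \<open>h\<close>, off a null set.\<close>
  define h where "h y = enn2real (g y)" for y
  have hm: "h \<in> borel_measurable borel" unfolding h_def using g(1) by simp
  have hpos: "h y \<ge> 0" for y by (simp add: h_def)
  have hint: "(h has_integral F x - F a) {a..x}" if x: "x \<in> {a..b}" for x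
  proof -
    have "(\<integral>\<^sup>+y. ennreal (h y * indicator {a..x} y) \<partial>lborel) = (\<integral>\<^sup>+y. g y * indicator {a..x} y \<partial>lborel)"
      using fin by (intro nn_integral_cong_AE, eventually_elim)
        (use x hpos in \<open>auto simp: h_def indicator_def ennreal_enn2real_if split: if_splits\<close>)
    then have "((\<lambda>y. h y * indicator {a..x} y) has_integral F x - F a) UNIV"
      using hm gint[OF x] mono[of a x] x
      by (intro nn_integral_has_integral borel_measurable_times borel_measurable_indicator) (auto simp: hpos)
    moreover have "(\<lambda>y. h y * indicator {a..x} y) = (\<lambda>y. if y \<in> {a..x} then h y else 0)" by auto
    ultimately show ?thesis by (simp only: has_integral_restrict_UNIV)
  qed
  show thesis
  proof (rule that[OF _ hint])
    show "h absolutely_integrable_on {a..b}"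
      using hint[of b] \<open>a \<le> b\<close> hpos by (intro nonnegative_absolutely_integrable_1) auto
  qed
qed

text \<open>Jordan decomposition f = V - (V - f) with V the variation function: both parts are
  nondecreasing and absolutely continuous, so each has a density.\<close>

lemma abs_cont_on_interval_real_density:
  fixes f :: "real \<Rightarrow> real"
  assumes ac: "abs_cont_on_interval f a b" and "a \<le> b"
  obtains h where "h absolutely_integrable_on {a..b}"
    "\<And>x. x \<in> {a..b} \<Longrightarrow> (h has_integral f x - f a) {a..x}"
proof -
  define V where "V x = variation f a x" for x
  have inc: "V x + norm (f y - f x) \<le> V y" if "a \<le> x" "x \<le> y" "y \<le> b" for x y
    unfolding V_def using that by (intro variation_increment abs_cont_on_interval_subset[OF ac]) auto
  have Vac: "\<exists>\<delta>>0. \<forall>P. nonoverlapping a b P \<longrightarrow> (\<Sum>p\<in>P. snd p - fst p) < \<delta>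
       \<longrightarrow> (\<Sum>p\<in>P. V (snd p) - V (fst p)) < \<epsilon>" if "\<epsilon> > 0" for \<epsilon>
    using variation_absolutely_continuous[OF ac that] unfolding V_def by metis
  obtain h1 where h1: "h1 absolutely_integrable_on {a..b}"
    "\<And>x. x \<in> {a..b} \<Longrightarrow> (h1 has_integral V x - V a) {a..x}"
  proof (rule mono_absolutely_continuous_density[OF \<open>a \<le> b\<close> _ Vac that])
    show "V x \<le> V y" if "a \<le> x" "x \<le> y" "y \<le> b" for x y
      using inc[OF that] norm_ge_zero[of "f y - f x"] by linarith
  qed
  have Wac: "\<exists>\<delta>>0. \<forall>P. nonoverlapping a b P \<longrightarrow> (\<Sum>p\<in>P. snd p - fst p) < \<delta>
       \<longrightarrow> (\<Sum>p\<in>P. (V (snd p) - f (snd p)) - (V (fst p) - f (fst p))) < \<epsilon>" if \<epsilon>: "\<epsilon> > 0" for \<epsilon>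
  proof -
    obtain \<delta> where \<delta>: "\<delta> > 0" "\<And>P. nonoverlapping a b P \<Longrightarrow> (\<Sum>p\<in>P. snd p - fst p) < \<delta>
       \<Longrightarrow> (\<Sum>p\<in>P. V (snd p) - V (fst p)) < \<epsilon>/2" using Vac[OF half_gt_zero[OF \<epsilon>]] by blast
    show ?thesis
    proof (intro exI[of _ \<delta>] conjI allI impI \<delta>(1))
      fix P assume P: "nonoverlapping a b P" "(\<Sum>p\<in>P. snd p - fst p) < \<delta>"
      \<comment> \<open>Increments of f are bounded in modulus by those of \<open>V\<close>, so
        increments of V - f are at most twice those of \<open>V\<close>.\<close>
      have "(\<Sum>p\<in>P. (V (snd p) - f (snd p)) - (V (fst p) - f (fst p))) \<le> (\<Sum>p\<in>P. 2 * (V (snd p) - V (fst p)))"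
      proof (rule sum_mono)
        fix p assume "p \<in> P"
        then show "(V (snd p) - f (snd p)) - (V (fst p) - f (fst p)) \<le> 2 * (V (snd p) - V (fst p))"
          using nonoverlappingD(2-4)[OF P(1)] inc[of "fst p" "snd p"] by (fastforce simp: abs_if split: if_splits)
      qed
      also have "\<dots> < \<epsilon>" using \<delta>(2)[OF P] by (simp only: sum_distrib_left[symmetric])
      finally show "(\<Sum>p\<in>P. (V (snd p) - f (snd p)) - (V (fst p) - f (fst p))) < \<epsilon>" .
    qed
  qed
  obtain h2 where h2: "h2 absolutely_integrable_on {a..b}"
    "\<And>x. x \<in> {a..b} \<Longrightarrow> (h2 has_integral (V x - f x) - (V a - f a)) {a..x}"
  proof (rule mono_absolutely_continuous_density[OF \<open>a \<le> b\<close> _ Wac that])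
    show "V x - f x \<le> V y - f y" if "a \<le> x" "x \<le> y" "y \<le> b" for x y
      using inc[OF that] by (simp add: abs_if split: if_splits)
  qed
  show thesis
  proof (rule that)
    show "(\<lambda>x. h1 x - h2 x) absolutely_integrable_on {a..b}" using h1(1) h2(1) by (rule set_integral_diff(1))
    fix x assume "x \<in> {a..b}"
    from has_integral_diff[OF h1(2)[OF this] h2(2)[OF this]]
    show "((\<lambda>x. h1 x - h2 x) has_integral f x - f a) {a..x}" by (simp add: algebra_simps)
  qed
qed

lemma absolutely_integrable_Complex:
  assumes "h1 absolutely_integrable_on S" "h2 absolutely_integrable_on S"
  shows "(\<lambda>x. Complex (h1 x) (h2 x)) absolutely_integrable_on S"
proof -
  have "(\<lambda>x. of_real (h1 x) + \<i> * of_real (h2 x)) absolutely_integrable_on S"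
    by (intro set_integral_add(1) set_integrable_mult_right absolutely_integrable_linear[OF assms(1) bounded_linear_of_real, unfolded o_def]
        absolutely_integrable_linear[OF assms(2) bounded_linear_of_real, unfolded o_def])
  then show ?thesis by (simp add: Complex_eq)
qed

lemma abs_cont_on_interval_density:
  fixes f :: "real \<Rightarrow> complex"
  assumes ac: "abs_cont_on_interval f a b" and "a \<le> b"
  obtains h where "h absolutely_integrable_on {a..b}"
    "\<And>x. x \<in> {a..b} \<Longrightarrow> (h has_integral f x - f a) {a..x}"
proof -
  have re: "abs_cont_on_interval (\<lambda>x. Re (f x)) a b" and im: "abs_cont_on_interval (\<lambda>x. Im (f x)) a b"
  proof -
    have "norm (Re (f t) - Re (f s)) \<le> 1 * (norm (f t - f s) + norm (f t - f s))" for t s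
      using abs_Re_le_cmod[of "f t - f s"] norm_ge_zero[of "f t - f s"] unfolding real_norm_def minus_complex.sel mult_1 by linarith
    then show "abs_cont_on_interval (\<lambda>x. Re (f x)) a b" by (intro abs_cont_on_interval_dominated[OF ac ac])
    have "norm (Im (f t) - Im (f s)) \<le> 1 * (norm (f t - f s) + norm (f t - f s))" for t s
      using abs_Im_le_cmod[of "f t - f s"] norm_ge_zero[of "f t - f s"] unfolding real_norm_def minus_complex.sel mult_1 by linarith
    then show "abs_cont_on_interval (\<lambda>x. Im (f x)) a b" by (intro abs_cont_on_interval_dominated[OF ac ac])
  qed
  obtain h1 where h1: "h1 absolutely_integrable_on {a..b}"
    "\<And>x. x \<in> {a..b} \<Longrightarrow> (h1 has_integral Re (f x) - Re (f a)) {a..x}"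
    using abs_cont_on_interval_real_density[OF re \<open>a \<le> b\<close>] by blast
  obtain h2 where h2: "h2 absolutely_integrable_on {a..b}"
    "\<And>x. x \<in> {a..b} \<Longrightarrow> (h2 has_integral Im (f x) - Im (f a)) {a..x}"
    using abs_cont_on_interval_real_density[OF im \<open>a \<le> b\<close>] by blast
  show thesis
  proof (rule that)
    show "(\<lambda>x. Complex (h1 x) (h2 x)) absolutely_integrable_on {a..b}"
      by (rule absolutely_integrable_Complex[OF h1(1) h2(1)])
    fix x assume x: "x \<in> {a..b}"
    have "((\<lambda>x. of_real (h1 x) + \<i> * of_real (h2 x)) has_integral
        (of_real (Re (f x) - Re (f a)) + \<i> * of_real (Im (f x) - Im (f a)))) {a..x}"
      by (intro has_integral_add has_integral_mult_right has_integral_linear[OF h1(2)[OF x] bounded_linear_of_real, unfolded o_def]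
        has_integral_linear[OF h2(2)[OF x] bounded_linear_of_real, unfolded o_def])
    moreover have "of_real (Re (f x) - Re (f a)) + \<i> * of_real (Im (f x) - Im (f a)) = f x - f a"
      by (simp add: complex_eq_iff)
    ultimately show "((\<lambda>x. Complex (h1 x) (h2 x)) has_integral f x - f a) {a..x}"
      by (simp add: Complex_eq)
  qed
qed

section \<open>Lebesgue differentiation and indefinite integrals\<close>

text \<open>The differentiation theorem for integrals is applied to averages to the right of a
  point. The left quotients come from the reflected function, and the two-sided derivative is put
  together from both.\<close>

lemma has_vector_derivative_one_sided_quotients:
  fixes f :: "real \<Rightarrow> 'a::real_normed_vector"
  assumes "\<And>e. e > 0 \<Longrightarrow> \<exists>d>0. \<forall>h. 0 < h \<and> h < d \<longrightarrow> norm ((f (x + h) - f x) /\<^sub>R h - D) < e"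
    and "\<And>e. e > 0 \<Longrightarrow> \<exists>d>0. \<forall>h. 0 < h \<and> h < d \<longrightarrow> norm ((f x - f (x - h)) /\<^sub>R h - D) < e"
  shows "(f has_vector_derivative D) (at x)"
  unfolding has_vector_derivative_def has_derivative_at'
proof (intro conjI allI impI bounded_linear_scaleR_left)
  fix e :: real assume "e > 0"
  obtain d1 where d1: "d1 > 0" "\<And>h. 0 < h \<Longrightarrow> h < d1 \<Longrightarrow> norm ((f (x + h) - f x) /\<^sub>R h - D) < e"
    using assms(1)[OF \<open>e > 0\<close>] by blast
  obtain d2 where d2: "d2 > 0" "\<And>h. 0 < h \<Longrightarrow> h < d2 \<Longrightarrow> norm ((f x - f (x - h)) /\<^sub>R h - D) < e"
    using assms(2)[OF \<open>e > 0\<close>] by blast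
  show "\<exists>d>0. \<forall>x'. 0 < norm (x' - x) \<and> norm (x' - x) < d \<longrightarrow>
       norm (f x' - f x - (x' - x) *\<^sub>R D) / norm (x' - x) < e"
  proof (intro exI[of _ "min d1 d2"] conjI allI impI)
    fix x' assume *: "0 < norm (x' - x) \<and> norm (x' - x) < min d1 d2"
    show "norm (f x' - f x - (x' - x) *\<^sub>R D) / norm (x' - x) < e"
    proof (cases "x' > x")
      case True
      define h where "h = x' - x"
      have h: "h > 0" "h < d1" "x' = x + h" using * True by (auto simp: h_def)
      have "(f (x + h) - f x) /\<^sub>R h - D = (f (x + h) - f x - h *\<^sub>R D) /\<^sub>R h" using h(1) by (simp add: algebra_simps)
      then show ?thesis using d1(2)[OF h(1,2)] h by (simp add: divide_inverse mult.commute)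
    next
      case False
      define h where "h = x - x'"
      have h: "h > 0" "h < d2" "x' = x - h" using * False by (auto simp: h_def)
      have "(f x - f (x - h)) /\<^sub>R h - D = - ((f (x - h) - f x - (-h) *\<^sub>R D) /\<^sub>R h)" using h(1) by (simp add: algebra_simps)
      then have "norm ((f x - f (x - h)) /\<^sub>R h - D) = norm (f (x - h) - f x - (-h) *\<^sub>R D) / h"
        using h(1) by (simp only: norm_minus_cancel) (simp add: divide_inverse mult.commute)
      then show ?thesis using d2(2)[OF h(1,2)] h by simp
    qed
  qed (use d1 d2 in auto)
qed

lemma lebesgue_differentiation:
  fixes h :: "real \<Rightarrow> complex"
  assumes h: "h integrable_on {a..b}" and g: "\<And>x. x \<in> {a..b} \<Longrightarrow> g x = c + integral {a..x} h"
  obtains N where "negligible N" "\<And>x. x \<in> {a<..<b} - N \<Longrightarrow> (g has_vector_derivative h x) (at x)"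
proof -
  \<comment> \<open>Extension by zero makes the function integrable on every interval, hence also
    after reflection.\<close>
  define H where "H x = (if x \<in> {a..b} then h x else 0)" for x
  have HU: "H integrable_on UNIV" unfolding H_def using h integrable_restrict_UNIV[of "{a..b}" h] by simp
  then have Hi: "H integrable_on cbox u v" for u v by (rule integrable_on_subcbox) simp
  have Hi': "(\<lambda>x. H (- x)) integrable_on cbox u v" for u v
  proof -
    have "(\<lambda>x. H (- x)) integrable_on cbox (- (- u)) (- (- v))"
      using Hi by (rule integrable_reflect[THEN iffD2])
    then show ?thesis by simp
  qed
  obtain N1 where N1: "negligible N1" "\<And>x e. \<lbrakk>x \<notin> N1; 0 < e\<rbrakk> \<Longrightarrow>
      \<exists>d>0. \<forall>k. 0 < k \<and> k < d \<longrightarrow> norm (integral (cbox x (x + k *\<^sub>R One)) H /\<^sub>R k ^ DIM(real) - H x) < e"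
    using integrable_ccontinuous_explicit[OF Hi] by blast
  obtain N2 where N2: "negligible N2" "\<And>x e. \<lbrakk>x \<notin> N2; 0 < e\<rbrakk> \<Longrightarrow>
      \<exists>d>0. \<forall>k. 0 < k \<and> k < d \<longrightarrow> norm (integral (cbox x (x + k *\<^sub>R One)) (\<lambda>x. H (- x)) /\<^sub>R k ^ DIM(real) - H (- x)) < e"
    using integrable_ccontinuous_explicit[OF Hi'] by blast
  have diff: "g v - g u = integral {u..v} H" if "a \<le> u" "u \<le> v" "v \<le> b" for u v
  proof -
    have "integral {a..v} h = integral {a..u} h + integral {u..v} h"
      using that by (intro Henstock_Kurzweil_Integration.integral_combine[symmetric] integrable_subinterval_real[OF h]) auto
    moreover have "integral {u..v} H = integral {u..v} h"
      using that by (intro integral_cong) (auto simp: H_def)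
    ultimately show ?thesis using g[of u] g[of v] that by simp
  qed
  show thesis
  proof (rule that)
    show "negligible (N1 \<union> uminus ` N2)"
      using N1(1) negligible_differentiable_image_negligible[OF order_refl N2(1), of uminus]
      by (simp add: negligible_Un differentiable_on_minus)
    fix x assume x: "x \<in> {a<..<b} - (N1 \<union> uminus ` N2)"
    then have x1: "x \<notin> N1" and x2: "- x \<notin> N2" by (auto simp: image_iff)
    have Hx: "H x = h x" using x by (simp add: H_def)
    show "(g has_vector_derivative h x) (at x)"
    proof (rule has_vector_derivative_one_sided_quotients)
      fix e :: real assume "e > 0"
      from N1(2)[OF x1 this] obtain d where d: "d > 0" "\<And>k. 0 < k \<Longrightarrow> k < d \<Longrightarrow> norm (integral {x..x + k} H /\<^sub>R k - h x) < e"
        by (auto simp: Hx)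
      show "\<exists>d>0. \<forall>k. 0 < k \<and> k < d \<longrightarrow> norm ((g (x + k) - g x) /\<^sub>R k - h x) < e"
        using d x diff[of x "x + k" for k] by (intro exI[of _ "min d (b - x)"]) auto
    next
      fix e :: real assume "e > 0"
      from N2(2)[OF x2 this] obtain d where d: "d > 0" "\<And>k. 0 < k \<Longrightarrow> k < d \<Longrightarrow> norm (integral {-x..- x + k} (\<lambda>x. H (- x)) /\<^sub>R k - h x) < e"
        by (auto simp: Hx)
      \<comment> \<open>A right average of the reflected function at -x is a left average of
        \<open>H\<close> at x.\<close>
      have "integral {-x..- x + k} (\<lambda>x. H (- x)) = integral {x - k..x} H" for k
        using integral_reflect[where f=H and a="x - k" and b=x] by simp
      then show "\<exists>d>0. \<forall>k. 0 < k \<and> k < d \<longrightarrow> norm ((g x - g (x - k)) /\<^sub>R k - h x) < e"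
        using d x diff[of "x - k" x for k] by (intro exI[of _ "min d (x - a)"]) auto
    qed
  qed
qed

text \<open>Uniform integrability in the form |h| \<le> M + excess, with an excess of small
  integral; it follows by dominated convergence along M = n. This form serves both the absolute
  continuity of indefinite integrals and the contraction estimate for unbounded
  coefficients.\<close>

lemma absolutely_integrable_truncation:
  fixes h :: "real \<Rightarrow> 'a::euclidean_space"
  assumes h: "h absolutely_integrable_on {a..b}" and "e > 0"
  obtains M where "M \<ge> 0" "(\<lambda>x. max 0 (norm (h x) - M)) integrable_on {a..b}"
    "integral {a..b} (\<lambda>x. max 0 (norm (h x) - M)) < e"
proof -
  have nh: "(\<lambda>x. norm (h x)) absolutely_integrable_on {a..b}" using h by (rule absolutely_integrable_norm[unfolded o_def])
  have int: "(\<lambda>x. max 0 (norm (h x) - M)) integrable_on {a..b}" for M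
    by (intro set_lebesgue_integral_eq_integral(1) absolutely_integrable_max_1 set_integral_diff(1) nh) auto
  have "(\<lambda>n. integral {a..b} (\<lambda>x. max 0 (norm (h x) - real n))) \<longlonglongrightarrow> integral {a..b} (\<lambda>x. 0)"
  proof (rule dominated_convergence(2)[OF int set_lebesgue_integral_eq_integral(1)[OF nh]])
    show "(\<lambda>n. max 0 (norm (h x) - real n)) \<longlonglongrightarrow> 0" for x
    proof (rule tendsto_eventually)
      obtain m where "norm (h x) \<le> real m" using real_arch_simple by blast
      then have "max 0 (norm (h x) - real n) = 0" if "n \<ge> m" for n using that by (simp add: max_def)
      then show "\<forall>\<^sub>F n in sequentially. max 0 (norm (h x) - real n) = 0"
        unfolding eventually_sequentially by blast
    qed
  qed auto
  then have "\<forall>\<^sub>F n in sequentially. integral {a..b} (\<lambda>x. max 0 (norm (h x) - real n)) < e"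
    using \<open>e > 0\<close> by (intro order_tendstoD(2)) auto
  then obtain n where "integral {a..b} (\<lambda>x. max 0 (norm (h x) - real n)) < e"
    by (meson eventually_happens sequentially_bot)
  then show thesis using that[of "real n"] int by auto
qed

lemma interval_family_sum_integral_le:
  fixes r :: "real \<Rightarrow> real"
  assumes fam: "interval_family a b n s t" and r: "r integrable_on {a..b}" and pos: "\<And>x. x \<in> {a..b} \<Longrightarrow> r x \<ge> 0"
  shows "(\<Sum>i<n. integral {s i..t i} r) \<le> integral {a..b} r"
proof -
  define I where "I = {i. i < n \<and> s i < t i}"
  let ?p = "\<lambda>i. (s i, t i)"
  have F: "a \<le> s i" "s i \<le> t i" "t i \<le> b" if "i < n" for i using fam that unfolding interval_family_def by auto
  have D: "{s i<..<t i} \<inter> {s j<..<t j} = {}" if "i < n" "j < n" "i \<noteq> j" for i j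
    using fam that unfolding interval_family_def by auto
  have inj: "inj_on ?p I"
  proof (rule inj_onI, rule ccontr)
    fix i j assume ij: "i \<in> I" "j \<in> I" "?p i = ?p j" "i \<noteq> j"
    then have "{s i<..<t i} = {}" using D[of i j] by (auto simp: I_def)
    then show False using ij(1) by (auto simp: I_def)
  qed
  have "nonoverlapping a b (?p ` I)"
  proof (rule nonoverlappingI)
    fix p p' assume "p \<in> ?p ` I" "p' \<in> ?p ` I" "p \<noteq> p'"
    then obtain i j where "i \<in> I" "j \<in> I" "i \<noteq> j" "p = ?p i" "p' = ?p j" by auto
    then show "{fst p<..<snd p} \<inter> {fst p'<..<snd p'} = {}" using D[of i j] by (simp add: I_def)
  qed (use F in \<open>auto simp: I_def\<close>)
  from nonoverlapping_sum_integral_le[OF this r pos]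
  have "(\<Sum>i\<in>I. integral {s i..t i} r) \<le> integral {a..b} r" by (simp add: sum.reindex[OF inj])
  moreover have "(\<Sum>i<n. integral {s i..t i} r) = (\<Sum>i\<in>I. integral {s i..t i} r)"
    using F(2) by (intro sum.mono_neutral_right) (auto simp: I_def less_le)
  ultimately show ?thesis by simp
qed

text \<open>The part of |h| below M contributes at most M times the total length. The excess
  contributes at most its full integral, which is below \<epsilon>/2 whatever the intervals
  are.\<close>

lemma indefinite_integral_abs_cont:
  fixes h :: "real \<Rightarrow> complex"
  assumes h: "h absolutely_integrable_on {a..b}" and g: "\<And>x. x \<in> {a..b} \<Longrightarrow> g x = c + integral {a..x} h"
  shows "abs_cont_on_interval g a b"
  unfolding abs_cont_on_interval_iff
proof (intro allI impI)
  fix \<epsilon> :: real assume "\<epsilon> > 0"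
  obtain M where M: "M \<ge> 0" "(\<lambda>x. max 0 (norm (h x) - M)) integrable_on {a..b}"
    "integral {a..b} (\<lambda>x. max 0 (norm (h x) - M)) < \<epsilon>/2"
    using absolutely_integrable_truncation[OF h half_gt_zero[OF \<open>\<epsilon> > 0\<close>]] by blast
  let ?r = "\<lambda>x. max 0 (norm (h x) - M)"
  have hi: "h integrable_on {a..b}" using h set_lebesgue_integral_eq_integral(1) by blast
  define \<delta> where "\<delta> = \<epsilon> / (2 * (M + 1))"
  have inc: "norm (g v - g u) \<le> M * (v - u) + integral {u..v} ?r" if uv: "a \<le> u" "u \<le> v" "v \<le> b" for u v
  proof -
    have "integral {a..v} h = integral {a..u} h + integral {u..v} h"
      using that by (intro Henstock_Kurzweil_Integration.integral_combine[symmetric] integrable_subinterval_real[OF hi]) auto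
    then have "g v - g u = integral {u..v} h" using g[of u] g[of v] uv by simp
    also have "norm \<dots> \<le> integral {u..v} (\<lambda>x. M + ?r x)"
    proof (rule integral_norm_bound_integral)
      show "h integrable_on {u..v}" using uv by (intro integrable_subinterval_real[OF hi]) auto
      show "(\<lambda>x. M + ?r x) integrable_on {u..v}"
        using uv by (intro integrable_add integrable_const_ivl integrable_subinterval_real[OF M(2)]) auto
    qed auto
    also have "\<dots> = M * (v - u) + integral {u..v} ?r"
      using uv by (subst integral_add) (auto intro!: integrable_subinterval_real[OF M(2)])
    finally show ?thesis .
  qed
  show "\<exists>\<delta>>0. \<forall>n s t. interval_family a b n s t \<longrightarrow> (\<Sum>i<n. t i - s i) < \<delta> \<longrightarrow>
        (\<Sum>i<n. norm (g (t i) - g (s i))) < \<epsilon>"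
  proof (intro exI[of _ \<delta>] conjI allI impI)
    show "\<delta> > 0" using \<open>\<epsilon> > 0\<close> M(1) by (simp add: \<delta>_def)
    fix n s t assume fam: "interval_family a b n s t" and l: "(\<Sum>i<n. t i - s i) < \<delta>"
    have "(\<Sum>i<n. norm (g (t i) - g (s i))) \<le> (\<Sum>i<n. M * (t i - s i) + integral {s i..t i} ?r)"
      using fam by (intro sum_mono inc) (auto simp: interval_family_def)
    also have "\<dots> = M * (\<Sum>i<n. t i - s i) + (\<Sum>i<n. integral {s i..t i} ?r)"
      by (simp only: sum.distrib sum_distrib_left)
    also have "\<dots> \<le> M * \<delta> + integral {a..b} ?r"
      using interval_family_sum_integral_le[OF fam M(2)] l M(1) by (intro add_mono mult_left_mono) auto
    also have "\<dots> \<le> \<epsilon>/2 + integral {a..b} ?r" using M(1) \<open>\<epsilon> > 0\<close> by (simp add: \<delta>_def field_simps)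
    also have "\<dots> < \<epsilon>" using M(3) by simp
    finally show "(\<Sum>i<n. norm (g (t i) - g (s i))) < \<epsilon>" .
  qed
qed

text \<open>Since f is the indefinite integral of its density, Lebesgue differentiation makes the
  density a derivative almost everywhere.\<close>

lemma abs_cont_on_interval_differentiable:
  fixes f :: "real \<Rightarrow> complex"
  assumes ac: "abs_cont_on_interval f a b" and "a \<le> b"
  obtains h N where "h absolutely_integrable_on {a..b}" "negligible N"
    "\<And>x. x \<in> {a<..<b} - N \<Longrightarrow> (f has_vector_derivative h x) (at x)"
    "\<And>x. x \<in> {a..b} \<Longrightarrow> (h has_integral f x - f a) {a..x}"
proof -
  obtain h where h: "h absolutely_integrable_on {a..b}" "\<And>x. x \<in> {a..b} \<Longrightarrow> (h has_integral f x - f a) {a..x}"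
    using abs_cont_on_interval_density[OF assms] by blast
  have "f x = f a + integral {a..x} h" if "x \<in> {a..b}" for x
    using h(2)[OF that] by (simp add: has_integral_iff)
  from lebesgue_differentiation[OF set_lebesgue_integral_eq_integral(1)[OF h(1)] this]
  show thesis using that h by metis
qed

text \<open>Only the lower bound \<open>k\<close> of the derivative has to be integrable, so the ingredients of the
  derivative need not be measurable.\<close>
corollary abs_cont_increment_ge:
  fixes W :: "real \<Rightarrow> complex"
  assumes ac: "abs_cont_on_interval W a b" and "a \<le> b" and N: "negligible N"
    and d: "\<And>x D. x \<in> {a<..<b} - N \<Longrightarrow> (W has_vector_derivative D) (at x) \<Longrightarrow> k x \<le> Re D"
    and k: "k integrable_on {a..b}"
  shows "integral {a..b} k \<le> Re (W b - W a)"
proof -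
  obtain h N' where h: "negligible N'"
    "\<And>x. x \<in> {a<..<b} - N' \<Longrightarrow> (W has_vector_derivative h x) (at x)" "(h has_integral W b - W a) {a..b}"
    using abs_cont_on_interval_differentiable[OF ac \<open>a \<le> b\<close>] \<open>a \<le> b\<close> by (metis atLeastAtMost_iff order_refl)
  have Re: "((\<lambda>x. Re (h x)) has_integral Re (W b - W a)) {a..b}"
    using has_integral_linear[OF h(3) bounded_linear_Re] by (simp add: o_def)
  \<comment> \<open>The comparison of integrals used below is pointwise, so on this null set k is
    replaced by the density of W itself.\<close>
  define N'' where "N'' = N \<union> N' \<union> {a, b}"
  have neg: "negligible N''" using N h(1) by (simp add: negligible_Un N''_def)
  have "((\<lambda>x. if x \<in> N'' then Re (h x) else k x) has_integral integral {a..b} k) {a..b}"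
    by (rule has_integral_spike[OF neg _ integrable_integral[OF k]]) auto
  then show ?thesis using Re
    by (rule has_integral_le) (use d[OF _ h(2)] in \<open>auto simp: N''_def\<close>)
qed

section \<open>Linear equations with integrable coefficients\<close>

lemma absolutely_integrable_mult_continuous:
  fixes Q w :: "real \<Rightarrow> 'a::{euclidean_space,real_normed_algebra}"
  assumes Q: "Q absolutely_integrable_on {a..b}" and w: "continuous_on {a..b} w"
  shows "(\<lambda>x. Q x * w x) absolutely_integrable_on {a..b}"
proof -
  have "bounded (w ` {a..b})" using compact_continuous_image[OF w] compact_imp_bounded by blast
  then show ?thesis
    by (intro absolutely_integrable_bounded_measurable_product[where h="\<lambda>x y. y * x", OF _ _ _ _ Q]
        continuous_imp_measurable_on_sets_lebesgue[OF w])
      (auto simp: bilinear_conv_bounded_bilinear intro: bounded_bilinear.flip[OF bounded_bilinear_mult])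
qed

text \<open>The weight exp(K x) (a Bielecki norm) makes the Volterra operator a contraction on all
  of [0, R] at once. The bounded part of Q gains M / K from integrating the exponential. The excess
  \<open>r\<close> has no pointwise bound, so there the exponential is replaced by its value at x
  and only the small integral of \<open>r\<close> is used.\<close>

lemma iterated_integral_contraction:
  fixes Q :: "real \<Rightarrow> complex"
  assumes Q: "Q absolutely_integrable_on {0..R}" and "R > 0"
  obtains K where "K > 0"
    "\<And>w D x. continuous_on {0..R} w \<Longrightarrow> (\<And>x. x \<in> {0..R} \<Longrightarrow> norm (w x) \<le> D * exp (K * x)) \<Longrightarrow> x \<in> {0..R}
       \<Longrightarrow> norm (integral {0..x} (\<lambda>s. integral {0..s} (\<lambda>t. Q t * w t))) \<le> D / 2 * exp (K * x)"
proof -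
  obtain M where M: "M \<ge> 0" "(\<lambda>x. max 0 (norm (Q x) - M)) integrable_on {0..R}"
    "integral {0..R} (\<lambda>x. max 0 (norm (Q x) - M)) < 1 / (4 * R)"
    using absolutely_integrable_truncation[OF Q, of "1 / (4 * R)"] \<open>R > 0\<close> by auto
  define r where "r x = max 0 (norm (Q x) - M)" for x
  \<comment> \<open>Chosen so that M / K \<le> 1 / (4 R). With the 1 / (4 R) from the excess and the
    outer integral of length at most R this gives the factor 1/2; the added 1 keeps K positive when
    M = 0.\<close>
  define K where "K = 4 * R * M + 1"
  have K: "K > 0" using M(1) \<open>R > 0\<close> by (simp add: K_def add_nonneg_pos)
  show thesis
  proof (rule that[OF K])
    fix w :: "real \<Rightarrow> complex" and D x assume w: "continuous_on {0..R} w" and D: "\<And>x. x \<in> {0..R} \<Longrightarrow> norm (w x) \<le> D * exp (K * x)"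
      and x: "x \<in> {0..R}"
    have "norm (w 0) \<le> D * exp (K * 0)" using D[of 0] \<open>R > 0\<close> by simp
    from order_trans[OF norm_ge_zero this] have "D \<ge> 0" by simp
    have Qw: "(\<lambda>t. Q t * w t) integrable_on {0..R}"
      using absolutely_integrable_mult_continuous[OF Q w] set_lebesgue_integral_eq_integral(1) by blast
    have inner: "norm (integral {0..s} (\<lambda>t. Q t * w t)) \<le> D / (2 * R) * exp (K * x)" if s: "s \<in> {0..x}" for s
    proof -
      have ei: "((\<lambda>t. exp (K * t)) has_integral (exp (K * s) / K - exp (K * 0) / K)) {0..s}"
        using s K by (intro fundamental_theorem_of_calculus)
          (auto intro!: derivative_eq_intros simp: has_real_derivative_iff_has_vector_derivative[symmetric])
      have ri: "r integrable_on {0..s}" unfolding r_def using s x by (intro integrable_subinterval_real[OF M(2)]) auto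
      have bd: "((\<lambda>t. D * (M * exp (K * t) + exp (K * x) * r t)) has_integral
          D * (M * (exp (K * s) / K - exp (K * 0) / K) + exp (K * x) * integral {0..s} r)) {0..s}"
        by (intro has_integral_mult_right has_integral_add ei integrable_integral[OF ri])
      have "norm (integral {0..s} (\<lambda>t. Q t * w t)) \<le> integral {0..s} (\<lambda>t. D * (M * exp (K * t) + exp (K * x) * r t))"
      proof (rule integral_norm_bound_integral)
        show "(\<lambda>t. Q t * w t) integrable_on {0..s}" using s x by (intro integrable_subinterval_real[OF Qw]) auto
        show "(\<lambda>t. D * (M * exp (K * t) + exp (K * x) * r t)) integrable_on {0..s}" using bd by blast
        fix t assume t: "t \<in> {0..s}"
        have "norm (Q t * w t) \<le> (M + r t) * (D * exp (K * t))"
          unfolding norm_mult using D[of t] t s x M(1) by (intro mult_mono) (auto simp: r_def)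
        also have "\<dots> = D * (M * exp (K * t) + exp (K * t) * r t)" by (simp add: algebra_simps)
        also have "\<dots> \<le> D * (M * exp (K * t) + exp (K * x) * r t)"
          using \<open>D \<ge> 0\<close> t s K by (intro mult_left_mono add_left_mono mult_right_mono) (auto simp: r_def)
        finally show "norm (Q t * w t) \<le> D * (M * exp (K * t) + exp (K * x) * r t)" .
      qed
      also have "\<dots> = D * (M * (exp (K * s) / K - exp (K * 0) / K) + exp (K * x) * integral {0..s} r)"
        using bd by blast
      also have "\<dots> \<le> D * (exp (K * x) * (M / K) + exp (K * x) * (1 / (4 * R)))"
      proof (intro mult_left_mono add_mono \<open>D \<ge> 0\<close>)
        have "exp (K * s) / K - exp (K * 0) / K \<le> exp (K * x) / K"
        proof -
          have "exp (K * s) / K \<le> exp (K * x) / K" using s K by (intro divide_right_mono) auto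
          moreover have "exp (K * 0) / K \<ge> 0" using K by simp
          ultimately show ?thesis by linarith
        qed
        from mult_left_mono[OF this M(1)]
        show "M * (exp (K * s) / K - exp (K * 0) / K) \<le> exp (K * x) * (M / K)"
          by (simp only: times_divide_eq_right mult.commute[of "exp (K * x)" M])
        have "integral {0..s} r \<le> integral {0..R} r"
        proof (rule integral_subset_le[OF _ ri])
          show "r integrable_on {0..R}" using M(2) unfolding r_def .
        qed (use s x in \<open>auto simp: r_def\<close>)
        then show "integral {0..s} r \<le> 1 / (4 * R)" using M(3) unfolding r_def by linarith
      qed auto
      also have "\<dots> = D * exp (K * x) * (M / K + 1 / (4 * R))" by (simp add: algebra_simps)
      also have "\<dots> \<le> D * exp (K * x) * (1 / (2 * R))"
      proof (intro mult_left_mono)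
        have "M / K \<le> 1 / (4 * R)" using \<open>R > 0\<close> M(1) K by (simp add: divide_simps) (simp add: K_def)
        then show "M / K + 1 / (4 * R) \<le> 1 / (2 * R)" by simp
      qed (use \<open>D \<ge> 0\<close> in auto)
      finally show ?thesis by (simp add: algebra_simps)
    qed
    have "norm (integral {0..x} (\<lambda>s. integral {0..s} (\<lambda>t. Q t * w t))) \<le> integral {0..x} (\<lambda>s. D / (2 * R) * exp (K * x))"
    proof (rule integral_norm_bound_integral[OF _ _ inner])
      show "(\<lambda>s. integral {0..s} (\<lambda>t. Q t * w t)) integrable_on {0..x}"
        using x by (intro integrable_continuous_real indefinite_integral_continuous_1 integrable_subinterval_real[OF Qw]) auto
    qed auto
    also have "\<dots> = (x / R) * (D / 2 * exp (K * x))" using x by (simp add: mult_ac)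
    also have "\<dots> \<le> 1 * (D / 2 * exp (K * x))" using x \<open>R > 0\<close> \<open>D \<ge> 0\<close> by (intro mult_right_mono) auto
    finally show "norm (integral {0..x} (\<lambda>s. integral {0..s} (\<lambda>t. Q t * w t))) \<le> D / 2 * exp (K * x)" by simp
  qed
qed

text \<open>The twice integrated form of y'' = Q y - f with y(0) = \<alpha> and y'(0) = \<beta>,
  which makes sense for continuous y and merely integrable Q and f.\<close>

definition volterra_solution :: "(real \<Rightarrow> complex) \<Rightarrow> (real \<Rightarrow> complex) \<Rightarrow> complex \<Rightarrow> complex \<Rightarrow> real \<Rightarrow> (real \<Rightarrow> complex) \<Rightarrow> bool" where
  "volterra_solution Q f \<alpha> \<beta> R y \<longleftrightarrow> continuous_on {0..R} y \<and>
     (\<forall>x\<in>{0..R}. y x = \<alpha> + integral {0..x} (\<lambda>s. \<beta> + integral {0..s} (\<lambda>t. Q t * y t - f t)))"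

lemma volterra_solution_subinterval:
  "volterra_solution Q f \<alpha> \<beta> R y \<Longrightarrow> R' \<le> R \<Longrightarrow> volterra_solution Q f \<alpha> \<beta> R' y"
  unfolding volterra_solution_def by (auto elim: continuous_on_subset)

lemma iterated_integral_diff:
  fixes g h :: "real \<Rightarrow> complex"
  assumes g: "g integrable_on {0..R}" and h: "h integrable_on {0..R}" and x: "x \<in> {0..R}"
  shows "integral {0..x} (\<lambda>s. \<beta> + integral {0..s} g) - integral {0..x} (\<lambda>s. \<beta> + integral {0..s} h)
     = integral {0..x} (\<lambda>s. integral {0..s} (\<lambda>t. g t - h t))"
proof -
  have i: "(\<lambda>s. \<beta> + integral {0..s} k) integrable_on {0..x}" if "k integrable_on {0..R}" for k :: "real \<Rightarrow> complex"
    using x by (intro integrable_continuous_real continuous_intros indefinite_integral_continuous_1 integrable_subinterval_real[OF that]) auto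
  have "integral {0..x} (\<lambda>s. \<beta> + integral {0..s} g) - integral {0..x} (\<lambda>s. \<beta> + integral {0..s} h)
     = integral {0..x} (\<lambda>s. (\<beta> + integral {0..s} g) - (\<beta> + integral {0..s} h))"
    by (rule Henstock_Kurzweil_Integration.integral_diff[symmetric, OF i[OF g] i[OF h]])
  also have "\<dots> = integral {0..x} (\<lambda>s. integral {0..s} (\<lambda>t. g t - h t))"
  proof (rule integral_cong)
    fix s assume "s \<in> {0..x}"
    then show "(\<beta> + integral {0..s} g) - (\<beta> + integral {0..s} h) = integral {0..s} (\<lambda>t. g t - h t)"
      using x by (subst Henstock_Kurzweil_Integration.integral_diff) (auto intro!: integrable_subinterval_real[OF g] integrable_subinterval_real[OF h])
  qed
  finally show ?thesis .
qed

text \<open>The difference of two solutions is a fixed point of the homogeneous Volterra operator.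
  Its weighted maximum D is attained on the compact interval, and the contraction bounds D by D /
  2.\<close>

lemma volterra_solution_unique:
  assumes Q: "Q absolutely_integrable_on {0..R}" and f: "f integrable_on {0..R}" and "R > 0"
    and y: "volterra_solution Q f \<alpha> \<beta> R y" and z: "volterra_solution Q f \<alpha> \<beta> R z" and x: "x \<in> {0..R}"
  shows "y x = z x"
proof -
  obtain K where K: "K > 0"
    "\<And>w D x. continuous_on {0..R} w \<Longrightarrow> (\<And>x. x \<in> {0..R} \<Longrightarrow> norm (w x) \<le> D * exp (K * x)) \<Longrightarrow> x \<in> {0..R}
       \<Longrightarrow> norm (integral {0..x} (\<lambda>s. integral {0..s} (\<lambda>t. Q t * w t))) \<le> D / 2 * exp (K * x)"
    using iterated_integral_contraction[OF Q \<open>R > 0\<close>] by blast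
  have yc: "continuous_on {0..R} y" and zc: "continuous_on {0..R} z" using y z by (auto simp: volterra_solution_def)
  define w where "w x = y x - z x" for x
  have wc: "continuous_on {0..R} w" unfolding w_def by (intro continuous_intros yc zc)
  have int: "(\<lambda>t. Q t * u t - f t) integrable_on {0..R}" if "continuous_on {0..R} u" for u
    by (intro integrable_diff f set_lebesgue_integral_eq_integral(1) absolutely_integrable_mult_continuous[OF Q that])
  have weq: "w x = integral {0..x} (\<lambda>s. integral {0..s} (\<lambda>t. Q t * w t))" if "x \<in> {0..R}" for x
  proof -
    have "w x = integral {0..x} (\<lambda>s. \<beta> + integral {0..s} (\<lambda>t. Q t * y t - f t)) - integral {0..x} (\<lambda>s. \<beta> + integral {0..s} (\<lambda>t. Q t * z t - f t))"
      using y z that by (simp add: w_def volterra_solution_def)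
    then show ?thesis
      by (simp add: iterated_integral_diff[OF int[OF yc] int[OF zc] that] w_def algebra_simps)
  qed
  have "continuous_on {0..R} (\<lambda>x. norm (w x) * exp (- K * x))" by (intro continuous_intros wc)
  then obtain x0 where x0: "x0 \<in> {0..R}" "\<And>x. x \<in> {0..R} \<Longrightarrow> norm (w x) * exp (- K * x) \<le> norm (w x0) * exp (- K * x0)"
    using continuous_attains_sup[of "{0..R}" "\<lambda>x. norm (w x) * exp (- K * x)"] \<open>R > 0\<close> by auto
  define D where "D = norm (w x0) * exp (- K * x0)"
  have bound: "norm (w x) \<le> D * exp (K * x)" if "x \<in> {0..R}" for x
    using mult_right_mono[OF x0(2)[OF that], of "exp (K * x)"] by (simp add: D_def mult.assoc exp_add[symmetric])
  have "norm (w x0) \<le> D / 2 * exp (K * x0)" using K(2)[OF wc bound x0(1)] weq[OF x0(1)] by simp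
  then have "D * exp (K * x0) \<le> D / 2 * exp (K * x0)" by (simp add: D_def mult.assoc exp_add[symmetric])
  then have "D * exp (K * x0) \<le> 0" by simp
  then have "D \<le> 0" by (simp add: mult_le_0_iff not_le[symmetric])
  then have "norm (w x) \<le> 0" using bound[OF x] by (meson exp_ge_zero mult_nonpos_nonneg order_trans)
  then show ?thesis by (simp add: w_def)
qed

text \<open>Banach's fixed point theorem in the complete space of bounded continuous functions on
  the line. The weight is built in by letting \<open>u\<close> stand for exp(-K x) y(x), and
  \<open>W u\<close> recovers y; the plain supremum metric then acts as the weighted one.\<close>

lemma volterra_solution_exists:
  assumes Q: "Q absolutely_integrable_on {0..R}" and f: "f integrable_on {0..R}" and "R > 0"
  obtains y where "volterra_solution Q f \<alpha> \<beta> R y"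
proof -
  obtain K where K: "K > 0"
    "\<And>w D x. continuous_on {0..R} w \<Longrightarrow> (\<And>x. x \<in> {0..R} \<Longrightarrow> norm (w x) \<le> D * exp (K * x)) \<Longrightarrow> x \<in> {0..R}
       \<Longrightarrow> norm (integral {0..x} (\<lambda>s. integral {0..s} (\<lambda>t. Q t * w t))) \<le> D / 2 * exp (K * x)"
    using iterated_integral_contraction[OF Q \<open>R > 0\<close>] by blast
  \<comment> \<open>Clamping the argument to [0, R] extends a continuous function on the interval to
    a bounded continuous one on the line.\<close>
  define cl where "cl x = max 0 (min R x)" for x
  have cl: "cl x \<in> {0..R}" "x \<in> {0..R} \<Longrightarrow> cl x = x" for x using \<open>R > 0\<close> by (auto simp: cl_def)
  define W where "W u s = exp (K * s) *\<^sub>R apply_bcontfun u s" for u :: "real \<Rightarrow>\<^sub>C complex" and s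
  define G where "G u x = \<alpha> + integral {0..x} (\<lambda>s. \<beta> + integral {0..s} (\<lambda>t. Q t * W u t - f t))" for u x
  define T where "T u = Bcontfun (\<lambda>x. exp (- K * cl x) *\<^sub>R G u (cl x))" for u
  have Wc: "continuous_on S (W u)" for S u
    unfolding W_def by (intro continuous_intros continuous_on_apply_bcontfun)
  have int: "(\<lambda>t. Q t * W u t - f t) integrable_on {0..R}" for u
    by (intro integrable_diff f set_lebesgue_integral_eq_integral(1) absolutely_integrable_mult_continuous[OF Q Wc])
  have Gc: "continuous_on {0..R} (G u)" for u
    unfolding G_def by (intro continuous_intros indefinite_integral_continuous_1 integrable_continuous_real int)
  have Tapp: "apply_bcontfun (T u) x = exp (- K * cl x) *\<^sub>R G u (cl x)" for u x
  proof -
    have c: "continuous_on {0..R} (\<lambda>x. exp (- K * x) *\<^sub>R G u x)" by (intro continuous_intros Gc)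
    have "bounded ((\<lambda>x. exp (- K * x) *\<^sub>R G u x) ` {0..R})"
      using compact_continuous_image[OF c] compact_imp_bounded by blast
    then obtain B where B: "\<And>x. x \<in> {0..R} \<Longrightarrow> norm (exp (- K * x) *\<^sub>R G u x) \<le> B" unfolding bounded_iff by blast
    have "(\<lambda>x. exp (- K * cl x) *\<^sub>R G u (cl x)) \<in> bcontfun"
    proof (rule bcontfun_normI)
      show "continuous_on UNIV (\<lambda>x. exp (- K * cl x) *\<^sub>R G u (cl x))"
        by (rule continuous_on_compose2[OF c]) (use cl(1) in \<open>auto simp: cl_def intro!: continuous_intros\<close>)
      show "norm (exp (- K * cl x) *\<^sub>R G u (cl x)) \<le> B" for x by (rule B[OF cl(1)])
    qed
    then show ?thesis by (simp add: T_def Bcontfun_inverse)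
  qed
  have "dist (T u) (T v) \<le> 1/2 * dist u v" for u v
  proof (rule dist_bound)
    fix x
    have "G u (cl x) - G v (cl x) = integral {0..cl x} (\<lambda>s. integral {0..s} (\<lambda>t. Q t * (W u t - W v t)))"
      unfolding G_def add_diff_cancel_left iterated_integral_diff[OF int[of u] int[of v] cl(1)[of x]]
      by (simp add: right_diff_distrib)
    moreover have "norm (integral {0..cl x} (\<lambda>s. integral {0..s} (\<lambda>t. Q t * (W u t - W v t)))) \<le> dist u v / 2 * exp (K * cl x)"
    proof (rule K(2)[OF _ _ cl(1)])
      show "continuous_on {0..R} (\<lambda>t. W u t - W v t)" by (intro continuous_intros Wc)
      fix t
      have "norm (W u t - W v t) = exp (K * t) * dist (apply_bcontfun u t) (apply_bcontfun v t)"
        by (simp add: W_def scaleR_diff_right[symmetric] dist_norm)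
      also have "\<dots> \<le> exp (K * t) * dist u v" by (intro mult_left_mono dist_bounded) auto
      finally show "norm (W u t - W v t) \<le> dist u v * exp (K * t)" by (simp add: mult.commute)
    qed
    ultimately have "exp (- K * cl x) * norm (G u (cl x) - G v (cl x)) \<le> exp (- K * cl x) * (dist u v / 2 * exp (K * cl x))"
      by (intro mult_left_mono) auto
    also have "\<dots> = 1/2 * dist u v" by (simp add: exp_minus field_simps)
    finally show "dist (apply_bcontfun (T u) x) (apply_bcontfun (T v) x) \<le> 1/2 * dist u v"
      by (simp add: Tapp dist_norm scaleR_diff_right[symmetric])
  qed
  then obtain u where u: "T u = u"
    using banach_fix_type[of "1/2" T] by auto
  have "volterra_solution Q f \<alpha> \<beta> R (W u)"
    unfolding volterra_solution_def
  proof (intro conjI ballI Wc)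
    fix x assume x: "x \<in> {0..R}"
    have "W u x = exp (K * x) *\<^sub>R (exp (- K * x) *\<^sub>R G u x)"
      using Tapp[of u x] cl(2)[OF x] by (simp add: W_def u)
    also have "\<dots> = G u x" by (simp add: exp_add[symmetric])
    finally show "W u x = \<alpha> + integral {0..x} (\<lambda>s. \<beta> + integral {0..s} (\<lambda>t. Q t * W u t - f t))"
      by (simp add: G_def)
  qed
  then show thesis by (rule that)
qed

text \<open>Solutions on the intervals [0, n + 1] agree wherever two of them are defined, by
  uniqueness, and so glue together.\<close>

theorem linear_ode_global_solution:
  assumes Q: "\<And>R. Q absolutely_integrable_on {0..R}" and f: "\<And>R. f integrable_on {0..R}"
  obtains y y1 :: "real \<Rightarrow> complex" where "y 0 = \<alpha>" "y1 0 = \<beta>" "continuous_on {0..} y"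
    "\<And>x. x \<ge> 0 \<Longrightarrow> (y has_vector_derivative y1 x) (at x within {0..})"
    "\<And>x. x \<ge> 0 \<Longrightarrow> y1 x = \<beta> + integral {0..x} (\<lambda>t. Q t * y t - f t)"
proof -
  have "\<exists>y. volterra_solution Q f \<alpha> \<beta> (real (Suc n)) y" for n
    using volterra_solution_exists[OF Q f, of "real (Suc n)"] by (metis of_nat_0_less_iff zero_less_Suc)
  then obtain ys where ys: "\<And>n. volterra_solution Q f \<alpha> \<beta> (real (Suc n)) (ys n)" by metis
  \<comment> \<open>The interval belonging to this index reaches beyond x by at least 1.\<close>
  define y where "y x = ys (nat \<lceil>x\<rceil>) x" for x
  have agree: "y x = ys n x" if x: "x \<in> {0..real (Suc n)}" for x n
  proof -
    define m where "m = min n (nat \<lceil>x\<rceil>)"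
    have "x \<le> real (Suc (nat \<lceil>x\<rceil>))" using x by (simp add: real_nat_ceiling_ge le_SucI add_increasing)
    then have "x \<in> {0..real (Suc m)}" using x by (auto simp: m_def min_def)
    moreover have "volterra_solution Q f \<alpha> \<beta> (real (Suc m)) (ys n)"
      "volterra_solution Q f \<alpha> \<beta> (real (Suc m)) (ys (nat \<lceil>x\<rceil>))"
      using ys by (auto intro!: volterra_solution_subinterval[OF ys] simp: m_def)
    ultimately show ?thesis unfolding y_def
      using volterra_solution_unique[OF Q f] by (metis of_nat_0_less_iff zero_less_Suc)
  qed
  have sol: "volterra_solution Q f \<alpha> \<beta> (real (Suc n)) y" for n
    unfolding volterra_solution_def
  proof (intro conjI ballI)
    have "continuous_on {0..real (Suc n)} (ys n)" using ys[of n] by (simp add: volterra_solution_def)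
    then show "continuous_on {0..real (Suc n)} y" using agree by (metis (no_types, lifting) continuous_on_cong)
    fix x assume x: "x \<in> {0..real (Suc n)}"
    have "y x = \<alpha> + integral {0..x} (\<lambda>s. \<beta> + integral {0..s} (\<lambda>t. Q t * ys n t - f t))"
      using ys[of n] x agree[OF x] unfolding volterra_solution_def by simp
    also have "integral {0..x} (\<lambda>s. \<beta> + integral {0..s} (\<lambda>t. Q t * ys n t - f t))
        = integral {0..x} (\<lambda>s. \<beta> + integral {0..s} (\<lambda>t. Q t * y t - f t))"
      using x agree[of _ n] by (intro integral_cong arg_cong[where f="\<lambda>z. \<beta> + z"]) auto
    finally show "y x = \<alpha> + integral {0..x} (\<lambda>s. \<beta> + integral {0..s} (\<lambda>t. Q t * y t - f t))" .
  qed
  define y1 where "y1 x = \<beta> + integral {0..x} (\<lambda>t. Q t * y t - f t)" for x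
  have yc: "continuous_on {0..real (Suc n)} y" for n using sol[of n] by (simp add: volterra_solution_def)
  have int: "(\<lambda>t. Q t * y t - f t) integrable_on {0..real (Suc n)}" for n
    by (intro integrable_diff f set_lebesgue_integral_eq_integral(1) absolutely_integrable_mult_continuous[OF Q yc])
  have y1c: "continuous_on {0..real (Suc n)} y1" for n
    unfolding y1_def by (intro continuous_intros indefinite_integral_continuous_1 int)
  have der: "(y has_vector_derivative y1 x) (at x within {0..})" if x: "x \<ge> 0" for x
  proof -
    define n where "n = nat \<lceil>x\<rceil>"
    have xn: "x < real (Suc n)" unfolding n_def using real_nat_ceiling_ge[of x] by linarith
    have "((\<lambda>u. \<alpha> + integral {0..u} y1) has_vector_derivative y1 x) (at x within {0..real (Suc n)})"
      using integral_has_vector_derivative[OF y1c[of n], of x] x xn by (auto intro!: derivative_eq_intros)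
    then have "(y has_vector_derivative y1 x) (at x within {0..real (Suc n)})"
    proof (rule has_vector_derivative_transform[rotated 2])
      show "x \<in> {0..real (Suc n)}" using x xn by simp
      fix u assume "u \<in> {0..real (Suc n)}"
      then show "y u = \<alpha> + integral {0..u} y1"
        using sol[of n] unfolding volterra_solution_def y1_def by simp
    qed
    moreover have "at x within {0..real (Suc n)} = at x within {0..}"
      by (rule at_within_nhd[where S="{..<real (Suc n)}"]) (use xn in auto)
    ultimately show ?thesis by simp
  qed
  show thesis
  proof (rule that[OF _ _ _ der])
    show "y 0 = \<alpha>" using sol[of 0] by (simp add: volterra_solution_def)
    show "y1 0 = \<beta>" by (simp add: y1_def)
    show "continuous_on {0..} y"
      unfolding continuous_on_eq_continuous_within by (auto intro: has_vector_derivative_continuous[OF der])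
  qed (simp_all add: y1_def)
qed

section \<open>The energy estimate\<close>

lemma abs_cont_on_interval_C1:
  fixes y y1 :: "real \<Rightarrow> complex"
  assumes der: "\<And>x. x \<in> {a..b} \<Longrightarrow> (y has_vector_derivative y1 x) (at x within {a..b})"
    and c: "continuous_on {a..b} y1"
  shows "abs_cont_on_interval y a b"
proof (rule indefinite_integral_abs_cont[where c="y a"])
  show "y1 absolutely_integrable_on {a..b}" by (rule absolutely_integrable_continuous_real[OF c])
  fix x assume x: "x \<in> {a..b}"
  then have "(y1 has_integral y x - y a) {a..x}"
    by (intro fundamental_theorem_of_calculus has_vector_derivative_within_subset[OF der]) auto
  then show "y x = y a + integral {a..x} y1" by (simp add: has_integral_iff)
qed

lemma abs_cont_on_interval_mult:
  fixes f g :: "real \<Rightarrow> complex"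
  assumes f: "abs_cont_on_interval f a b" and g: "abs_cont_on_interval g a b"
  shows "abs_cont_on_interval (\<lambda>x. f x * g x) a b"
proof -
  have "bounded (f ` {a..b})" "bounded (g ` {a..b})"
    using compact_continuous_image[OF abs_cont_on_interval_imp_continuous_on] f g compact_imp_bounded by blast+
  then obtain A B where A: "\<And>x. x \<in> {a..b} \<Longrightarrow> norm (f x) \<le> A" and B: "\<And>x. x \<in> {a..b} \<Longrightarrow> norm (g x) \<le> B"
    unfolding bounded_iff by blast
  show ?thesis
  proof (rule abs_cont_on_interval_dominated[OF f g])
    fix s t assume st: "a \<le> s" "s \<le> t" "t \<le> b"
    have "f t * g t - f s * g s = (f t - f s) * g t + f s * (g t - g s)" by (simp add: algebra_simps)
    then have "norm (f t * g t - f s * g s) \<le> norm (f t - f s) * norm (g t) + norm (f s) * norm (g t - g s)"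
      by (metis norm_triangle_ineq norm_mult)
    also have "\<dots> \<le> norm (f t - f s) * max A B + max A B * norm (g t - g s)"
      using A[of s] B[of t] st by (intro add_mono mult_mono) (auto simp: le_max_iff_disj intro: order_trans[OF norm_ge_zero])
    finally show "norm (f t * g t - f s * g s) \<le> max A B * (norm (f t - f s) + norm (g t - g s))"
      by (simp add: algebra_simps)
  qed
qed

lemma abs_cont_on_interval_cnj:
  assumes f: "abs_cont_on_interval f a b"
  shows "abs_cont_on_interval (\<lambda>x. cnj (f x)) a b"
proof (rule abs_cont_on_interval_dominated[OF f f, where K=1])
  fix s t
  have "norm (cnj (f t) - cnj (f s)) = norm (f t - f s)" by (metis complex_cnj_diff complex_mod_cnj)
  then show "norm (cnj (f t) - cnj (f s)) \<le> 1 * (norm (f t - f s) + norm (f t - f s))" by simp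
qed

text \<open>The derivative of |y|^2 is at most 2 |y| |y'|, split with a free parameter \<eta>. A
  small \<eta> makes the share of y' absorbable; \<eta> equal to twice the length of the interval
  does the same for the share of y.\<close>

lemma norm_square_increment_le:
  fixes y y1 :: "real \<Rightarrow> complex"
  assumes der: "\<And>x. x \<in> {a..b} \<Longrightarrow> (y has_vector_derivative y1 x) (at x within {a..b})"
    and c: "continuous_on {a..b} y1" and u: "u \<in> {a..b}" and v: "v \<in> {a..b}" and \<eta>: "\<eta> > 0"
  shows "(norm (y v))\<^sup>2 \<le> (norm (y u))\<^sup>2 + ((1/\<eta>) * integral {a..b} (\<lambda>x. (norm (y x))\<^sup>2) + \<eta> * integral {a..b} (\<lambda>x. (norm (y1 x))\<^sup>2))"
proof -
  have yc: "continuous_on {a..b} y"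
    unfolding continuous_on_eq_continuous_within using has_vector_derivative_continuous[OF der] by blast
  define g where "g x = y1 x * cnj (y x) + y x * cnj (y1 x)" for x
  have gc: "continuous_on {a..b} g" unfolding g_def by (intro continuous_intros c yc)
  have bound_int: "((\<lambda>x. (1/\<eta>) * (norm (y x))\<^sup>2 + \<eta> * (norm (y1 x))\<^sup>2) has_integral
      ((1/\<eta>) * integral {a..b} (\<lambda>x. (norm (y x))\<^sup>2) + \<eta> * integral {a..b} (\<lambda>x. (norm (y1 x))\<^sup>2))) {a..b}"
    by (intro has_integral_add has_integral_mult_right integrable_integral integrable_continuous_real continuous_intros c yc)
  have gle: "norm (g x) \<le> (1/\<eta>) * (norm (y x))\<^sup>2 + \<eta> * (norm (y1 x))\<^sup>2" for x
  proof -
    have "norm (g x) \<le> norm (y1 x) * norm (y x) + norm (y x) * norm (y1 x)"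
      unfolding g_def by (metis norm_triangle_ineq norm_mult complex_mod_cnj)
    moreover have "0 \<le> (norm (y x) - \<eta> * norm (y1 x))\<^sup>2 / \<eta>" using \<eta> by simp
    moreover have "(norm (y x) - \<eta> * norm (y1 x))\<^sup>2 / \<eta> = (1/\<eta>) * (norm (y x))\<^sup>2 + \<eta> * (norm (y1 x))\<^sup>2 - 2 * (norm (y1 x) * norm (y x))"
      using \<eta> by (simp add: power2_eq_square field_simps)
    ultimately show ?thesis by (simp add: mult.commute[of "cmod (y x)" "cmod (y1 x)"])
  qed
  have main: "norm (y d * cnj (y d) - y e * cnj (y e)) \<le> integral {a..b} (\<lambda>x. (1/\<eta>) * (norm (y x))\<^sup>2 + \<eta> * (norm (y1 x))\<^sup>2)"
    if "a \<le> e" "e \<le> d" "d \<le> b" for d e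
  proof -
    note bi = has_integral_integrable[OF bound_int]
    have bi': "(\<lambda>x. (1/\<eta>) * (norm (y x))\<^sup>2 + \<eta> * (norm (y1 x))\<^sup>2) integrable_on {e..d}"
      using that by (intro integrable_subinterval_real[OF bi]) auto
    have "((\<lambda>x. y x * cnj (y x)) has_vector_derivative g x) (at x within {e..d})" if x: "x \<in> {e..d}" for x
    proof -
      have d1: "(y has_vector_derivative y1 x) (at x within {e..d})"
        using has_vector_derivative_within_subset[OF der[of x]] x \<open>a \<le> e\<close> \<open>d \<le> b\<close> by auto
      show ?thesis unfolding g_def
        using has_vector_derivative_mult[OF d1 bounded_linear.has_vector_derivative[OF bounded_linear_cnj d1]]
        by (simp add: add.commute)
    qed
    then have gi: "(g has_integral y d * cnj (y d) - y e * cnj (y e)) {e..d}"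
      using \<open>e \<le> d\<close> by (intro fundamental_theorem_of_calculus) auto
    then have "norm (y d * cnj (y d) - y e * cnj (y e)) = norm (integral {e..d} g)" by (simp add: has_integral_iff)
    also have "\<dots> \<le> integral {e..d} (\<lambda>x. (1/\<eta>) * (norm (y x))\<^sup>2 + \<eta> * (norm (y1 x))\<^sup>2)"
      using gi gle by (intro integral_norm_bound_integral bi') (auto simp: has_integral_iff)
    also have "\<dots> \<le> integral {a..b} (\<lambda>x. (1/\<eta>) * (norm (y x))\<^sup>2 + \<eta> * (norm (y1 x))\<^sup>2)"
      using that \<eta> by (intro integral_subset_le bi' bi) auto
    finally show ?thesis .
  qed
  have "(norm (y v))\<^sup>2 - (norm (y u))\<^sup>2 = Re (y v * cnj (y v) - y u * cnj (y u))"
    unfolding cmod_power2 by (simp add: power2_eq_square)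
  also have "\<dots> \<le> norm (y v * cnj (y v) - y u * cnj (y u))" by (rule complex_Re_le_cmod)
  also have "\<dots> \<le> integral {a..b} (\<lambda>x. (1/\<eta>) * (norm (y x))\<^sup>2 + \<eta> * (norm (y1 x))\<^sup>2)"
    using main[of u v] main[of v u] u v by (cases "u \<le> v") (auto simp: norm_minus_commute)
  also have "\<dots> = (1/\<eta>) * integral {a..b} (\<lambda>x. (norm (y x))\<^sup>2) + \<eta> * integral {a..b} (\<lambda>x. (norm (y1 x))\<^sup>2)"
    using bound_int by blast
  finally show ?thesis by simp
qed

text \<open>The increment bound for |y|^2 between x and v is multiplied by \<open>w x\<close> and
  integrated in x. With w = 1 this is a trace inequality; with w = |q| it converts control of |q|
  |y|^2 into control of |y|^2.\<close>

lemma weighted_mean_bound: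
  fixes y y1 :: "real \<Rightarrow> complex" and w :: "real \<Rightarrow> real"
  assumes der: "\<And>x. x \<in> {a..b} \<Longrightarrow> (y has_vector_derivative y1 x) (at x within {a..b})"
    and c: "continuous_on {a..b} y1" and v: "v \<in> {a..b}" and \<eta>: "\<eta> > 0"
    and w: "w absolutely_integrable_on {a..b}" and wpos: "\<And>x. x \<in> {a..b} \<Longrightarrow> w x \<ge> 0"
  shows "(norm (y v))\<^sup>2 * integral {a..b} w \<le> integral {a..b} (\<lambda>x. w x * (norm (y x))\<^sup>2)
      + integral {a..b} w * ((1/\<eta>) * integral {a..b} (\<lambda>x. (norm (y x))\<^sup>2) + \<eta> * integral {a..b} (\<lambda>x. (norm (y1 x))\<^sup>2))"
proof -
  define E where "E = (1/\<eta>) * integral {a..b} (\<lambda>x. (norm (y x))\<^sup>2) + \<eta> * integral {a..b} (\<lambda>x. (norm (y1 x))\<^sup>2)"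
  have yc: "continuous_on {a..b} y"
    unfolding continuous_on_eq_continuous_within using has_vector_derivative_continuous[OF der] by blast
  have wi: "w integrable_on {a..b}" using w set_lebesgue_integral_eq_integral(1) by blast
  have wy: "(\<lambda>x. w x * (norm (y x))\<^sup>2) integrable_on {a..b}"
    by (intro set_lebesgue_integral_eq_integral(1) absolutely_integrable_mult_continuous w continuous_intros yc)
  have "((\<lambda>x. (norm (y v))\<^sup>2 * w x) has_integral (norm (y v))\<^sup>2 * integral {a..b} w) {a..b}"
    by (intro has_integral_mult_right integrable_integral wi)
  moreover have "((\<lambda>x. w x * (norm (y x))\<^sup>2 + w x * E) has_integral
      integral {a..b} (\<lambda>x. w x * (norm (y x))\<^sup>2) + integral {a..b} w * E) {a..b}"
    by (intro has_integral_add has_integral_mult_left integrable_integral wi wy)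
  ultimately show ?thesis unfolding E_def[symmetric]
  proof (rule has_integral_le)
    fix x assume x: "x \<in> {a..b}"
    from mult_left_mono[OF norm_square_increment_le[OF der c x v \<eta>] wpos[OF x]]
    show "(norm (y v))\<^sup>2 * w x \<le> w x * (norm (y x))\<^sup>2 + w x * E" by (simp add: E_def algebra_simps)
  qed
qed

text \<open>The right side is the real part of the derivative of \<phi>^2 P y cnj y' for \<phi> = 1
  - m x, with D, z and (q + t) y - f in the roles of P', y' and y''. E measures how far the sector
  condition on q may fail, as it does on [0, x0]. The terms with E and f are kept without the
  weight, which is allowed because \<phi>^2 \<le> 1.\<close>

lemma energy_density_bound:
  fixes P D q y z f :: complex
  assumes P: "cmod P = 1" "\<sigma> \<le> Re P" and q: "(\<sigma> - E) * cmod q \<le> Re (P * cnj q)"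
    and D: "cmod D \<le> 2 * \<delta> * \<sigma> * sqrt (cmod q)" and t: "t \<ge> 0" and \<delta>: "\<delta> \<ge> 0" "\<delta> < 1" and \<sigma>: "\<sigma> > 0"
    and \<phi>: "0 \<le> \<phi>" "\<phi> \<le> 1" and m: "m \<ge> 0" and E: "E \<ge> 0"
  defines "c \<equiv> (1 - \<delta>) * \<sigma>"
  shows "\<phi>\<^sup>2 * (3 * c / 4 * (cmod z)\<^sup>2 + c * (cmod q * (cmod y)\<^sup>2) + (t * \<sigma> - 1/2) * (cmod y)\<^sup>2)
      - E * (cmod q * (cmod y)\<^sup>2) - 1/2 * (cmod f)\<^sup>2 - 4 * m\<^sup>2 / c * (cmod y)\<^sup>2
    \<le> Re (of_real (\<phi>\<^sup>2) * (D * y * cnj z + P * z * cnj z + P * y * cnj ((q + of_real t) * y - f))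
        - of_real (2 * m * \<phi>) * (P * y * cnj z))"
proof -
  have c: "c > 0" using \<delta> \<sigma> by (simp add: c_def)
  \<comment> \<open>The bound on D is matched to 2ab \<le> a^2 + b^2: it costs \<delta> \<sigma> in
    both |q| |y|^2 and |z|^2 and leaves c of the coercivity \<sigma>.\<close>
  have t1: "Re (D * y * cnj z) \<ge> - (\<delta> * \<sigma> * (cmod q * (cmod y)\<^sup>2 + (cmod z)\<^sup>2))"
  proof -
    have "cmod (D * y * cnj z) \<le> 2 * \<delta> * \<sigma> * sqrt (cmod q) * cmod y * cmod z"
      unfolding norm_mult complex_mod_cnj by (intro mult_right_mono D) auto
    also have "\<dots> = \<delta> * \<sigma> * (2 * (sqrt (cmod q) * cmod y) * cmod z)" by simp
    also have "\<dots> \<le> \<delta> * \<sigma> * ((sqrt (cmod q) * cmod y)\<^sup>2 + (cmod z)\<^sup>2)"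
      using \<delta> \<sigma> by (intro mult_left_mono sum_squares_bound) auto
    finally show ?thesis using abs_Re_le_cmod[of "D * y * cnj z"] by (simp add: power_mult_distrib)
  qed
  have t2: "Re (P * z * cnj z) \<ge> \<sigma> * (cmod z)\<^sup>2"
  proof -
    have "Re (P * z * cnj z) = Re P * (cmod z)\<^sup>2"
      by (simp add: mult.assoc complex_mult_cnj cmod_power2)
    then show ?thesis using P(2) by (simp add: mult_right_mono)
  qed
  have t3: "Re (P * y * cnj ((q + of_real t) * y - f)) \<ge> (\<sigma> - E) * (cmod q * (cmod y)\<^sup>2) + t * \<sigma> * (cmod y)\<^sup>2 - (cmod y)\<^sup>2 / 2 - (cmod f)\<^sup>2 / 2"
  proof -
    have "P * y * cnj ((q + of_real t) * y - f) = P * cnj q * (y * cnj y) + of_real t * P * (y * cnj y) - P * y * cnj f"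
      by (simp add: algebra_simps)
    then have "Re (P * y * cnj ((q + of_real t) * y - f)) = Re (P * cnj q) * (cmod y)\<^sup>2 + t * Re P * (cmod y)\<^sup>2 - Re (P * y * cnj f)"
      by (simp add: complex_mult_cnj cmod_power2)
    moreover have "Re (P * cnj q) * (cmod y)\<^sup>2 \<ge> (\<sigma> - E) * cmod q * (cmod y)\<^sup>2" using q by (intro mult_right_mono) auto
    moreover have "t * Re P * (cmod y)\<^sup>2 \<ge> t * \<sigma> * (cmod y)\<^sup>2" using P(2) t by (intro mult_right_mono mult_left_mono) auto
    moreover have "Re (P * y * cnj f) \<le> (cmod y)\<^sup>2 / 2 + (cmod f)\<^sup>2 / 2"
      using complex_Re_le_cmod[of "P * y * cnj f"] sum_squares_bound[of "cmod y" "cmod f"] P(1) by (simp add: norm_mult)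
    ultimately show ?thesis by (simp add: mult.assoc)
  qed
  have t4: "2 * m * \<phi> * Re (P * y * cnj z) \<le> \<phi>\<^sup>2 * (c / 4 * (cmod z)\<^sup>2) + 4 * m\<^sup>2 / c * (cmod y)\<^sup>2"
  proof -
    have "2 * m * \<phi> * Re (P * y * cnj z) \<le> 2 * m * \<phi> * (cmod y * cmod z)"
      using complex_Re_le_cmod[of "P * y * cnj z"] P(1) m \<phi> by (intro mult_left_mono) (auto simp: norm_mult)
    also have "\<dots> \<le> \<phi>\<^sup>2 * (c / 4 * (cmod z)\<^sup>2) + 4 * m\<^sup>2 / c * (cmod y)\<^sup>2"
    proof -
      \<comment> \<open>Completed square: a quarter of c is spent on z, while the cost in y carries
        the factor m^2, which is R^(-2) for m = 1 / R.\<close>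
      have "0 \<le> (\<phi> * c * cmod z - 4 * m * cmod y)\<^sup>2 / (4 * c)" using c by simp
      also have "\<dots> = \<phi>\<^sup>2 * (c / 4 * (cmod z)\<^sup>2) + 4 * m\<^sup>2 / c * (cmod y)\<^sup>2 - 2 * m * \<phi> * (cmod y * cmod z)"
        using c by (simp add: power2_eq_square field_simps)
      finally show ?thesis by simp
    qed
    finally show ?thesis .
  qed
  have \<phi>2: "0 \<le> \<phi>\<^sup>2" "\<phi>\<^sup>2 \<le> 1" using \<phi> by (auto simp: power_le_one)
  let ?S = "D * y * cnj z + P * z * cnj z + P * y * cnj ((q + of_real t) * y - f)"
  have "c * (cmod z)\<^sup>2 + (c - E) * (cmod q * (cmod y)\<^sup>2) + (t * \<sigma> - 1/2) * (cmod y)\<^sup>2 - (cmod f)\<^sup>2 / 2 \<le> Re ?S"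
    using t1 t2 t3 by (simp add: c_def algebra_simps)
  then have "\<phi>\<^sup>2 * (c * (cmod z)\<^sup>2 + (c - E) * (cmod q * (cmod y)\<^sup>2) + (t * \<sigma> - 1/2) * (cmod y)\<^sup>2 - (cmod f)\<^sup>2 / 2) \<le> \<phi>\<^sup>2 * Re ?S"
    using \<phi>2 by (intro mult_left_mono) auto
  moreover have "\<phi>\<^sup>2 * (E * (cmod q * (cmod y)\<^sup>2)) \<le> 1 * (E * (cmod q * (cmod y)\<^sup>2))" "\<phi>\<^sup>2 * (cmod f)\<^sup>2 \<le> 1 * (cmod f)\<^sup>2"
    using E by (simp_all only: mult_right_mono[OF \<phi>2(2)] mult_nonneg_nonneg norm_ge_zero zero_le_power2)
  moreover have "Re (of_real (\<phi>\<^sup>2) * ?S - of_real (2 * m * \<phi>) * (P * y * cnj z)) = \<phi>\<^sup>2 * Re ?S - 2 * m * \<phi> * Re (P * y * cnj z)"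
    by (simp only: minus_complex.sel times_complex.sel(1) Re_complex_of_real Im_complex_of_real mult_zero_left diff_0_right)
  ultimately show ?thesis using t4 by (simp add: algebra_simps)
qed

section \<open>Coercivity for a sectorial potential\<close>

text \<open>Records what the energy method uses of q: a unimodular, absolutely continuous multiplier
  P that stays in the right half-plane away from the imaginary axis and beyond x0 rotates cnj q
  there as well. \<open>P_deriv\<close> bounds whatever derivative P has off a null set, so no
  particular choice of P' is fixed.\<close>

locale sectorial_potential =
  fixes q P :: "real \<Rightarrow> complex" and x0 \<sigma> \<delta> :: real
  assumes x0: "x0 > 0" and \<sigma>: "0 < \<sigma>" "\<sigma> \<le> 1" and \<delta>: "0 < \<delta>" "\<delta> < 1"
    and q_integrable: "\<And>R. q absolutely_integrable_on {0..R}"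
    and P_abs_cont: "\<And>R. abs_cont_on_interval P 0 R"
    and P_norm: "\<And>x. cmod (P x) = 1"
    and P_Re: "\<And>x. \<sigma> \<le> Re (P x)"
    and P_q: "\<And>x. x \<ge> x0 \<Longrightarrow> \<sigma> * cmod (q x) \<le> Re (P x * cnj (q x))"
    and P_deriv: "\<And>R. \<exists>N. negligible N \<and> (\<forall>x\<in>{0<..<R} - N. \<forall>D. (P has_vector_derivative D) (at x) \<longrightarrow>
        cmod D \<le> 2 * \<delta> * \<sigma> * sqrt (cmod (q x)))"
begin

text \<open>What is left of the coercivity constant \<sigma> once the term with P' has taken its
  share \<delta>.\<close>

definition c :: real where "c = (1 - \<delta>) * \<sigma>"

lemma c_pos: "c > 0" using \<sigma> \<delta> by (simp add: c_def)

text \<open>The equation is -y'' + (q + t) y = f, so t > 0 corresponds to the spectral parameter -t.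
  The derivative \<open>y1\<close> is carried along because initial and boundary data refer to
  it.\<close>

definition solves :: "real \<Rightarrow> real \<Rightarrow> (real \<Rightarrow> complex) \<Rightarrow> (real \<Rightarrow> complex) \<Rightarrow> (real \<Rightarrow> complex) \<Rightarrow> bool" where
  "solves t R y y1 f \<longleftrightarrow>
     (\<forall>x\<in>{0..R}. (y has_vector_derivative y1 x) (at x within {0..R})) \<and> abs_cont_on_interval y1 0 R \<and>
     (\<exists>N. negligible N \<and> (\<forall>x\<in>{0<..<R} - N. (y1 has_vector_derivative ((q x + of_real t) * y x - f x)) (at x))) \<and>
     (\<lambda>x. (cmod (f x))\<^sup>2) integrable_on {0..R}"

lemma solvesD:
  assumes "solves t R y y1 f"
  shows "\<And>x. x \<in> {0..R} \<Longrightarrow> (y has_vector_derivative y1 x) (at x within {0..R})"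
    "continuous_on {0..R} y" "continuous_on {0..R} y1" "abs_cont_on_interval y1 0 R" "abs_cont_on_interval y 0 R"
    "(\<lambda>x. (cmod (f x))\<^sup>2) integrable_on {0..R}"
proof -
  show d: "\<And>x. x \<in> {0..R} \<Longrightarrow> (y has_vector_derivative y1 x) (at x within {0..R})"
    and ac: "abs_cont_on_interval y1 0 R" and "(\<lambda>x. (cmod (f x))\<^sup>2) integrable_on {0..R}"
    using assms unfolding solves_def by blast+
  show y1c: "continuous_on {0..R} y1" using ac by (rule abs_cont_on_interval_imp_continuous_on)
  show "continuous_on {0..R} y"
    unfolding continuous_on_eq_continuous_within using has_vector_derivative_continuous[OF d] by blast
  show "abs_cont_on_interval y 0 R" using d y1c by (rule abs_cont_on_interval_C1)
qed

lemma integrable_q_mult: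
  fixes g :: "real \<Rightarrow> real"
  assumes "continuous_on {0..R} g"
  shows "(\<lambda>x. cmod (q x) * g x) integrable_on {0..R}"
  by (intro set_lebesgue_integral_eq_integral(1) absolutely_integrable_mult_continuous assms
      absolutely_integrable_norm[OF q_integrable, unfolded o_def])

text \<open>Integrates \<open>energy_density_bound\<close> for W = (1 - m x)^2 P y cnj y'. W
  vanishes at R in either of the two ways allowed by \<open>bcR\<close>, zero weight or zero y, and
  its value at 0 is controlled by the boundary condition there.\<close>

lemma energy_inequality:
  assumes R: "x0 \<le> R" and m: "m \<ge> 0" "m * R \<le> 1" and t: "t \<ge> 0" and sol: "solves t R y y1 f"
    and bc0: "cmod (y 0) * cmod (y1 0) \<le> \<kappa>0 * (cmod (y 0))\<^sup>2"
    and bcR: "(1 - m * R) * cmod (y R) = 0"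
  shows "integral {0..R} (\<lambda>x. (1 - m * x)\<^sup>2 * (3 * c / 4 * (cmod (y1 x))\<^sup>2 + c * (cmod (q x) * (cmod (y x))\<^sup>2) + (t * \<sigma> - 1/2) * (cmod (y x))\<^sup>2))
    \<le> 1/2 * integral {0..R} (\<lambda>x. (cmod (f x))\<^sup>2) + 4 * m\<^sup>2 / c * integral {0..R} (\<lambda>x. (cmod (y x))\<^sup>2)
      + 2 * integral {0..x0} (\<lambda>x. cmod (q x) * (cmod (y x))\<^sup>2) + \<kappa>0 * (cmod (y 0))\<^sup>2"
proof -
  note S = solvesD[OF sol]
  have "R > 0" using R x0 by simp
  define W where "W x = of_real ((1 - m * x)\<^sup>2) * (P x * y x * cnj (y1 x))" for x
  \<comment> \<open>On [0, x0] only Re (P cnj q) \<ge> -|q| is available; as \<sigma> \<le> 1, this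
    is at least (\<sigma> - 2) |q|.\<close>
  define E where "E x = (if x \<in> {0..x0} then 2 else 0::real)" for x
  define k1 where "k1 x = (1 - m * x)\<^sup>2 * (3 * c / 4 * (cmod (y1 x))\<^sup>2 + c * (cmod (q x) * (cmod (y x))\<^sup>2) + (t * \<sigma> - 1/2) * (cmod (y x))\<^sup>2)" for x
  define k where "k x = k1 x - E x * (cmod (q x) * (cmod (y x))\<^sup>2) - 1/2 * (cmod (f x))\<^sup>2 - 4 * m\<^sup>2 / c * (cmod (y x))\<^sup>2" for x
  define J where "J = integral {0..x0} (\<lambda>x. cmod (q x) * (cmod (y x))\<^sup>2)"
  have k1i: "k1 integrable_on {0..R}"
  proof -
    have "(\<lambda>x. cmod (q x) * ((1 - m * x)\<^sup>2 * c * (cmod (y x))\<^sup>2) + (1 - m * x)\<^sup>2 * (3 * c / 4 * (cmod (y1 x))\<^sup>2 + (t * \<sigma> - 1/2) * (cmod (y x))\<^sup>2)) integrable_on {0..R}"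
      by (intro integrable_add integrable_q_mult integrable_continuous_real continuous_intros S)
    then show ?thesis unfolding k1_def by (simp add: algebra_simps)
  qed
  have Ei: "((\<lambda>x. E x * (cmod (q x) * (cmod (y x))\<^sup>2)) has_integral 2 * J) {0..R}"
  proof -
    have "(\<lambda>x. cmod (q x) * (cmod (y x))\<^sup>2) integrable_on {0..x0}"
      by (intro integrable_q_mult continuous_intros continuous_on_subset[OF S(2)]) (use R in auto)
    then have "((\<lambda>x. 2 * (cmod (q x) * (cmod (y x))\<^sup>2)) has_integral 2 * J) {0..x0}"
      unfolding J_def by (intro has_integral_mult_right integrable_integral)
    then have "((\<lambda>x. if x \<in> {0..x0} then 2 * (cmod (q x) * (cmod (y x))\<^sup>2) else 0) has_integral 2 * J) {0..R}"
      using R by (subst has_integral_restrict) auto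
    then show ?thesis by (rule has_integral_eq[rotated]) (simp add: E_def)
  qed
  have kint: "(k has_integral (integral {0..R} k1 - 2 * J - 1/2 * integral {0..R} (\<lambda>x. (cmod (f x))\<^sup>2)
      - 4 * m\<^sup>2 / c * integral {0..R} (\<lambda>x. (cmod (y x))\<^sup>2))) {0..R}"
    unfolding k_def
    by (intro has_integral_diff has_integral_mult_right integrable_integral k1i Ei S(6) integrable_continuous_real continuous_intros S)
  have ac: "abs_cont_on_interval W 0 R"
    unfolding W_def
  proof (intro abs_cont_on_interval_mult abs_cont_on_interval_cnj P_abs_cont S)
    show "abs_cont_on_interval (\<lambda>x. complex_of_real ((1 - m * x)\<^sup>2)) 0 R"
    proof (rule abs_cont_on_interval_C1)
      show "((\<lambda>x. complex_of_real ((1 - m * x)\<^sup>2)) has_vector_derivative of_real (- 2 * m * (1 - m * x))) (at x within {0..R})" for x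
        by (intro has_vector_derivative_of_real)
          (auto intro!: derivative_eq_intros simp: has_real_derivative_iff_has_vector_derivative[symmetric])
    qed (intro continuous_intros)
  qed
  obtain N1 where N1: "negligible N1" "\<And>x. x \<in> {0<..<R} - N1 \<Longrightarrow> (y1 has_vector_derivative ((q x + of_real t) * y x - f x)) (at x)"
    using sol unfolding solves_def by blast
  obtain P' N2 where N2: "negligible N2" "\<And>x. x \<in> {0<..<R} - N2 \<Longrightarrow> (P has_vector_derivative P' x) (at x)"
    using abs_cont_on_interval_differentiable[OF P_abs_cont, of R] \<open>R > 0\<close> by (metis less_imp_le)
  obtain N3 where N3: "negligible N3" "\<And>x D. x \<in> {0<..<R} - N3 \<Longrightarrow> (P has_vector_derivative D) (at x) \<Longrightarrow>
      cmod D \<le> 2 * \<delta> * \<sigma> * sqrt (cmod (q x))"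
    using P_deriv[of R] by blast
  have "integral {0..R} k \<le> Re (W R - W 0)"
  proof (rule abs_cont_increment_ge[OF ac])
    show "negligible (N1 \<union> N2 \<union> N3)" using N1(1) N2(1) N3(1) by (simp add: negligible_Un)
    show "k integrable_on {0..R}" using kint by blast
    fix x D assume x: "x \<in> {0<..<R} - (N1 \<union> N2 \<union> N3)" and D: "(W has_vector_derivative D) (at x)"
    define \<phi> where "\<phi> = 1 - m * x"
    define z' where "z' = (q x + of_real t) * y x - f x"
    have "m * x \<le> m * R" using x m by (intro mult_left_mono) auto
    then have \<phi>: "0 \<le> \<phi>" "\<phi> \<le> 1" using x m unfolding \<phi>_def by auto
    have dP: "(P has_vector_derivative P' x) (at x)" and dy1: "(y1 has_vector_derivative z') (at x)"
      using N1(2)[of x] N2(2)[of x] x by (auto simp: z'_def)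
    have "at x within {0..R} = at x" using x by (intro at_within_interior) (auto simp: interior_atLeastAtMost_real)
    then have dy: "(y has_vector_derivative y1 x) (at x)" using S(1)[of x] x by auto
    have d\<phi>: "((\<lambda>x. complex_of_real ((1 - m * x)\<^sup>2)) has_vector_derivative of_real (- 2 * m * \<phi>)) (at x)"
      unfolding \<phi>_def by (intro has_vector_derivative_of_real)
        (auto intro!: derivative_eq_intros simp: has_real_derivative_iff_has_vector_derivative[symmetric])
    have "(W has_vector_derivative of_real ((1 - m * x)\<^sup>2) * ((P x * y x) * cnj z' + (P x * y1 x + P' x * y x) * cnj (y1 x))
        + of_real (- 2 * m * \<phi>) * (P x * y x * cnj (y1 x))) (at x)"
      unfolding W_def
      by (intro has_vector_derivative_mult d\<phi> dP dy bounded_linear.has_vector_derivative[OF bounded_linear_cnj dy1])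
    then have D_eq: "D = of_real (\<phi>\<^sup>2) * (P' x * y x * cnj (y1 x) + P x * y1 x * cnj (y1 x) + P x * y x * cnj z') - of_real (2 * m * \<phi>) * (P x * y x * cnj (y1 x))"
      using vector_derivative_unique_at[OF D] by (simp add: \<phi>_def algebra_simps)
    have Pq: "(\<sigma> - E x) * cmod (q x) \<le> Re (P x * cnj (q x))"
    proof (cases "x \<le> x0")
      case True
      have "- cmod (q x) \<le> Re (P x * cnj (q x))"
        using abs_Re_le_cmod[of "P x * cnj (q x)"] P_norm[of x] by (simp add: norm_mult)
      moreover have "(\<sigma> - 2) * cmod (q x) \<le> (- 1) * cmod (q x)" using \<sigma> by (intro mult_right_mono) auto
      ultimately show ?thesis using True x by (simp add: E_def)
    next
      case False
      then show ?thesis using P_q[of x] by (simp add: E_def)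
    qed
    have "cmod (P' x) \<le> 2 * \<delta> * \<sigma> * sqrt (cmod (q x))" using N3(2)[OF _ dP] x by auto
    from energy_density_bound[OF P_norm P_Re Pq this t _ \<delta>(2) \<sigma>(1) \<phi> m(1), of "y1 x" "y x" "f x"] \<delta>
    show "k x \<le> Re D" unfolding D_eq k_def k1_def z'_def c_def \<phi>_def by (simp add: E_def)
  qed (use \<open>R > 0\<close> in auto)
  moreover have "W R = 0"
  proof -
    have "1 - m * R = 0 \<or> y R = 0" using bcR by simp
    then show ?thesis unfolding W_def
      by (elim disjE) (simp_all only: power_zero_numeral of_real_0 mult_zero_left mult_zero_right)
  qed
  moreover have "- Re (W 0) \<le> \<kappa>0 * (cmod (y 0))\<^sup>2"
  proof -
    have "- Re (W 0) \<le> cmod (W 0)" using abs_Re_le_cmod[of "W 0"] by linarith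
    also have "\<dots> = cmod (y 0) * cmod (y1 0)" by (simp add: W_def norm_mult P_norm)
    finally show ?thesis using bc0 by linarith
  qed
  moreover have "integral {0..R} k = integral {0..R} k1 - 2 * J - 1/2 * integral {0..R} (\<lambda>x. (cmod (f x))\<^sup>2)
      - 4 * m\<^sup>2 / c * integral {0..R} (\<lambda>x. (cmod (y x))\<^sup>2)" using kint by blast
  ultimately show ?thesis unfolding k1_def[symmetric] J_def[symmetric] by simp
qed

text \<open>The weight \<open>1 - m * x\<close> is used with \<open>m = 1 / R\<close>, which imposes nothing at \<open>R\<close>, and with
  \<open>m = 0\<close>, which requires \<open>y R = 0\<close>.\<close>
definition coercive :: "real \<Rightarrow> real \<Rightarrow> bool" where
  "coercive \<kappa>0 t \<longleftrightarrow> t > 0 \<and>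
    (\<forall>R m y y1 f. 2 * x0 \<le> R \<longrightarrow> m \<ge> 0 \<longrightarrow> m * R \<le> 1 \<longrightarrow> solves t R y y1 f \<longrightarrow>
      cmod (y 0) * cmod (y1 0) \<le> \<kappa>0 * (cmod (y 0))\<^sup>2 \<longrightarrow> (1 - m * R) * cmod (y R) = 0 \<longrightarrow>
      integral {0..R} (\<lambda>x. (1 - m * x)\<^sup>2 * (c / 2 * (cmod (y1 x))\<^sup>2 + c * (cmod (q x) * (cmod (y x))\<^sup>2) + 1 / 2 * (cmod (y x))\<^sup>2))
      \<le> 1/2 * integral {0..R} (\<lambda>x. (cmod (f x))\<^sup>2) + 4 * m\<^sup>2 / c * integral {0..R} (\<lambda>x. (cmod (y x))\<^sup>2))"

text \<open>The terms from [0, x0] and from the boundary are at most K times the maximum of |y|^2 on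
  [0, x0]. The trace inequality bounds this maximum by a small multiple of the integral of |y'|^2
  plus a large multiple of that of |y|^2, and only the latter has to be paid by t.\<close>

theorem coercive_shift:
  assumes "\<kappa>0 \<ge> 0"
  obtains t where "coercive \<kappa>0 t"
proof -
  define K where "K = 2 * integral {0..x0} (\<lambda>x. cmod (q x)) + \<kappa>0"
  have qi: "(\<lambda>x. cmod (q x)) integrable_on {0..x0}" using integrable_q_mult[of x0 "\<lambda>_. 1"] by simp
  then have q0: "integral {0..x0} (\<lambda>x. cmod (q x)) \<ge> 0" by (intro integral_nonneg) auto
  then have K: "K \<ge> 0" using assms by (simp add: K_def)
  \<comment> \<open>Makes the y' part at most c / 4, which lowers the coefficient 3 c / 4 of the
    energy inequality to c / 2.\<close>
  define \<eta> where "\<eta> = c / (16 * (K + 1))"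
  have \<eta>: "\<eta> > 0" using K c_pos by (simp add: \<eta>_def)
  have K\<eta>: "4 * K * \<eta> \<le> c / 4" using K c_pos by (simp add: \<eta>_def field_simps)
  \<comment> \<open>The factor 4 undoes the weight, which is at least 1/4 on [0, x0]. Then t is
    chosen so that the coefficient 1/2 of |y|^2 is left over.\<close>
  define C where "C = 4 * K * (1 / x0 + 1 / \<eta>)"
  have C: "C \<ge> 0" using K x0 \<eta> by (simp add: C_def)
  define t where "t = (C + 1) / \<sigma>"
  have t: "t > 0" "t * \<sigma> - 1 / 2 = C + 1 / 2" using C \<sigma> by (auto simp: t_def)
  show thesis
  proof (rule that[of t], unfold coercive_def, intro conjI allI impI t(1))
    fix R m y y1 f
    assume R: "2 * x0 \<le> R" and m: "m \<ge> 0" "m * R \<le> 1" and sol: "solves t R y y1 f"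
      and bc0: "cmod (y 0) * cmod (y1 0) \<le> \<kappa>0 * (cmod (y 0))\<^sup>2" and bcR: "(1 - m * R) * cmod (y R) = 0"
    note S = solvesD[OF sol]
    have R': "x0 \<le> R" using R x0 by simp
    define I1 where "I1 = integral {0..R} (\<lambda>x. (1 - m * x)\<^sup>2 * (cmod (y1 x))\<^sup>2)"
    define I2 where "I2 = integral {0..R} (\<lambda>x. cmod (q x) * ((1 - m * x)\<^sup>2 * (cmod (y x))\<^sup>2))"
    define I3 where "I3 = integral {0..R} (\<lambda>x. (1 - m * x)\<^sup>2 * (cmod (y x))\<^sup>2)"
    have comb: "integral {0..R} (\<lambda>x. (1 - m * x)\<^sup>2 * (a1 * (cmod (y1 x))\<^sup>2 + a2 * (cmod (q x) * (cmod (y x))\<^sup>2) + a3 * (cmod (y x))\<^sup>2))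
      = a1 * I1 + a2 * I2 + a3 * I3" for a1 a2 a3
    proof (rule integral_unique)
      have "((\<lambda>x. a1 * ((1 - m * x)\<^sup>2 * (cmod (y1 x))\<^sup>2) + a2 * (cmod (q x) * ((1 - m * x)\<^sup>2 * (cmod (y x))\<^sup>2)) + a3 * ((1 - m * x)\<^sup>2 * (cmod (y x))\<^sup>2))
        has_integral a1 * I1 + a2 * I2 + a3 * I3) {0..R}"
        unfolding I1_def I2_def I3_def
        by (intro has_integral_add has_integral_mult_right integrable_integral integrable_q_mult integrable_continuous_real continuous_intros S)
      then show "((\<lambda>x. (1 - m * x)\<^sup>2 * (a1 * (cmod (y1 x))\<^sup>2 + a2 * (cmod (q x) * (cmod (y x))\<^sup>2) + a3 * (cmod (y x))\<^sup>2))
        has_integral a1 * I1 + a2 * I2 + a3 * I3) {0..R}"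
        by (rule has_integral_eq[rotated]) (simp only: distrib_left mult.left_commute)
    qed
    \<comment> \<open>Here R \<ge> 2 x0 enters: it gives m x \<le> 1/2 on [0, x0].\<close>
    have half: "1 / 4 \<le> (1 - m * x)\<^sup>2" if "x \<in> {0..x0}" for x
    proof -
      have "2 * (m * x) \<le> m * R" using that R m(1) mult_left_mono[of "2 * x" R m] by auto
      then have "(1/2)\<^sup>2 \<le> (1 - m * x)\<^sup>2" using m(2) by (intro power_mono) auto
      then show ?thesis by (simp add: power2_eq_square)
    qed
    have quarter: "integral {0..x0} (\<lambda>x. (cmod (g x))\<^sup>2) \<le> 4 * integral {0..R} (\<lambda>x. (1 - m * x)\<^sup>2 * (cmod (g x))\<^sup>2)"
      if g: "continuous_on {0..R} g" for g :: "real \<Rightarrow> complex"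
    proof -
      have g': "continuous_on {0..x0} g" using continuous_on_subset[OF g] R' by auto
      have "integral {0..x0} (\<lambda>x. (cmod (g x))\<^sup>2) \<le> integral {0..x0} (\<lambda>x. 4 * ((1 - m * x)\<^sup>2 * (cmod (g x))\<^sup>2))"
      proof (rule integral_le)
        fix x assume "x \<in> {0..x0}"
        from mult_right_mono[OF half[OF this], of "4 * (cmod (g x))\<^sup>2"]
        show "(cmod (g x))\<^sup>2 \<le> 4 * ((1 - m * x)\<^sup>2 * (cmod (g x))\<^sup>2)" by (simp add: mult.left_commute)
      qed (intro integrable_continuous_real continuous_intros g')+
      also have "\<dots> \<le> integral {0..R} (\<lambda>x. 4 * ((1 - m * x)\<^sup>2 * (cmod (g x))\<^sup>2))"
        using R' by (intro integral_subset_le integrable_continuous_real continuous_intros g g') auto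
      finally show ?thesis by simp
    qed
    define A where "A = integral {0..x0} (\<lambda>x. (cmod (y x))\<^sup>2)"
    define B where "B = integral {0..x0} (\<lambda>x. (cmod (y1 x))\<^sup>2)"
    have A: "A \<le> 4 * I3" and B: "B \<le> 4 * I1" unfolding A_def B_def I1_def I3_def using quarter S by blast+
    define T where "T = (1 / x0 + 1 / \<eta>) * A + \<eta> * B"
    have y0: "continuous_on {0..x0} y" and y10: "continuous_on {0..x0} y1"
      using continuous_on_subset[OF S(2)] continuous_on_subset[OF S(3)] R' by auto
    have trace: "(cmod (y v))\<^sup>2 \<le> T" if v: "v \<in> {0..x0}" for v
    proof -
      have d: "(y has_vector_derivative y1 x) (at x within {0..x0})" if "x \<in> {0..x0}" for x
        using has_vector_derivative_within_subset[OF S(1)[of x]] that R' by auto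
      from weighted_mean_bound[OF d y10 v \<eta>, of "\<lambda>_. 1"] x0
      have "(cmod (y v))\<^sup>2 * x0 \<le> A + x0 * ((1 / \<eta>) * A + \<eta> * B)" by (simp add: A_def B_def)
      also have "\<dots> = T * x0" using x0 by (simp add: T_def field_simps)
      finally show ?thesis using x0 by simp
    qed
    have "integral {0..x0} (\<lambda>x. cmod (q x) * (cmod (y x))\<^sup>2) \<le> integral {0..x0} (\<lambda>x. cmod (q x) * T)"
      using trace by (intro integral_le integrable_q_mult continuous_intros y0 mult_left_mono) auto
    then have J: "2 * integral {0..x0} (\<lambda>x. cmod (q x) * (cmod (y x))\<^sup>2) + \<kappa>0 * (cmod (y 0))\<^sup>2 \<le> K * T"
      using mult_left_mono[OF trace[of 0] assms] x0 by (simp add: K_def algebra_simps)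
    have "K * T \<le> K * ((1 / x0 + 1 / \<eta>) * (4 * I3) + \<eta> * (4 * I1))"
      unfolding T_def using A B K \<eta> x0 by (intro mult_left_mono add_mono) auto
    also have "\<dots> = C * I3 + (4 * K * \<eta>) * I1" by (simp add: C_def algebra_simps)
    also have "\<dots> \<le> C * I3 + c / 4 * I1"
      using K\<eta> unfolding I1_def
      by (intro add_left_mono mult_right_mono integral_nonneg integrable_continuous_real continuous_intros S) auto
    finally have KT: "K * T \<le> C * I3 + c / 4 * I1" .
    from energy_inequality[OF R' m less_imp_le[OF t(1)] sol bc0 bcR] J KT
    show "integral {0..R} (\<lambda>x. (1 - m * x)\<^sup>2 * (c / 2 * (cmod (y1 x))\<^sup>2 + c * (cmod (q x) * (cmod (y x))\<^sup>2) + 1 / 2 * (cmod (y x))\<^sup>2))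
      \<le> 1/2 * integral {0..R} (\<lambda>x. (cmod (f x))\<^sup>2) + 4 * m\<^sup>2 / c * integral {0..R} (\<lambda>x. (cmod (y x))\<^sup>2)"
      unfolding comb t(2) by (simp add: algebra_simps)
  qed
qed

end

section \<open>Compactness\<close>

lemma integral_nonneg_mono_interval:
  fixes g :: "real \<Rightarrow> real"
  assumes "g integrable_on {0..b}" "\<And>x. g x \<ge> 0" "0 \<le> a'" "b' \<le> b"
  shows "integral {a'..b'} g \<le> integral {0..b} g"
  using assms by (intro integral_subset_le integrable_subinterval_real[OF assms(1)]) auto

text \<open>Uses |v| \<le> e |v|^2 + 1 / (4 e) in place of the Schwarz inequality. Choosing e before
  the distance b - a gives a modulus of continuity that depends only on an L2 bound for v.\<close>

lemma norm_increment_le: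
  fixes u v :: "real \<Rightarrow> complex"
  assumes der: "\<And>x. x \<in> {a..b} \<Longrightarrow> (u has_vector_derivative v x) (at x within {a..b})"
    and v: "continuous_on {a..b} v" and ab: "a \<le> b" and e: "e > 0"
  shows "cmod (u b - u a) \<le> e * integral {a..b} (\<lambda>x. (cmod (v x))\<^sup>2) + (b - a) / (4 * e)"
proof -
  have "(v has_integral u b - u a) {a..b}" using ab der by (rule fundamental_theorem_of_calculus)
  then have "cmod (u b - u a) = cmod (integral {a..b} v)" by (simp add: has_integral_iff)
  also have "\<dots> \<le> integral {a..b} (\<lambda>x. e * (cmod (v x))\<^sup>2 + 1 / (4 * e))"
  proof (rule integral_norm_bound_integral)
    fix x
    have "0 \<le> (2 * e * cmod (v x) - 1)\<^sup>2 / (4 * e)" using e by simp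
    also have "\<dots> = e * (cmod (v x))\<^sup>2 + 1 / (4 * e) - cmod (v x)" using e by (simp add: power2_eq_square field_simps)
    finally show "cmod (v x) \<le> e * (cmod (v x))\<^sup>2 + 1 / (4 * e)" by simp
  qed (intro integrable_continuous_real continuous_intros v)+
  also have "\<dots> = e * integral {a..b} (\<lambda>x. (cmod (v x))\<^sup>2) + (b - a) / (4 * e)"
  proof (rule integral_unique)
    have "((\<lambda>x. e * (cmod (v x))\<^sup>2 + 1 / (4 * e)) has_integral
      e * integral {a..b} (\<lambda>x. (cmod (v x))\<^sup>2) + (b - a) *\<^sub>R (1 / (4 * e))) {a..b}"
      using ab has_integral_const_real[of "1 / (4 * e)" a b]
      by (intro has_integral_add has_integral_mult_right integrable_integral integrable_continuous_real continuous_intros v) simp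
    then show "((\<lambda>x. e * (cmod (v x))\<^sup>2 + 1 / (4 * e)) has_integral
      e * integral {a..b} (\<lambda>x. (cmod (v x))\<^sup>2) + (b - a) / (4 * e)) {a..b}" by simp
  qed
  finally show ?thesis .
qed

text \<open>With \<eta> = 2 h in the weighted mean bound, integration over the window returns half
  of the left side, which is absorbed; dividing by the mass of w brings in 1 / G.\<close>

lemma interval_mass_le:
  fixes u v :: "real \<Rightarrow> complex" and w :: "real \<Rightarrow> real"
  assumes der: "\<And>x. x \<in> {a..a + h} \<Longrightarrow> (u has_vector_derivative v x) (at x within {a..a + h})"
    and c: "continuous_on {a..a + h} v" and h: "h > 0" and G: "G > 0"
    and w: "w absolutely_integrable_on {a..a + h}" and wpos: "\<And>x. w x \<ge> 0" and wG: "G \<le> integral {a..a + h} w"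
  shows "integral {a..a + h} (\<lambda>x. (cmod (u x))\<^sup>2) \<le>
     2 * h / G * integral {a..a + h} (\<lambda>x. w x * (cmod (u x))\<^sup>2) + 4 * h\<^sup>2 * integral {a..a + h} (\<lambda>x. (cmod (v x))\<^sup>2)"
proof -
  define Iu where "Iu = integral {a..a + h} (\<lambda>x. (cmod (u x))\<^sup>2)"
  define Iv where "Iv = integral {a..a + h} (\<lambda>x. (cmod (v x))\<^sup>2)"
  define Iw where "Iw = integral {a..a + h} (\<lambda>x. w x * (cmod (u x))\<^sup>2)"
  define V where "V = integral {a..a + h} w"
  have V: "V > 0" "G \<le> V" using G wG by (auto simp: V_def)
  have uc: "continuous_on {a..a + h} u"
    unfolding continuous_on_eq_continuous_within using has_vector_derivative_continuous[OF der] by blast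
  have wu: "(\<lambda>x. w x * (cmod (u x))\<^sup>2) integrable_on {a..a + h}"
    by (intro set_lebesgue_integral_eq_integral(1) absolutely_integrable_mult_continuous w continuous_intros uc)
  have Iw: "Iw \<ge> 0" unfolding Iw_def using wpos by (intro integral_nonneg wu) auto
  have pt: "(cmod (u x))\<^sup>2 \<le> Iw / G + Iu / (2 * h) + 2 * h * Iv" if x: "x \<in> {a..a + h}" for x
  proof -
    have "(cmod (u x))\<^sup>2 * V \<le> Iw + V * ((1 / (2 * h)) * Iu + 2 * h * Iv)"
      unfolding Iw_def Iu_def Iv_def V_def
      using weighted_mean_bound[OF der c x, of "2 * h" w] w wpos h by simp
    then have "(cmod (u x))\<^sup>2 \<le> (Iw + V * ((1 / (2 * h)) * Iu + 2 * h * Iv)) / V"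
      using V(1) by (simp add: pos_le_divide_eq)
    also have "\<dots> = Iw / V + Iu / (2 * h) + 2 * h * Iv" using V(1) by (simp add: field_simps)
    also have "Iw / V \<le> Iw / G" using V G Iw by (intro divide_left_mono) auto
    finally show ?thesis by simp
  qed
  have "integral {a..a + h} (\<lambda>x. (cmod (u x))\<^sup>2) \<le> integral {a..a + h} (\<lambda>x. Iw / G + Iu / (2 * h) + 2 * h * Iv)"
    by (intro integral_le integrable_continuous_real continuous_intros uc pt)
  then have "Iu \<le> integral {a..a + h} (\<lambda>x. Iw / G + Iu / (2 * h) + 2 * h * Iv)"
    by (simp only: Iu_def[symmetric])
  also have "\<dots> = h * (Iw / G) + Iu / 2 + 2 * h\<^sup>2 * Iv" using h by (simp add: field_simps power2_eq_square)
  finally have "Iu \<le> 2 * h / G * Iw + 4 * h\<^sup>2 * Iv" by (simp add: field_simps)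
  then show ?thesis by (simp add: Iu_def Iw_def Iv_def)
qed

text \<open>The tail is cut into consecutive windows of length h and the window estimates are added.
  With G held fixed, the smallness of the factor comes from h.\<close>

lemma tail_mass_le:
  fixes u v :: "real \<Rightarrow> complex" and w :: "real \<Rightarrow> real"
  assumes der: "\<And>x. x \<ge> 0 \<Longrightarrow> (u has_vector_derivative v x) (at x within {0..})"
    and c: "continuous_on {0..} v" and h: "h > 0" and G: "G > 0" and X: "X \<ge> 0"
    and w: "\<And>R. w absolutely_integrable_on {0..R}" and wpos: "\<And>x. w x \<ge> 0"
    and wG: "\<And>x. x \<ge> X \<Longrightarrow> G \<le> integral {x..x + h} w"
    and B: "\<And>R. R \<ge> 0 \<Longrightarrow> integral {0..R} (\<lambda>x. w x * (cmod (u x))\<^sup>2) \<le> B" "\<And>R. R \<ge> 0 \<Longrightarrow> integral {0..R} (\<lambda>x. (cmod (v x))\<^sup>2) \<le> B"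
  shows "integral {X..Y} (\<lambda>x. (cmod (u x))\<^sup>2) \<le> (2 * h / G + 4 * h\<^sup>2) * B"
proof -
  have uc: "continuous_on {0..} u"
    unfolding continuous_on_eq_continuous_within by (auto intro: has_vector_derivative_continuous[OF der])
  have ucs: "continuous_on {a..b} u" and vcs: "continuous_on {a..b} v" if "a \<ge> 0" for a b
    using continuous_on_subset[OF uc] continuous_on_subset[OF c] that by auto
  have ui: "(\<lambda>x. (cmod (u x))\<^sup>2) integrable_on {a..b}" and vi: "(\<lambda>x. (cmod (v x))\<^sup>2) integrable_on {a..b}" if "a \<ge> 0" for a b
    using that by (intro integrable_continuous_real continuous_intros ucs vcs; simp)+
  have ws: "w absolutely_integrable_on {a..b}" if "a \<ge> 0" for a b
    using w[of b] by (rule absolutely_integrable_on_subinterval) (use that in auto)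
  have wi: "(\<lambda>x. w x * (cmod (u x))\<^sup>2) integrable_on {a..b}" if "a \<ge> 0" for a b
    using that by (intro set_lebesgue_integral_eq_integral(1) absolutely_integrable_mult_continuous ws continuous_intros ucs)
  have step: "integral {X..X + real n * h} (\<lambda>x. (cmod (u x))\<^sup>2) \<le>
     2 * h / G * integral {X..X + real n * h} (\<lambda>x. w x * (cmod (u x))\<^sup>2) + 4 * h\<^sup>2 * integral {X..X + real n * h} (\<lambda>x. (cmod (v x))\<^sup>2)" for n
  proof (induction n)
    case (Suc n)
    define Z where "Z = X + real n * h"
    have Z: "X \<le> Z" "Z \<le> Z + h" "X + real (Suc n) * h = Z + h" using h by (auto simp: Z_def algebra_simps)
    have split: "integral {X..Z + h} g = integral {X..Z} g + integral {Z..Z + h} g" if "g integrable_on {X..Z + h}" for g :: "real \<Rightarrow> real"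
      using Z by (intro Henstock_Kurzweil_Integration.integral_combine[symmetric] that) auto
    have d: "(u has_vector_derivative v x) (at x within {Z..Z + h})" if "x \<in> {Z..Z + h}" for x
      using has_vector_derivative_within_subset[OF der[of x]] that Z X by auto
    have "integral {Z..Z + h} (\<lambda>x. (cmod (u x))\<^sup>2) \<le>
     2 * h / G * integral {Z..Z + h} (\<lambda>x. w x * (cmod (u x))\<^sup>2) + 4 * h\<^sup>2 * integral {Z..Z + h} (\<lambda>x. (cmod (v x))\<^sup>2)"
      using Z X by (intro interval_mass_le d vcs h G ws wpos wG) auto
    then show ?case
      using Suc unfolding Z(3) split[OF ui[OF X]] split[OF vi[OF X]] split[OF wi[OF X]] Z_def[symmetric]
      by (simp add: algebra_simps)
  qed simp
  have B0: "B \<ge> 0" using B(2)[of 0] by simp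
  obtain n where n: "(Y - X) / h \<le> real n" using real_arch_simple by blast
  then have Y: "Y \<le> X + real n * h" using h by (simp add: field_simps)
  have "integral {X..Y} (\<lambda>x. (cmod (u x))\<^sup>2) \<le> integral {X..X + real n * h} (\<lambda>x. (cmod (u x))\<^sup>2)"
    using Y X by (intro integral_subset_le ui) auto
  also note step[of n]
  also have "2 * h / G * integral {X..X + real n * h} (\<lambda>x. w x * (cmod (u x))\<^sup>2) + 4 * h\<^sup>2 * integral {X..X + real n * h} (\<lambda>x. (cmod (v x))\<^sup>2)
     \<le> 2 * h / G * B + 4 * h\<^sup>2 * B"
  proof (intro add_mono mult_left_mono)
    show "integral {X..X + real n * h} (\<lambda>x. w x * (cmod (u x))\<^sup>2) \<le> B"
      using integral_nonneg_mono_interval[OF wi[of 0 "X + real n * h"], of X "X + real n * h"] B(1)[of "X + real n * h"] X h wpos by simp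
    show "integral {X..X + real n * h} (\<lambda>x. (cmod (v x))\<^sup>2) \<le> B"
      using integral_nonneg_mono_interval[OF vi[of 0 "X + real n * h"], of X "X + real n * h"] B(2)[of "X + real n * h"] X h by simp
  qed (use h G in auto)
  finally show ?thesis by (simp add: distrib_right)
qed

text \<open>The weighted mean bound on [x, x + 1] with w = 1 and \<eta> = 1: the integral of |u|^2
  enters twice, that of |v|^2 once.\<close>

lemma sup_bound:
  fixes u v :: "real \<Rightarrow> complex"
  assumes der: "\<And>x. x \<ge> 0 \<Longrightarrow> (u has_vector_derivative v x) (at x within {0..})"
    and c: "continuous_on {0..} v"
    and B: "\<And>R. R \<ge> 0 \<Longrightarrow> integral {0..R} (\<lambda>x. (cmod (u x))\<^sup>2) \<le> B" "\<And>R. R \<ge> 0 \<Longrightarrow> integral {0..R} (\<lambda>x. (cmod (v x))\<^sup>2) \<le> B"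
    and x: "x \<ge> 0"
  shows "(cmod (u x))\<^sup>2 \<le> 3 * B"
proof -
  have uc: "continuous_on {0..} u"
    unfolding continuous_on_eq_continuous_within by (auto intro: has_vector_derivative_continuous[OF der])
  have ui: "(\<lambda>x. (cmod (u x))\<^sup>2) integrable_on {0..b}" and vi: "(\<lambda>x. (cmod (v x))\<^sup>2) integrable_on {0..b}" for b
    by (intro integrable_continuous_real continuous_intros continuous_on_subset[OF uc] continuous_on_subset[OF c]; auto)+
  have d: "(u has_vector_derivative v s) (at s within {x..x + 1})" if "s \<in> {x..x + 1}" for s
    using has_vector_derivative_within_subset[OF der[of s]] that x by auto
  have "continuous_on {x..x + 1} v" using x by (intro continuous_on_subset[OF c]) auto
  from weighted_mean_bound[OF d this, of x 1 "\<lambda>_. 1"]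
  have "(cmod (u x))\<^sup>2 \<le> 2 * integral {x..x + 1} (\<lambda>x. (cmod (u x))\<^sup>2) + integral {x..x + 1} (\<lambda>x. (cmod (v x))\<^sup>2)" by simp
  moreover have "integral {x..x + 1} (\<lambda>x. (cmod (u x))\<^sup>2) \<le> B"
    using integral_nonneg_mono_interval[OF ui[of "x + 1"], of x "x + 1"] B(1)[of "x + 1"] x by simp
  moreover have "integral {x..x + 1} (\<lambda>x. (cmod (v x))\<^sup>2) \<le> B"
    using integral_nonneg_mono_interval[OF vi[of "x + 1"], of x "x + 1"] B(2)[of "x + 1"] x by simp
  ultimately show ?thesis by linarith
qed

text \<open>A diagonal subsequence converges on the rationals, and equicontinuity, from the L2 bound
  on the derivatives, extends this to every point. Dominated convergence gives L2 convergence on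
  [0, X]; beyond X the weight makes the mass uniformly small.\<close>

theorem weighted_sobolev_compactness:
  fixes u v :: "nat \<Rightarrow> real \<Rightarrow> complex" and w :: "real \<Rightarrow> real"
  assumes der: "\<And>n x. x \<ge> 0 \<Longrightarrow> (u n has_vector_derivative v n x) (at x within {0..})"
    and c: "\<And>n. continuous_on {0..} (v n)"
    and w: "\<And>R. w absolutely_integrable_on {0..R}" and wpos: "\<And>x. w x \<ge> 0"
    and wG: "\<And>h G. h > 0 \<Longrightarrow> \<exists>X\<ge>0. \<forall>x\<ge>X. G \<le> integral {x..x + h} w"
    and B: "\<And>n R. R \<ge> 0 \<Longrightarrow> integral {0..R} (\<lambda>x. (cmod (u n x))\<^sup>2) \<le> B"
      "\<And>n R. R \<ge> 0 \<Longrightarrow> integral {0..R} (\<lambda>x. (cmod (v n x))\<^sup>2) \<le> B"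
      "\<And>n R. R \<ge> 0 \<Longrightarrow> integral {0..R} (\<lambda>x. w x * (cmod (u n x))\<^sup>2) \<le> B"
  obtains r :: "nat \<Rightarrow> nat" and z where "strict_mono r" "continuous_on {0..} z" "\<And>R. R \<ge> 0 \<Longrightarrow> integral {0..R} (\<lambda>x. (cmod (z x))\<^sup>2) \<le> B"
    "\<And>\<epsilon>. \<epsilon> > 0 \<Longrightarrow> \<exists>N. \<forall>n\<ge>N. \<forall>R\<ge>0. integral {0..R} (\<lambda>x. (cmod (u (r n) x - z x))\<^sup>2) \<le> \<epsilon>"
proof -
  have B0: "B \<ge> 0" using B(1)[of 0] by simp
  have uc: "continuous_on {0..} (u n)" for n
    unfolding continuous_on_eq_continuous_within by (auto intro: has_vector_derivative_continuous[OF der])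
  have vi: "(\<lambda>x. (cmod (v n x))\<^sup>2) integrable_on {0..b}" for b n
    by (intro integrable_continuous_real continuous_intros continuous_on_subset[OF c]) auto
  have sup: "cmod (u n x) \<le> sqrt (3 * B)" if "x \<ge> 0" for n x
    using real_le_rsqrt[OF sup_bound[OF der c B(1,2) that]] by blast
  have inc: "cmod (u n x - u n y) \<le> e * B + (x - y) / (4 * e)" if "0 \<le> y" "y \<le> x" "e > 0" for n x y e
  proof -
    have d: "(u n has_vector_derivative v n s) (at s within {y..x})" if "s \<in> {y..x}" for s
      using has_vector_derivative_within_subset[OF der[of s]] that \<open>0 \<le> y\<close> by auto
    have "continuous_on {y..x} (v n)" using that by (intro continuous_on_subset[OF c]) auto
    from norm_increment_le[OF d this that(2,3)]
    have "cmod (u n x - u n y) \<le> e * integral {y..x} (\<lambda>x. (cmod (v n x))\<^sup>2) + (x - y) / (4 * e)" .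
    also have "integral {y..x} (\<lambda>x. (cmod (v n x))\<^sup>2) \<le> B"
      using integral_nonneg_mono_interval[OF vi[of n x], of y x] B(2)[of x n] that by simp
    finally show ?thesis using that by simp
  qed
  have equi: "cmod (u n x - u n y) \<le> e * B + \<bar>x - y\<bar> / (4 * e)" if "0 \<le> y" "0 \<le> x" "e > 0" for n x y e
    using inc[of y x e n] inc[of x y e n] that by (cases "y \<le> x") (auto simp: norm_minus_commute abs_minus_commute)
  have equi_small: "\<exists>d>0. \<forall>n. \<forall>x\<ge>0. \<forall>y\<ge>0. \<bar>x - y\<bar> < d \<longrightarrow> cmod (u n x - u n y) \<le> \<epsilon>" if "\<epsilon> > 0" for \<epsilon>
  proof -
    \<comment> \<open>Splits \<epsilon> evenly between the two terms of \<open>equi\<close>: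
      \<open>e * B\<close> takes one half, and the distance \<open>2 * e * \<epsilon>\<close> chosen
      below leaves the other.\<close>
    define e where "e = \<epsilon> / (2 * (B + 1))"
    have e: "e > 0" "e * B \<le> \<epsilon> / 2" using that B0 by (auto simp: e_def field_simps)
    show ?thesis
    proof (intro exI[of _ "2 * e * \<epsilon>"] conjI allI impI)
      show "0 < 2 * e * \<epsilon>" using e that by simp
      fix n x y assume xy: "0 \<le> x" "0 \<le> y" "\<bar>x - y\<bar> < 2 * e * \<epsilon>"
      have "\<bar>x - y\<bar> / (4 * e) \<le> \<epsilon> / 2" using xy(3) e by (simp add: field_simps)
      then show "cmod (u n x - u n y) \<le> \<epsilon>" using equi[OF xy(2,1) e(1), of n] e(2) by linarith
    qed
  qed
  have "countable (\<rat> \<inter> {0..} :: real set)" by (intro countable_Int1 countable_rat)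
  then obtain r :: "nat \<Rightarrow> nat" where r: "strict_mono r" "\<And>x. x \<in> \<rat> \<inter> {0..} \<Longrightarrow> \<exists>l. (\<lambda>n. u (r n) x) \<longlonglongrightarrow> l"
    using function_convergent_subsequence[of "\<rat> \<inter> {0..}" u "sqrt (3 * B)"] sup by auto
  have conv: "convergent (\<lambda>n. u (r n) x)" if x: "x \<ge> 0" for x
  proof (rule Cauchy_convergent, rule metric_CauchyI)
    fix \<epsilon> :: real assume "\<epsilon> > 0"
    obtain d where d: "d > 0" "\<And>n y. y \<ge> 0 \<Longrightarrow> \<bar>x - y\<bar> < d \<Longrightarrow> cmod (u n x - u n y) \<le> \<epsilon> / 4"
      using equi_small[of "\<epsilon> / 4"] \<open>\<epsilon> > 0\<close> x by (metis divide_pos_pos zero_less_numeral)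
    obtain y where y: "y \<in> \<rat>" "x < y" "y < x + d" using Rats_dense_in_real[of x "x + d"] d(1) by auto
    then obtain l where "(\<lambda>n. u (r n) y) \<longlonglongrightarrow> l" using r(2)[of y] x by auto
    then have "Cauchy (\<lambda>n. u (r n) y)" by (rule LIMSEQ_imp_Cauchy)
    then obtain M where M: "\<And>m n. m \<ge> M \<Longrightarrow> n \<ge> M \<Longrightarrow> dist (u (r m) y) (u (r n) y) < \<epsilon> / 4"
      using \<open>\<epsilon> > 0\<close> unfolding Cauchy_def by (metis divide_pos_pos zero_less_numeral)
    have "dist (u (r m) x) (u (r n) x) < \<epsilon>" if "m \<ge> M" "n \<ge> M" for m n
    proof -
      have *: "cmod (u (r m) x - u (r m) y) \<le> \<epsilon> / 4" "cmod (u (r n) x - u (r n) y) \<le> \<epsilon> / 4" using d(2)[of y] y x by auto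
      have "dist (u (r m) x) (u (r n) x) \<le> dist (u (r m) x) (u (r m) y) + (dist (u (r m) y) (u (r n) y) + dist (u (r n) y) (u (r n) x))"
        by (metis dist_triangle order_trans add_left_mono)
      then show ?thesis using * M[OF that] \<open>\<epsilon> > 0\<close> by (simp add: dist_norm norm_minus_commute)
    qed
    then show "\<exists>M. \<forall>m\<ge>M. \<forall>n\<ge>M. dist (u (r m) x) (u (r n) x) < \<epsilon>" by blast
  qed
  define z where "z x = lim (\<lambda>n. u (r n) x)" for x
  have lim: "(\<lambda>n. u (r n) x) \<longlonglongrightarrow> z x" if "x \<ge> 0" for x
    using conv[OF that] by (simp add: z_def convergent_LIMSEQ_iff)
  have zc: "continuous_on {0..} z"
    unfolding continuous_on_iff
  proof (intro ballI allI impI)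
    fix x \<epsilon> :: real assume x: "x \<in> {0..}" and "\<epsilon> > 0"
    obtain d where d: "d > 0" "\<And>n y. y \<ge> 0 \<Longrightarrow> \<bar>x - y\<bar> < d \<Longrightarrow> cmod (u n x - u n y) \<le> \<epsilon> / 2"
      using equi_small[of "\<epsilon> / 2"] \<open>\<epsilon> > 0\<close> x by (metis atLeast_iff half_gt_zero)
    have "dist (z y) (z x) < \<epsilon>" if y: "y \<in> {0..}" "dist y x < d" for y
    proof -
      have "(\<lambda>n. cmod (u (r n) x - u (r n) y)) \<longlonglongrightarrow> cmod (z x - z y)"
        using x y by (intro tendsto_intros lim) auto
      then have "cmod (z x - z y) \<le> \<epsilon> / 2"
        by (rule LIMSEQ_le_const2) (use d(2)[of y] y in \<open>auto simp: dist_real_def abs_minus_commute\<close>)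
      then show ?thesis using \<open>\<epsilon> > 0\<close> by (simp add: dist_norm norm_minus_commute)
    qed
    then show "\<exists>d>0. \<forall>y\<in>{0..}. dist y x < d \<longrightarrow> dist (z y) (z x) < \<epsilon>" using d(1) by blast
  qed
  have zsup: "cmod (z x) \<le> sqrt (3 * B)" if "x \<ge> 0" for x
    by (rule LIMSEQ_le_const2[OF tendsto_norm[OF lim[OF that]]]) (use sup[OF that] in auto)
  have ci: "g integrable_on {a..b}" if "continuous_on {0..} g" "a \<ge> 0" for g :: "real \<Rightarrow> real" and a b
    using that by (intro integrable_continuous_real continuous_on_subset[OF that(1)]) auto
  have limz: "(\<lambda>n. integral {a..b} (\<lambda>x. (cmod (u (r n) x))\<^sup>2)) \<longlonglongrightarrow> integral {a..b} (\<lambda>x. (cmod (z x))\<^sup>2)" if "a \<ge> 0" for a b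
  proof (rule dominated_convergence(2)[where h="\<lambda>_. (sqrt (3 * B))\<^sup>2"])
    show "(\<lambda>x. (cmod (u (r n) x))\<^sup>2) integrable_on {a..b}" for n by (intro ci continuous_intros uc that)
    show "norm ((cmod (u (r n) x))\<^sup>2) \<le> (sqrt (3 * B))\<^sup>2" if "x \<in> {a..b}" for n x
      using sup[of x "r n"] that \<open>a \<ge> 0\<close> by (simp add: power_mono del: real_sqrt_pow2)
    show "(\<lambda>n. (cmod (u (r n) x))\<^sup>2) \<longlonglongrightarrow> (cmod (z x))\<^sup>2" if "x \<in> {a..b}" for x
      using that \<open>a \<ge> 0\<close> by (intro tendsto_intros lim) auto
  qed auto
  have lim0: "(\<lambda>n. integral {0..b} (\<lambda>x. (cmod (u (r n) x - z x))\<^sup>2)) \<longlonglongrightarrow> 0" for b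
  proof -
    have "(\<lambda>n. integral {0..b} (\<lambda>x. (cmod (u (r n) x - z x))\<^sup>2)) \<longlonglongrightarrow> integral {0..b} (\<lambda>x. 0)"
    proof (rule dominated_convergence(2)[where h="\<lambda>_. (2 * sqrt (3 * B))\<^sup>2"])
      show "(\<lambda>x. (cmod (u (r n) x - z x))\<^sup>2) integrable_on {0..b}" for n by (intro ci continuous_intros uc zc) auto
      show "norm ((cmod (u (r n) x - z x))\<^sup>2) \<le> (2 * sqrt (3 * B))\<^sup>2" if "x \<in> {0..b}" for n x
      proof -
        have "cmod (u (r n) x - z x) \<le> 2 * sqrt (3 * B)"
          using norm_triangle_ineq4[of "u (r n) x" "z x"] sup[of x "r n"] zsup[of x] that by auto
        from power_mono[OF this norm_ge_zero, of 2] show ?thesis by simp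
      qed
      show "(\<lambda>n. (cmod (u (r n) x - z x))\<^sup>2) \<longlonglongrightarrow> 0" if "x \<in> {0..b}" for x
        using tendsto_power[OF tendsto_norm[OF tendsto_diff[OF lim[of x] tendsto_const[of "z x"]]], of 2] that by simp
    qed auto
    then show ?thesis by simp
  qed
  have zB: "integral {0..R} (\<lambda>x. (cmod (z x))\<^sup>2) \<le> B" if "R \<ge> 0" for R
    by (rule LIMSEQ_le_const2[OF limz[OF order_refl]]) (use B(1)[OF that] in auto)
  have L2_conv: "\<exists>N. \<forall>n\<ge>N. \<forall>R\<ge>0. integral {0..R} (\<lambda>x. (cmod (u (r n) x - z x))\<^sup>2) \<le> \<epsilon>" if "\<epsilon> > 0" for \<epsilon>
  proof -
    \<comment> \<open>With G = 1 and h \<le> 1 the tail factor is at most 6 h, so the tails of both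
      functions are at most \<epsilon>/8. The difference then costs 2 \<epsilon>/8 + 2 \<epsilon>/8
      beyond X, and the other \<epsilon>/2 is spent on [0, X].\<close>
    define h where "h = min 1 (\<epsilon> / (48 * (B + 1)))"
    have h: "h > 0" "h \<le> 1" "h \<le> \<epsilon> / (48 * (B + 1))" using that B0 by (auto simp: h_def)
    obtain X where X: "X \<ge> 0" "\<And>x. x \<ge> X \<Longrightarrow> 1 \<le> integral {x..x + h} w"
      using wG[OF h(1), of 1] by blast
    have "h\<^sup>2 \<le> h" using h by (simp add: power2_eq_square mult_left_le)
    then have "(2 * h / 1 + 4 * h\<^sup>2) * B \<le> 6 * h * B" using B0 by (intro mult_right_mono) auto
    also have "\<dots> \<le> 6 * (\<epsilon> / (48 * (B + 1))) * B" using h(3) B0 by (intro mult_right_mono) auto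
    also have "\<dots> \<le> \<epsilon> / 8" using that B0 by (simp add: field_simps)
    finally have hB: "(2 * h / 1 + 4 * h\<^sup>2) * B \<le> \<epsilon> / 8" .
    have tail: "integral {X..Y} (\<lambda>x. (cmod (u n x))\<^sup>2) \<le> \<epsilon> / 8" for n Y
      by (rule order_trans[OF tail_mass_le[OF der c h(1) zero_less_one X(1) w wpos X(2) B(3,2)] hB])
    have ztail: "integral {X..Y} (\<lambda>x. (cmod (z x))\<^sup>2) \<le> \<epsilon> / 8" for Y
      by (rule LIMSEQ_le_const2[OF limz[OF X(1)]]) (use tail in auto)
    have "\<forall>\<^sub>F n in sequentially. integral {0..X} (\<lambda>x. (cmod (u (r n) x - z x))\<^sup>2) < \<epsilon> / 2"
      using that by (intro order_tendstoD(2)[OF lim0]) auto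
    then obtain N where N: "\<And>n. n \<ge> N \<Longrightarrow> integral {0..X} (\<lambda>x. (cmod (u (r n) x - z x))\<^sup>2) < \<epsilon> / 2"
      unfolding eventually_sequentially by blast
    have "integral {0..R} (\<lambda>x. (cmod (u (r n) x - z x))\<^sup>2) \<le> \<epsilon>" if "n \<ge> N" for n R
    proof -
      define R' where "R' = max R X"
      have di: "(\<lambda>x. (cmod (u (r n) x - z x))\<^sup>2) integrable_on {a..b}" if "a \<ge> 0" for a b
        by (intro ci continuous_intros uc zc that)
      have "integral {0..R} (\<lambda>x. (cmod (u (r n) x - z x))\<^sup>2) \<le> integral {0..R'} (\<lambda>x. (cmod (u (r n) x - z x))\<^sup>2)"
        using di by (intro integral_subset_le) (auto simp: R'_def)
      also have "\<dots> = integral {0..X} (\<lambda>x. (cmod (u (r n) x - z x))\<^sup>2) + integral {X..R'} (\<lambda>x. (cmod (u (r n) x - z x))\<^sup>2)"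
        using X(1) by (intro Henstock_Kurzweil_Integration.integral_combine[symmetric] di) (auto simp: R'_def)
      also have "integral {X..R'} (\<lambda>x. (cmod (u (r n) x - z x))\<^sup>2) \<le> integral {X..R'} (\<lambda>x. 2 * (cmod (u (r n) x))\<^sup>2 + 2 * (cmod (z x))\<^sup>2)"
      proof (intro integral_le di X(1))
        show "(\<lambda>x. 2 * (cmod (u (r n) x))\<^sup>2 + 2 * (cmod (z x))\<^sup>2) integrable_on {X..R'}"
          by (intro ci continuous_intros uc zc X(1))
        fix x
        have "(cmod (u (r n) x - z x))\<^sup>2 \<le> (cmod (u (r n) x) + cmod (z x))\<^sup>2"
          by (intro power_mono norm_triangle_ineq4) auto
        also have "\<dots> \<le> 2 * (cmod (u (r n) x))\<^sup>2 + 2 * (cmod (z x))\<^sup>2"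
          using sum_squares_bound[of "cmod (u (r n) x)" "cmod (z x)"] by (simp add: power2_sum)
        finally show "(cmod (u (r n) x - z x))\<^sup>2 \<le> 2 * (cmod (u (r n) x))\<^sup>2 + 2 * (cmod (z x))\<^sup>2" .
      qed
      also have "\<dots> = 2 * integral {X..R'} (\<lambda>x. (cmod (u (r n) x))\<^sup>2) + 2 * integral {X..R'} (\<lambda>x. (cmod (z x))\<^sup>2)"
        by (intro integral_unique has_integral_add has_integral_mult_right integrable_integral ci continuous_intros uc zc X(1))
      also have "\<dots> \<le> \<epsilon> / 2" using tail[of R' "r n"] ztail[of R'] by simp
      finally show ?thesis using N[OF that] by simp
    qed
    then show ?thesis by blast
  qed
  show thesis
  proof (rule that[OF r(1) zc])
    show "integral {0..R} (\<lambda>x. (cmod (z x))\<^sup>2) \<le> B" if "R \<ge> 0" for R by (rule zB[OF that])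
    show "\<exists>N. \<forall>n\<ge>N. \<forall>R\<ge>0. integral {0..R} (\<lambda>x. (cmod (u (r n) x - z x))\<^sup>2) \<le> \<epsilon>" if "\<epsilon> > 0" for \<epsilon>
      by (rule L2_conv[OF that])
  qed
qed

section \<open>Square-integrable functions and the half-phase\<close>

lemma negligible_imp_AE_lborel:
  assumes "negligible N" "\<And>x. x \<notin> N \<Longrightarrow> Q x"
  shows "AE x in lborel. Q x"
proof -
  have "AE x in lebesgue. Q x"
    using assms by (auto simp: eventually_ae_filter_negligible)
  then show ?thesis by (simp add: AE_completion_iff)
qed

lemma AE_lborel_imp_negligible:
  assumes "AE x in lborel. Q x"
  obtains N where "negligible N" "\<And>x. x \<notin> N \<Longrightarrow> Q x"
proof -
  have "AE x in lebesgue. Q x" using assms by (rule AE_completion)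
  then show thesis using that by (auto simp: eventually_ae_filter_negligible)
qed

lemma set_integrable_lborel_imp_absolutely_integrable:
  fixes f :: "real \<Rightarrow> 'a::euclidean_space"
  assumes "set_integrable lborel S f"
  shows "f absolutely_integrable_on S"
  using assms unfolding set_integrable_def by (intro integrable_completion[THEN iffD2]) auto

lemma L2_Rplus_integral:
  assumes "L2_Rplus f"
  shows "(\<lambda>x. (cmod (f x))\<^sup>2) integrable_on {0..R}"
    "integral {0..R} (\<lambda>x. (cmod (f x))\<^sup>2) \<le> (L2_norm_Rplus f)\<^sup>2"
proof -
  have i: "set_integrable lborel {0..} (\<lambda>x. (cmod (f x))\<^sup>2)" using assms by (simp add: L2_Rplus_def)
  note j = set_borel_integral_eq_integral[OF i]
  have "(\<lambda>x. (cmod (f x))\<^sup>2) absolutely_integrable_on {0..}" using i by (rule set_integrable_lborel_imp_absolutely_integrable)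
  then have "(\<lambda>x. (cmod (f x))\<^sup>2) absolutely_integrable_on {0..R}"
    by (rule set_integrable_subset) auto
  then show k: "(\<lambda>x. (cmod (f x))\<^sup>2) integrable_on {0..R}" by (rule set_lebesgue_integral_eq_integral(1))
  have "integral {0..R} (\<lambda>x. (cmod (f x))\<^sup>2) \<le> integral {0..} (\<lambda>x. (cmod (f x))\<^sup>2)"
    by (rule integral_subset_le[OF _ k j(1)]) auto
  also have "\<dots> = (L2_norm_Rplus f)\<^sup>2"
    unfolding L2_norm_Rplus_def j(2)[symmetric]
    by (rule real_sqrt_pow2[symmetric]) (auto simp: set_lebesgue_integral_def intro!: integral_nonneg_AE)
  finally show "integral {0..R} (\<lambda>x. (cmod (f x))\<^sup>2) \<le> (L2_norm_Rplus f)\<^sup>2" .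
qed

text \<open>Monotone convergence along the intervals [0, k] passes from bounds on all finite
  intervals to the half-line. Borel measurability is a separate assumption because the gauge
  integral yields Lebesgue measurability.\<close>

lemma L2_Rplus_bounded:
  assumes m: "set_borel_measurable lborel {0..} f" and i: "\<And>R. R \<ge> 0 \<Longrightarrow> (\<lambda>x. (cmod (f x))\<^sup>2) integrable_on {0..R}"
    and b: "\<And>R. R \<ge> 0 \<Longrightarrow> integral {0..R} (\<lambda>x. (cmod (f x))\<^sup>2) \<le> B"
  shows "L2_Rplus f" "(L2_norm_Rplus f)\<^sup>2 \<le> B"
proof -
  define g where "g x = (cmod (f x))\<^sup>2" for x
  have bg: "integral {0..real k} g \<le> B" for k using b[of "real k"] unfolding g_def by simp
  have gi: "g integrable_on {0..real k}" for k using i[of "real k"] unfolding g_def by simp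
  have conv: "g integrable_on {0..} \<and> (\<lambda>k. integral {0..} (\<lambda>x. if x \<in> {0..real k} then g x else 0)) \<longlonglongrightarrow> integral {0..} g"
  proof (rule monotone_convergence_increasing)
    have eq: "integral {0..} (\<lambda>x. if x \<in> {0..real k} then g x else 0) = integral {0..real k} g" for k
      by (subst Henstock_Kurzweil_Integration.integral_restrict_Int) (auto simp: Int_absorb2)
    show "(\<lambda>x. if x \<in> {0..real k} then g x else 0) integrable_on {0..}" for k
      using gi by (subst integrable_restrict_Int) (simp add: Int_absorb2)
    show "bounded (range (\<lambda>k. integral {0..} (\<lambda>x. if x \<in> {0..real k} then g x else 0)))"
      unfolding eq
    proof (rule boundedI)
      fix x assume "x \<in> range (\<lambda>k. integral {0..real k} g)"
      then obtain k where k: "x = integral {0..real k} g" by auto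
      have "0 \<le> x" unfolding k using gi by (intro integral_nonneg) (auto simp: g_def)
      then show "norm x \<le> B" using bg[of k] by (simp add: k)
    qed
    show "(\<lambda>k. if x \<in> {0..real k} then g x else 0) \<longlonglongrightarrow> g x" if "x \<in> {0..}" for x
    proof (rule tendsto_eventually)
      obtain m where "x \<le> real m" using real_arch_simple by blast
      then have "(if x \<in> {0..real k} then g x else 0) = g x" if "k \<ge> m" for k
        using that \<open>x \<in> {0..}\<close> by auto
      then show "\<forall>\<^sub>F k in sequentially. (if x \<in> {0..real k} then g x else 0) = g x"
        unfolding eventually_sequentially by blast
    qed
  qed (auto simp: g_def)
  have "integral {0..} g \<le> B"
  proof (rule LIMSEQ_le_const2[OF conjunct2[OF conv]])
    have "integral {0..} (\<lambda>x. if x \<in> {0..real k} then g x else 0) = integral {0..real k} g" for k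
      by (subst Henstock_Kurzweil_Integration.integral_restrict_Int) (auto simp: Int_absorb2)
    then show "\<exists>N. \<forall>k\<ge>N. integral {0..} (\<lambda>x. if x \<in> {0..real k} then g x else 0) \<le> B"
      using bg by auto
  qed
  have "g absolutely_integrable_on {0..}"
    using conv by (intro nonnegative_absolutely_integrable_1) (auto simp: g_def)
  moreover have "(\<lambda>x. indicator {0..} x *\<^sub>R g x) \<in> borel_measurable lborel"
  proof -
    have eq: "(\<lambda>x. indicator {0..} x *\<^sub>R g x) = (\<lambda>x. (cmod (indicator {0..} x *\<^sub>R f x))\<^sup>2)"
      by (auto simp: g_def indicator_def)
    show ?thesis
      unfolding eq by (rule borel_measurable_power[OF measurable_compose[OF m[unfolded set_borel_measurable_def] borel_measurable_norm]])
  qed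
  ultimately have gi: "set_integrable lborel {0..} g"
    unfolding set_integrable_def by (subst (asm) integrable_completion) auto
  then show "L2_Rplus f" using m unfolding L2_Rplus_def g_def by simp
  have "(L2_norm_Rplus f)\<^sup>2 = (LINT x:{0..}|lborel. g x)"
    unfolding L2_norm_Rplus_def g_def
    by (rule real_sqrt_pow2) (auto simp: set_lebesgue_integral_def intro!: integral_nonneg_AE)
  also have "\<dots> = integral {0..} g" by (rule set_borel_integral_eq_integral(2)[OF gi])
  finally show "(L2_norm_Rplus f)\<^sup>2 \<le> B" using \<open>integral {0..} g \<le> B\<close> by simp
qed

lemma continuous_on_set_borel_measurable:
  fixes f :: "real \<Rightarrow> complex"
  assumes "continuous_on {0..} f"
  shows "set_borel_measurable lborel {0..} f"
  using borel_measurable_continuous_on_indicator[OF _ assms] unfolding set_borel_measurable_def by simp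

lemma L2_Rplus_linear_combination:
  assumes "L2_Rplus f" "L2_Rplus g"
  shows "L2_Rplus (\<lambda>x. a * f x + b * g x)"
proof -
  have m: "set_borel_measurable lborel {0..} (\<lambda>x. a * f x + b * g x)"
  proof -
    have eq: "(\<lambda>x. indicator {0..} x *\<^sub>R (a * f x + b * g x)) =
      (\<lambda>x. a * (indicator {0..} x *\<^sub>R f x) + b * (indicator {0..} x *\<^sub>R g x))"
      by (simp add: algebra_simps)
    show ?thesis unfolding set_borel_measurable_def eq
      by (intro borel_measurable_add borel_measurable_times borel_measurable_const)
        (use assms in \<open>auto simp: L2_Rplus_def set_borel_measurable_def\<close>)
  qed
  have bound: "(cmod (a * f x + b * g x))\<^sup>2 \<le> 2 * (cmod a)\<^sup>2 * (cmod (f x))\<^sup>2 + 2 * (cmod b)\<^sup>2 * (cmod (g x))\<^sup>2" for x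
  proof -
    have "(cmod (a * f x + b * g x))\<^sup>2 \<le> (cmod (a * f x) + cmod (b * g x))\<^sup>2"
      by (intro power_mono norm_triangle_ineq) auto
    also have "\<dots> \<le> 2 * (cmod (a * f x))\<^sup>2 + 2 * (cmod (b * g x))\<^sup>2"
      using sum_squares_bound[of "cmod (a * f x)" "cmod (b * g x)"] by (simp add: power2_sum)
    finally show ?thesis by (simp add: norm_mult power_mult_distrib)
  qed
  have "set_integrable lborel {0..} (\<lambda>x. (cmod (a * f x + b * g x))\<^sup>2)"
  proof (rule set_integrable_bound)
    show "set_integrable lborel {0..} (\<lambda>x. 2 * (cmod a)\<^sup>2 * (cmod (f x))\<^sup>2 + 2 * (cmod b)\<^sup>2 * (cmod (g x))\<^sup>2)"
      using assms by (intro set_integral_add(1) set_integrable_mult_right) (auto simp: L2_Rplus_def)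
    have eq: "(\<lambda>x. indicator {0..} x *\<^sub>R (cmod (a * f x + b * g x))\<^sup>2) = (\<lambda>x. (cmod (indicator {0..} x *\<^sub>R (a * f x + b * g x)))\<^sup>2)"
      by (auto simp: indicator_def)
    show "set_borel_measurable lborel {0..} (\<lambda>x. (cmod (a * f x + b * g x))\<^sup>2)"
      unfolding set_borel_measurable_def eq
      by (rule borel_measurable_power[OF measurable_compose[OF m[unfolded set_borel_measurable_def] borel_measurable_norm]])
    show "AE x in lborel. x \<in> {0..} \<longrightarrow> norm ((cmod (a * f x + b * g x))\<^sup>2) \<le> norm (2 * (cmod a)\<^sup>2 * (cmod (f x))\<^sup>2 + 2 * (cmod b)\<^sup>2 * (cmod (g x))\<^sup>2)"
      using bound by (auto intro!: AE_I2 order_trans[OF bound])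
  qed
  then show ?thesis using m by (simp add: L2_Rplus_def)
qed

text \<open>On bounded intervals |f| \<le> 1 + |f|^2 takes the place of the Schwarz
  inequality.\<close>

lemma L2_Rplus_absolutely_integrable:
  assumes "L2_Rplus f"
  shows "f absolutely_integrable_on {0..R}"
proof -
  have m: "set_borel_measurable lborel {0..} f" and i: "set_integrable lborel {0..} (\<lambda>x. (cmod (f x))\<^sup>2)"
    using assms by (auto simp: L2_Rplus_def)
  have "set_integrable lborel {0..R} f"
  proof (rule set_integrable_bound)
    show "set_integrable lborel {0..R} (\<lambda>x. 1 + (cmod (f x))\<^sup>2)"
      by (intro set_integral_add(1) set_integrable_subset[OF i]) (auto intro!: borel_integrable_atLeastAtMost')
    have "(\<lambda>x. indicator {0..R} x *\<^sub>R (indicator {0..} x *\<^sub>R f x)) \<in> borel_measurable lborel"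
      by (rule borel_measurable_scaleR[OF borel_measurable_indicator m[unfolded set_borel_measurable_def]]) simp
    moreover have "(\<lambda>x. indicator {0..R} x *\<^sub>R (indicator {0..} x *\<^sub>R f x)) = (\<lambda>x. indicator {0..R} x *\<^sub>R f x)"
      by (auto simp: indicator_def)
    ultimately show "set_borel_measurable lborel {0..R} f" unfolding set_borel_measurable_def by simp
    have "cmod (f x) \<le> 1 + (cmod (f x))\<^sup>2" for x
      using zero_le_power2[of "cmod (f x) - 1"] by (simp add: power2_diff)
        (smt (verit) zero_le_power2)
    then show "AE x in lborel. x \<in> {0..R} \<longrightarrow> norm (f x) \<le> norm (1 + (cmod (f x))\<^sup>2)"
      by (auto intro!: AE_I2 order_trans)
  qed
  then show ?thesis by (rule set_integrable_lborel_imp_absolutely_integrable)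
qed

section \<open>The phase of the principal square root\<close>

definition half_phase :: "complex \<Rightarrow> complex" where
  "half_phase z = exp (\<i> * of_real (Arg z / 2))"

lemma half_phase_eq:
  assumes "z \<noteq> 0"
  shows "of_real (sqrt (cmod z)) * half_phase z = csqrt z"
proof -
  have "csqrt z = exp (Ln z / 2)" using assms by (rule csqrt_exp_Ln)
  also have "Ln z / 2 = of_real (ln (cmod z) / 2) + \<i> * of_real (Arg z / 2)"
    using assms by (simp add: complex_eq_iff Re_Ln Arg_eq_Im_Ln)
  also have "exp \<dots> = of_real (exp (ln (cmod z) / 2)) * half_phase z"
    by (simp only: exp_add half_phase_def exp_of_real)
  also have "exp (ln (cmod z) / 2) = sqrt (cmod z)"
    using assms by (simp add: exp_ln_iff powr_half_sqrt[symmetric] powr_def)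
  finally show ?thesis ..
qed

lemma norm_half_phase: "cmod (half_phase z) = 1"
  by (simp add: half_phase_def norm_exp_i_times)

lemma Re_half_phase: "Re (half_phase z) = cos (Arg z / 2)"
  by (simp add: half_phase_def Re_exp)

lemma sector_cos:
  assumes "0 < \<kappa>" "\<kappa> < pi" "- pi + \<kappa> < a" "a < pi - \<kappa>"
  shows "sin (\<kappa> / 2) \<le> cos (a / 2)"
proof -
  have "sin (\<kappa> / 2) = cos (pi / 2 - \<kappa> / 2)" by (simp add: cos_diff)
  also have "\<dots> \<le> cos \<bar>a / 2\<bar>" using assms by (intro cos_monotone_0_pi_le) (auto simp: abs_if)
  finally show ?thesis by (simp only: cos_abs_real)
qed

text \<open>With z = |z| exp(i Arg z) the product has argument -Arg z / 2: the half phase turns cnj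
  z into the same sector around the positive axis in which the half phase itself lies.\<close>

lemma half_phase_cnj:
  assumes "z \<noteq> 0"
  shows "half_phase z * cnj z = of_real (cmod z) * cnj (half_phase z)"
proof -
  have "z = of_real (cmod z) * exp (\<i> * of_real (Arg z))" using Arg_eq[OF assms] .
  then have "cnj z = of_real (cmod z) * exp (- \<i> * of_real (Arg z))"
    by (metis complex_cnj_mult complex_cnj_complex_of_real exp_cnj complex_cnj_i)
  moreover have "exp (\<i> * of_real (Arg z / 2)) * exp (- \<i> * of_real (Arg z)) = exp (- \<i> * of_real (Arg z / 2))"
    by (simp add: exp_add[symmetric] field_simps)
  moreover have "cnj (half_phase z) = exp (- \<i> * of_real (Arg z / 2))"
    unfolding half_phase_def by (metis complex_cnj_mult complex_cnj_complex_of_real exp_cnj complex_cnj_i)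
  ultimately show ?thesis unfolding half_phase_def by (metis mult.left_commute)
qed

text \<open>Outside the unit disc, radial projection to the circle at most doubles distances: one
  share of |u - v| comes from the vectors, the other from the gap between their moduli.\<close>

lemma normalize_diff_le:
  fixes u v :: complex
  assumes "cmod u \<ge> 1" "cmod v \<ge> 1"
  shows "cmod (u / of_real (cmod u) - v / of_real (cmod v)) \<le> 2 * cmod (u - v)"
proof -
  have nz: "cmod u > 0" "cmod v > 0" "u \<noteq> 0" "v \<noteq> 0" using assms by auto
  have "u / of_real (cmod u) - v / of_real (cmod v) = (u - v) / of_real (cmod u) + v / of_real (cmod v) * of_real ((cmod v - cmod u) / cmod u)"
    using nz by (simp add: field_simps)
  then have "cmod (u / of_real (cmod u) - v / of_real (cmod v)) \<le> cmod ((u - v) / of_real (cmod u)) + cmod (v / of_real (cmod v) * of_real ((cmod v - cmod u) / cmod u))"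
    by (metis norm_triangle_ineq)
  also have "\<dots> = cmod (u - v) / cmod u + \<bar>cmod v - cmod u\<bar> / cmod u"
    using nz by (simp add: norm_divide norm_mult del: of_real_diff)
  also have "\<dots> \<le> cmod (u - v) / 1 + cmod (u - v) / 1"
  proof (intro add_mono frac_le)
    show "\<bar>cmod v - cmod u\<bar> \<le> cmod (u - v)" using norm_triangle_ineq3[of v u] by (simp add: norm_minus_commute)
  qed (use assms in auto)
  finally show ?thesis by simp
qed

text \<open>For the square roots, z - w = (u - v)(u + v), and |u + v| \<ge> Re (u + v) \<ge> 2 s
  because both roots have real part at least s. Normalizing them costs a factor 2, which leaves 1 /
  s. This transfers absolute continuity from q to P.\<close>

lemma half_phase_Lipschitz:
  assumes s: "s > 0" and z: "cmod z \<ge> 1" "s \<le> cos (Arg z / 2)" and w: "cmod w \<ge> 1" "s \<le> cos (Arg w / 2)"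
  shows "cmod (half_phase z - half_phase w) \<le> 1 / s * cmod (z - w)"
proof -
  define u where "u = csqrt z" define v where "v = csqrt w"
  have nz: "z \<noteq> 0" "w \<noteq> 0" using z w by auto
  have u: "cmod u \<ge> 1" "Re u \<ge> s" "half_phase z = u / of_real (cmod u)"
  proof -
    have e: "u = of_real (sqrt (cmod z)) * half_phase z" unfolding u_def using half_phase_eq[OF nz(1)] ..
    have c: "cmod u = sqrt (cmod z)" using z(1) by (simp add: e norm_mult norm_half_phase)
    show "cmod u \<ge> 1" using z(1) by (simp add: c)
    have "u / of_real (cmod u) = of_real (sqrt (cmod z)) * half_phase z / of_real (sqrt (cmod z))"
      by (simp only: c) (simp only: e)
    then show "half_phase z = u / of_real (cmod u)" using z(1) by auto
    have "1 * s \<le> sqrt (cmod z) * cos (Arg z / 2)" using z s by (intro mult_mono) auto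
    then show "Re u \<ge> s" by (simp add: e Re_half_phase)
  qed
  have v: "cmod v \<ge> 1" "Re v \<ge> s" "half_phase w = v / of_real (cmod v)"
  proof -
    have e: "v = of_real (sqrt (cmod w)) * half_phase w" unfolding v_def using half_phase_eq[OF nz(2)] ..
    have c: "cmod v = sqrt (cmod w)" using w(1) by (simp add: e norm_mult norm_half_phase)
    show "cmod v \<ge> 1" using w(1) by (simp add: c)
    have "v / of_real (cmod v) = of_real (sqrt (cmod w)) * half_phase w / of_real (sqrt (cmod w))"
      by (simp only: c) (simp only: e)
    then show "half_phase w = v / of_real (cmod v)" using w(1) by auto
    have "1 * s \<le> sqrt (cmod w) * cos (Arg w / 2)" using w s by (intro mult_mono) auto
    then show "Re v \<ge> s" by (simp add: e Re_half_phase)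
  qed
  have "z - w = (u - v) * (u + v)" by (simp add: u_def v_def algebra_simps power2_eq_square[symmetric])
  then have "cmod (z - w) = cmod (u - v) * cmod (u + v)" by (simp add: norm_mult)
  moreover have "cmod (u + v) \<ge> 2 * s" using complex_Re_le_cmod[of "u + v"] u(2) v(2) by simp
  ultimately have "cmod (u - v) * (2 * s) \<le> cmod (z - w)" by (simp add: mult_left_mono)
  moreover have "cmod (half_phase z - half_phase w) \<le> 2 * cmod (u - v)"
    using normalize_diff_le[OF u(1) v(1)] by (simp add: u(3) v(3))
  ultimately show ?thesis using s by (simp add: field_simps) (smt (verit) mult.commute mult_left_mono)
qed

lemma half_phase_has_vector_derivative:
  assumes q: "(q has_vector_derivative d) (at x)" and nz: "q x \<noteq> 0" and arg: "Arg (q x) < pi"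
  shows "((\<lambda>x. half_phase (q x)) has_vector_derivative half_phase (q x) * (\<i> * of_real (Im (d / q x) / 2))) (at x)"
proof -
  have nn: "q x \<notin> \<real>\<^sub>\<le>\<^sub>0" using nz arg Arg_eq_pi[of "q x"] by (auto simp: complex_nonpos_Reals_iff complex_eq_iff)
  have "(Ln \<circ> q has_vector_derivative (d * inverse (q x))) (at x)"
    using field_vector_diff_chain_at[OF q has_field_derivative_Ln[OF nn]] .
  then have L: "((\<lambda>x. Ln (q x)) has_vector_derivative d / q x) (at x)"
    by (simp add: o_def divide_inverse)
  have "bounded_linear (\<lambda>z. \<i> * of_real (Im z / 2))"
    by (simp add: linear_conv_bounded_linear[symmetric] linear_iff algebra_simps add_divide_distrib scaleR_conv_of_real)
  from bounded_linear.has_vector_derivative[OF this L]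
  have "((\<lambda>x. \<i> * of_real (Im (Ln (q x)) / 2)) has_vector_derivative \<i> * of_real (Im (d / q x) / 2)) (at x)" .
  then have E: "((\<lambda>x. exp (\<i> * of_real (Im (Ln (q x)) / 2))) has_vector_derivative
      (\<i> * of_real (Im (d / q x) / 2)) * exp (\<i> * of_real (Im (Ln (q x)) / 2))) (at x)"
    using field_vector_diff_chain_at[OF _ DERIV_exp] by (fastforce simp: o_def)
  \<comment> \<open>\<open>half_phase\<close> is identified with the expression in Ln away from zero
    only; continuity keeps q nonzero near x.\<close>
  have "isCont q x" using q has_vector_derivative_continuous by blast
  then have "\<forall>\<^sub>F y in nhds x. q y \<noteq> 0"
    using nz by (auto simp: isCont_def tendsto_at_iff_tendsto_nhds intro: tendsto_imp_eventually_ne)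
  then have "\<forall>\<^sub>F y in nhds x. exp (\<i> * of_real (Im (Ln (q y)) / 2)) = half_phase (q y)"
    by eventually_elim (simp add: half_phase_def Arg_eq_Im_Ln)
  with E show ?thesis using nz
    by (subst (asm) has_vector_derivative_cong_ev) (auto simp: half_phase_def Arg_eq_Im_Ln mult.commute eventually_nhds_x_imp_x)
qed

section \<open>The resolvent\<close>

lemma AE_lborel_negligible_UN:
  assumes "\<And>n::nat. negligible (N n)" "\<And>x. (\<And>n. x \<notin> N n) \<Longrightarrow> Q x"
  shows "AE x in lborel. Q x"
  by (rule negligible_imp_AE_lborel[of "\<Union>n. N n"]) (use assms in \<open>auto intro: negligible_countable_Union\<close>)

lemma at_within_atLeast: "x > 0 \<Longrightarrow> at x within {0..} = at (x::real)"
  by (intro at_within_interior) auto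

context sectorial_potential
begin

text \<open>Coercivity with m = 1 / R. Some finite Y is all that is asked of y: its contribution is
  of order Y / R^2 and disappears as R grows, so the bound involves F only.\<close>

lemma coercive_a_priori_bound:
  assumes co: "coercive \<kappa>0 t" and sol: "\<And>R. solves t R y y1 f"
    and bc0: "cmod (y 0) * cmod (y1 0) \<le> \<kappa>0 * (cmod (y 0))\<^sup>2"
    and F: "\<And>R. R \<ge> 0 \<Longrightarrow> integral {0..R} (\<lambda>x. (cmod (f x))\<^sup>2) \<le> F"
    and Y: "\<And>R. R \<ge> 0 \<Longrightarrow> integral {0..R} (\<lambda>x. (cmod (y x))\<^sup>2) \<le> Y"
  shows "integral {0..X} (\<lambda>x. c / 2 * (cmod (y1 x))\<^sup>2 + c * (cmod (q x) * (cmod (y x))\<^sup>2) + 1 / 2 * (cmod (y x))\<^sup>2) \<le> 2 * F"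
proof (rule field_le_epsilon)
  fix e :: real assume "e > 0"
  define k where "k x = c / 2 * (cmod (y1 x))\<^sup>2 + c * (cmod (q x) * (cmod (y x))\<^sup>2) + 1 / 2 * (cmod (y x))\<^sup>2" for x
  have k0: "k x \<ge> 0" for x using c_pos by (simp add: k_def)
  have Y0: "Y \<ge> 0" using Y[of 0] by simp
  \<comment> \<open>R \<ge> 2 X makes the weight at least 1/4 on [0, X], R \<ge> 2 x0 is required by
    \<open>coercive\<close>, and the last entry together with R \<ge> 1 makes the Y term at most e /
    4.\<close>
  define R where "R = Max {1, 2 * X, 2 * x0, 16 * Y / (c * e)}"
  have R: "1 \<le> R" "2 * X \<le> R" "2 * x0 \<le> R" "16 * Y / (c * e) \<le> R" by (auto simp: R_def)
  note S = solvesD[OF sol[of R]]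
  have wk: "(\<lambda>x. w x * k x) integrable_on {a..b}" if "continuous_on {0..R} w" "0 \<le> a" "b \<le> R" for w :: "real \<Rightarrow> real" and a b
  proof -
    have "(\<lambda>x. cmod (q x) * (w x * c * (cmod (y x))\<^sup>2) + w x * (c / 2 * (cmod (y1 x))\<^sup>2 + 1 / 2 * (cmod (y x))\<^sup>2)) integrable_on {0..R}"
      by (intro integrable_add integrable_q_mult integrable_continuous_real continuous_intros S that(1))
    then have "(\<lambda>x. w x * k x) integrable_on {0..R}" unfolding k_def by (simp add: algebra_simps)
    then show ?thesis by (rule integrable_subinterval_real) (use that in auto)
  qed
  have ki: "k integrable_on {a..b}" if "0 \<le> a" "b \<le> R" for a b
    using wk[of "\<lambda>_. 1", OF _ that] by simp
  have "X \<le> R" using R x0 by auto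
  have "1 / 4 * integral {0..X} k = integral {0..X} (\<lambda>x. 1 / 4 * k x)" by simp
  also have "\<dots> \<le> integral {0..X} (\<lambda>x. (1 - (1 / R) * x)\<^sup>2 * k x)"
  proof (rule integral_le)
    show "(\<lambda>x. 1 / 4 * k x) integrable_on {0..X}" using \<open>X \<le> R\<close> by (intro wk continuous_intros) auto
    show "(\<lambda>x. (1 - (1 / R) * x)\<^sup>2 * k x) integrable_on {0..X}" using \<open>X \<le> R\<close> by (intro wk continuous_intros) auto
    fix x assume "x \<in> {0..X}"
    then have "(1 / R) * x \<le> 1 / 2" using R by (simp add: field_simps)
    then have "(1 / 2)\<^sup>2 \<le> (1 - (1 / R) * x)\<^sup>2" by (intro power_mono) auto
    then show "1 / 4 * k x \<le> (1 - (1 / R) * x)\<^sup>2 * k x" using k0 by (intro mult_right_mono) (auto simp: power2_eq_square)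
  qed
  also have "\<dots> \<le> integral {0..R} (\<lambda>x. (1 - (1 / R) * x)\<^sup>2 * k x)"
    using \<open>X \<le> R\<close> k0 by (intro integral_subset_le wk continuous_intros) auto
  also have "\<dots> \<le> 1/2 * integral {0..R} (\<lambda>x. (cmod (f x))\<^sup>2) + 4 * (1 / R)\<^sup>2 / c * integral {0..R} (\<lambda>x. (cmod (y x))\<^sup>2)"
    unfolding k_def
    by (rule co[unfolded coercive_def, THEN conjunct2, rule_format, OF R(3) _ _ sol bc0]) (use R in auto)
  also have "\<dots> \<le> 1/2 * F + 4 * (1 / R)\<^sup>2 / c * Y"
    using F[of R] Y[of R] R c_pos by (intro add_mono mult_left_mono) auto
  also have "4 * (1 / R)\<^sup>2 / c * Y \<le> e / 4"
  proof -
    have "16 * Y \<le> R * (c * e)" using R(4) c_pos \<open>e > 0\<close> by (simp add: pos_divide_le_eq)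
    also have "\<dots> \<le> R * R * (c * e)" using R(1) c_pos \<open>e > 0\<close> by (intro mult_right_mono) auto
    finally show ?thesis using R(1) c_pos by (simp add: power2_eq_square field_simps)
  qed
  finally show "integral {0..X} (\<lambda>x. c / 2 * (cmod (y1 x))\<^sup>2 + c * (cmod (q x) * (cmod (y x))\<^sup>2) + 1 / 2 * (cmod (y x))\<^sup>2) \<le> 2 * F + e"
    unfolding k_def[symmetric] by simp
qed

lemma a_priori_split:
  assumes b: "integral {0..X} (\<lambda>x. c / 2 * (cmod (y1 x))\<^sup>2 + c * (cmod (q x) * (cmod (y x))\<^sup>2) + 1 / 2 * (cmod (y x))\<^sup>2) \<le> M"
    and y: "continuous_on {0..X} y" and y1: "continuous_on {0..X} y1"
  shows "c * integral {0..X} (\<lambda>x. (cmod (y1 x))\<^sup>2) \<le> 2 * M" "c * integral {0..X} (\<lambda>x. cmod (q x) * (cmod (y x))\<^sup>2) \<le> M"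
    "integral {0..X} (\<lambda>x. (cmod (y x))\<^sup>2) \<le> 2 * M"
proof -
  define I1 where "I1 = integral {0..X} (\<lambda>x. (cmod (y1 x))\<^sup>2)"
  define I2 where "I2 = integral {0..X} (\<lambda>x. cmod (q x) * (cmod (y x))\<^sup>2)"
  define I3 where "I3 = integral {0..X} (\<lambda>x. (cmod (y x))\<^sup>2)"
  have i1: "(\<lambda>x. (cmod (y1 x))\<^sup>2) integrable_on {0..X}" and i3: "(\<lambda>x. (cmod (y x))\<^sup>2) integrable_on {0..X}"
    by (intro integrable_continuous_real continuous_intros y y1)+
  have i2: "(\<lambda>x. cmod (q x) * (cmod (y x))\<^sup>2) integrable_on {0..X}"
    by (intro integrable_q_mult continuous_intros y)
  have pos: "I1 \<ge> 0" "I2 \<ge> 0" "I3 \<ge> 0"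
    unfolding I1_def I2_def I3_def by (intro integral_nonneg i1 i2 i3; simp)+
  have "integral {0..X} (\<lambda>x. c / 2 * (cmod (y1 x))\<^sup>2 + c * (cmod (q x) * (cmod (y x))\<^sup>2) + 1 / 2 * (cmod (y x))\<^sup>2)
    = c / 2 * I1 + c * I2 + 1 / 2 * I3"
    unfolding I1_def I2_def I3_def
    by (intro integral_unique has_integral_add has_integral_mult_right integrable_integral i1 i2 i3)
  then have "c / 2 * I1 + c * I2 + 1 / 2 * I3 \<le> M" using b by simp
  moreover have "c / 2 * I1 \<ge> 0" "c * I2 \<ge> 0" using pos c_pos by auto
  ultimately show "c * integral {0..X} (\<lambda>x. (cmod (y1 x))\<^sup>2) \<le> 2 * M" "c * integral {0..X} (\<lambda>x. cmod (q x) * (cmod (y x))\<^sup>2) \<le> M"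
    "integral {0..X} (\<lambda>x. (cmod (y x))\<^sup>2) \<le> 2 * M"
    using pos unfolding I1_def I2_def I3_def by linarith+
qed

lemma global_solution:
  assumes f: "L2_Rplus f"
  obtains y y1 where "y 0 = \<alpha>" "y1 0 = \<beta>" "\<And>x. x \<ge> 0 \<Longrightarrow> (y has_vector_derivative y1 x) (at x within {0..})"
    "\<And>R. solves t R y y1 f"
proof -
  define Q where "Q x = q x + of_real t" for x
  have Q: "Q absolutely_integrable_on {0..R}" for R
    unfolding Q_def by (intro set_integral_add(1) q_integrable) auto
  have fi: "f absolutely_integrable_on {0..R}" for R using f by (rule L2_Rplus_absolutely_integrable)
  obtain y y1 where y: "y 0 = \<alpha>" "y1 0 = \<beta>" "continuous_on {0..} y"
    "\<And>x. x \<ge> 0 \<Longrightarrow> (y has_vector_derivative y1 x) (at x within {0..})"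
    "\<And>x. x \<ge> 0 \<Longrightarrow> y1 x = \<beta> + integral {0..x} (\<lambda>t. Q t * y t - f t)"
    using linear_ode_global_solution[OF Q set_lebesgue_integral_eq_integral(1)[OF fi], of \<alpha> \<beta>] by blast
  have "solves t R y y1 f" for R
  proof -
    have i: "(\<lambda>t. Q t * y t - f t) absolutely_integrable_on {0..R}"
      by (intro set_integral_diff(1) fi absolutely_integrable_mult_continuous Q continuous_on_subset[OF y(3)]) auto
    have e: "y1 x = \<beta> + integral {0..x} (\<lambda>t. Q t * y t - f t)" if "x \<in> {0..R}" for x
      using y(5) that by simp
    obtain N where N: "negligible N" "\<And>x. x \<in> {0<..<R} - N \<Longrightarrow> (y1 has_vector_derivative Q x * y x - f x) (at x)"
      using lebesgue_differentiation[OF set_lebesgue_integral_eq_integral(1)[OF i] e] by blast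
    show ?thesis unfolding solves_def
    proof (intro conjI ballI)
      show "(y has_vector_derivative y1 x) (at x within {0..R})" if "x \<in> {0..R}" for x
        using has_vector_derivative_within_subset[OF y(4)[of x]] that by auto
      show "abs_cont_on_interval y1 0 R" using i e by (rule indefinite_integral_abs_cont)
      show "\<exists>N. negligible N \<and> (\<forall>x\<in>{0<..<R} - N. (y1 has_vector_derivative (q x + of_real t) * y x - f x) (at x))"
        using N unfolding Q_def by blast
      show "(\<lambda>x. (cmod (f x))\<^sup>2) integrable_on {0..R}" using f by (rule L2_Rplus_integral)
    qed
  qed
  then show thesis using that y(1,2,4) by blast
qed

lemma solves_add:
  assumes "solves t R y y1 f" "solves t R u u1 (\<lambda>_. 0)"
  shows "solves t R (\<lambda>x. y x + a * u x) (\<lambda>x. y1 x + a * u1 x) f"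
proof -
  note S = solvesD[OF assms(1)] solvesD[OF assms(2)]
  obtain N1 where N1: "negligible N1" "\<And>x. x \<in> {0<..<R} - N1 \<Longrightarrow> (y1 has_vector_derivative ((q x + of_real t) * y x - f x)) (at x)"
    using assms(1) unfolding solves_def by blast
  obtain N2 where N2: "negligible N2" "\<And>x. x \<in> {0<..<R} - N2 \<Longrightarrow> (u1 has_vector_derivative ((q x + of_real t) * u x - 0)) (at x)"
    using assms(2) unfolding solves_def by blast
  show ?thesis unfolding solves_def
  proof (intro conjI ballI exI[of _ "N1 \<union> N2"])
    show "((\<lambda>x. y x + a * u x) has_vector_derivative (y1 x + a * u1 x)) (at x within {0..R})" if "x \<in> {0..R}" for x
      by (intro has_vector_derivative_add has_vector_derivative_mult_right S that)
    have "norm (y1 s + a * u1 s - (y1 r + a * u1 r)) \<le> (1 + cmod a) * (norm (y1 s - y1 r) + norm (u1 s - u1 r))" for s r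
    proof -
      have "y1 s + a * u1 s - (y1 r + a * u1 r) = (y1 s - y1 r) + a * (u1 s - u1 r)" by (simp add: algebra_simps)
      then have "norm (y1 s + a * u1 s - (y1 r + a * u1 r)) \<le> norm (y1 s - y1 r) + cmod a * norm (u1 s - u1 r)"
        by (metis norm_triangle_ineq norm_mult)
      also have "\<dots> \<le> (1 + cmod a) * (norm (y1 s - y1 r) + norm (u1 s - u1 r))" by (simp add: distrib_left distrib_right)
      finally show ?thesis .
    qed
    then show "abs_cont_on_interval (\<lambda>x. y1 x + a * u1 x) 0 R" by (intro abs_cont_on_interval_dominated[OF S(4,10)])
    show "negligible (N1 \<union> N2)" using N1(1) N2(1) by simp
    fix x assume "x \<in> {0<..<R} - (N1 \<union> N2)"
    then have "((\<lambda>x. y1 x + a * u1 x) has_vector_derivative ((q x + of_real t) * y x - f x) + a * ((q x + of_real t) * u x - 0)) (at x)"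
      by (intro has_vector_derivative_add has_vector_derivative_mult_right N1(2) N2(2)) auto
    then show "((\<lambda>x. y1 x + a * u1 x) has_vector_derivative (q x + of_real t) * (y x + a * u x) - f x) (at x)"
      by (simp add: algebra_simps)
  qed (rule S(6))
qed

text \<open>For \<open>B = 0\<close> the quotient \<open>A / B\<close> is 0, as it should be: then \<open>y0 = 0\<close>.\<close>
lemma boundary_condition_bound:
  fixes A B :: complex
  assumes "A * y0 + B * z0 = 0" "cmod A + cmod B > 0"
  shows "cmod y0 * cmod z0 \<le> cmod (A / B) * (cmod y0)\<^sup>2"
proof (cases "B = 0")
  case True
  then show ?thesis using assms by simp
next
  case False
  then have "z0 = - (A / B) * y0" using assms(1) by (simp add: field_simps add_eq_0_iff2)
  then have "cmod z0 = cmod (A / B) * cmod y0" by (metis norm_minus_cancel norm_mult)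
  then show ?thesis by (simp only: power2_eq_square mult.commute mult.left_commute order_refl)
qed

text \<open>Coercivity with m = 0 and f = 0: a solution with u R = 0 would vanish on [0, R], against
  its initial data. Hence a condition y R = 0 can always be met by adding a multiple of u.\<close>

lemma homogeneous_solution_nonzero:
  assumes co: "coercive \<kappa>0 t" and sol: "solves t R u u1 (\<lambda>_. 0)" and R: "2 * x0 \<le> R"
    and bc0: "cmod (u 0) * cmod (u1 0) \<le> \<kappa>0 * (cmod (u 0))\<^sup>2" and nz: "u 0 \<noteq> 0 \<or> u1 0 \<noteq> 0"
  shows "u R \<noteq> 0"
proof
  assume "u R = 0"
  note S = solvesD[OF sol]
  have "R > 0" using R x0 by simp
  have "integral {0..R} (\<lambda>x. c / 2 * (cmod (u1 x))\<^sup>2 + c * (cmod (q x) * (cmod (u x))\<^sup>2) + 1 / 2 * (cmod (u x))\<^sup>2) \<le> 0"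
    using co[unfolded coercive_def, THEN conjunct2, rule_format, OF R order_refl _ sol bc0] \<open>u R = 0\<close> by simp
  from a_priori_split(3)[OF this S(2,3)]
  have "integral {0..R} (\<lambda>x. (cmod (u x))\<^sup>2) \<le> 0" by simp
  moreover have "integral {0..R} (\<lambda>x. (cmod (u x))\<^sup>2) \<ge> 0"
    by (intro integral_nonneg integrable_continuous_real continuous_intros S) auto
  ultimately have "integral {0..R} (\<lambda>x. (cmod (u x))\<^sup>2) = 0" by simp
  then have "((\<lambda>x. (cmod (u x))\<^sup>2) has_integral 0) (cbox 0 R)"
    using integrable_integral[OF integrable_continuous_real, of 0 R "\<lambda>x. (cmod (u x))\<^sup>2"] S(2) by (simp add: continuous_on_power continuous_on_norm)
  then have z: "u x = 0" if "x \<in> {0..R}" for x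
    using has_integral_0_cbox_imp_0[of 0 R "\<lambda>x. (cmod (u x))\<^sup>2" x] that S(2) \<open>R > 0\<close>
    by (simp add: continuous_on_power continuous_on_norm)
  have "((\<lambda>_. 0) has_vector_derivative u1 0) (at 0 within {0..R})"
    by (rule has_vector_derivative_transform[OF _ _ S(1)]) (use z \<open>R > 0\<close> in auto)
  then have "u1 0 = 0"
    using vector_derivative_unique_within_closed_interval[of 0 R 0 "\<lambda>_. 0" "u1 0" 0] \<open>R > 0\<close> by (simp add: has_vector_derivative_const)
  then show False using nz z[of 0] \<open>R > 0\<close> by simp
qed

text \<open>A shooting argument. \<open>u\<close> satisfies the homogeneous equation and the
  boundary condition at 0, \<open>p\<close> solves the full equation with zero initial data, and the
  candidates are p + a u. Those vanishing at \<open>R n\<close> obey a bound by F uniformly in n, so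
  only a sequence of complex coefficients has to be made to converge.\<close>

theorem L2_solution_exists:
  fixes A B :: complex
  assumes co: "coercive (cmod (A / B)) t" and AB: "cmod A + cmod B > 0" and f: "L2_Rplus f"
  obtains y y1 where "A * y 0 + B * y1 0 = 0" "\<And>x. x \<ge> 0 \<Longrightarrow> (y has_vector_derivative y1 x) (at x within {0..})"
    "\<And>R. solves t R y y1 f" "L2_Rplus y"
proof -
  obtain p p1 where p: "p 0 = 0" "p1 0 = 0" "\<And>x. x \<ge> 0 \<Longrightarrow> (p has_vector_derivative p1 x) (at x within {0..})"
    "\<And>R. solves t R p p1 f"
    using global_solution[OF f] by metis
  have "L2_Rplus (\<lambda>_. 0)" by (simp add: L2_Rplus_def set_borel_measurable_def set_integrable_def)
  then obtain u u1 where u: "u 0 = B" "u1 0 = - A" "\<And>x. x \<ge> 0 \<Longrightarrow> (u has_vector_derivative u1 x) (at x within {0..})"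
    "\<And>R. solves t R u u1 (\<lambda>_. 0)"
    using global_solution by metis
  define F where "F = (L2_norm_Rplus f)\<^sup>2"
  have F: "integral {0..R} (\<lambda>x. (cmod (f x))\<^sup>2) \<le> F" for R unfolding F_def using f by (rule L2_Rplus_integral)
  have ubc: "cmod (u 0) * cmod (u1 0) \<le> cmod (A / B) * (cmod (u 0))\<^sup>2"
    by (rule boundary_condition_bound[OF _ AB]) (simp add: u)
  have unz: "u R \<noteq> 0" if "2 * x0 \<le> R" for R
  proof -
    have "u 0 \<noteq> 0 \<or> u1 0 \<noteq> 0" using AB u(1,2) by auto
    then show ?thesis by (rule homogeneous_solution_nonzero[OF co u(4) that ubc])
  qed
  define R where "R n = 2 * x0 + real n" for n
  \<comment> \<open>Makes p + a u vanish at \<open>R n\<close>; the denominator is nonzero by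
    \<open>unz\<close>.\<close>
  define a where "a n = - p (R n) / u (R n)" for n
  have Rn: "2 * x0 \<le> R n" for n by (simp add: R_def)
  have cont: "continuous_on {0..X} p" "continuous_on {0..X} u" for X using solvesD(2) p(4) u(4) by blast+
  have sol: "solves t X (\<lambda>x. p x + b * u x) (\<lambda>x. p1 x + b * u1 x) f" for b X by (rule solves_add[OF p(4) u(4)])
  have bc: "A * (p 0 + b * u 0) + B * (p1 0 + b * u1 0) = 0" for b by (simp add: p u)
  have approx_full: "integral {0..R n} (\<lambda>x. (cmod (p x + a n * u x))\<^sup>2) \<le> F" for n
  proof -
    note S = solvesD[OF sol[of "R n" "a n"]]
    have "p (R n) + a n * u (R n) = 0" using unz[OF Rn] by (simp add: a_def)
    then have "integral {0..R n} (\<lambda>x. c / 2 * (cmod (p1 x + a n * u1 x))\<^sup>2 + c * (cmod (q x) * (cmod (p x + a n * u x))\<^sup>2) + 1 / 2 * (cmod (p x + a n * u x))\<^sup>2)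
        \<le> 1/2 * integral {0..R n} (\<lambda>x. (cmod (f x))\<^sup>2)"
      using co[unfolded coercive_def, THEN conjunct2, rule_format, OF Rn order_refl _ sol boundary_condition_bound[OF bc AB]] by simp
    also have "\<dots> \<le> F / 2" using F by simp
    finally show ?thesis using a_priori_split(3)[OF _ S(2,3)] by fastforce
  qed
  have int: "(\<lambda>x. (cmod (p x + b * u x))\<^sup>2) integrable_on {0..X}" "(\<lambda>x. (cmod (u x))\<^sup>2) integrable_on {0..X}" "(\<lambda>x. (cmod (p x))\<^sup>2) integrable_on {0..X}" for b X
    by (intro integrable_continuous_real continuous_intros cont)+
  have approx: "integral {0..X} (\<lambda>x. (cmod (p x + a n * u x))\<^sup>2) \<le> F" if "X \<le> R n" for n X
  proof -
    have "integral {0..X} (\<lambda>x. (cmod (p x + a n * u x))\<^sup>2) \<le> integral {0..R n} (\<lambda>x. (cmod (p x + a n * u x))\<^sup>2)"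
      using that by (intro integral_subset_le int) auto
    then show ?thesis using approx_full[of n] by linarith
  qed
  have sq: "(cmod (v - w))\<^sup>2 \<le> 2 * (cmod v)\<^sup>2 + 2 * (cmod w)\<^sup>2" for v w
  proof -
    have "(cmod (v - w))\<^sup>2 \<le> (cmod v + cmod w)\<^sup>2" by (intro power_mono norm_triangle_ineq4) auto
    then show ?thesis using sum_squares_bound[of "cmod v" "cmod w"] by (simp add: power2_sum)
  qed
  \<comment> \<open>On the fixed interval [0, 2 x0], a u is the difference of the bounded function p
    + a u and of p. Since \<open>U\<close> is positive, this bounds the coefficients
    \<open>a n\<close>.\<close>
  define U where "U = integral {0..2 * x0} (\<lambda>x. (cmod (u x))\<^sup>2)"
  define G where "G = integral {0..2 * x0} (\<lambda>x. (cmod (p x))\<^sup>2)"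
  have U: "U > 0"
  proof -
    have "U \<ge> 0" unfolding U_def by (intro integral_nonneg int) auto
    moreover have "U \<noteq> 0"
    proof
      assume "U = 0"
      then have "((\<lambda>x. (cmod (u x))\<^sup>2) has_integral 0) (cbox 0 (2 * x0))"
        using integrable_integral[OF int(2)[of "2 * x0"]] by (simp add: U_def)
      then have "u (2 * x0) = 0"
        using has_integral_0_cbox_imp_0[of 0 "2 * x0" "\<lambda>x. (cmod (u x))\<^sup>2" "2 * x0"] cont x0
        by (simp add: continuous_on_power continuous_on_norm)
      then show False using unz by simp
    qed
    ultimately show ?thesis by simp
  qed
  have a_bound: "(cmod (a n))\<^sup>2 * U \<le> 2 * F + 2 * G" for n
  proof -
    have "(cmod (a n))\<^sup>2 * U = integral {0..2 * x0} (\<lambda>x. (cmod (a n))\<^sup>2 * (cmod (u x))\<^sup>2)" by (simp add: U_def)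
    also have "\<dots> \<le> integral {0..2 * x0} (\<lambda>x. 2 * (cmod (p x + a n * u x))\<^sup>2 + 2 * (cmod (p x))\<^sup>2)"
    proof (rule integral_le)
      fix x
      show "(cmod (a n))\<^sup>2 * (cmod (u x))\<^sup>2 \<le> 2 * (cmod (p x + a n * u x))\<^sup>2 + 2 * (cmod (p x))\<^sup>2"
        using sq[of "p x + a n * u x" "p x"] by (simp add: norm_mult power_mult_distrib)
    qed (intro integrable_continuous_real continuous_intros cont)+
    also have "\<dots> = 2 * integral {0..2 * x0} (\<lambda>x. (cmod (p x + a n * u x))\<^sup>2) + 2 * G"
      unfolding G_def by (intro integral_unique has_integral_add has_integral_mult_right integrable_integral int)
    also have "\<dots> \<le> 2 * F + 2 * G" using approx[OF Rn] by simp
    finally show ?thesis .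
  qed
  have "cmod (a n) \<le> sqrt ((2 * F + 2 * G) / U)" for n
    using a_bound[of n] U by (intro real_le_rsqrt) (simp add: field_simps)
  then have "bounded (range a)" by (intro boundedI) auto
  then obtain b r where r: "strict_mono r" "(a \<circ> r) \<longlonglongrightarrow> b"
    using bounded_imp_convergent_subsequence by blast
  \<comment> \<open>On each [0, X] the limit p + b u is compared with a single approximant whose
    coefficient is close enough to b. The bound is not sharp; what matters is that it does not
    depend on X.\<close>
  have "integral {0..X} (\<lambda>x. (cmod (p x + b * u x))\<^sup>2) \<le> 2 * F + 1" for X
  proof -
    define V where "V = integral {0..X} (\<lambda>x. (cmod (u x))\<^sup>2)"
    have "(\<lambda>n. 2 * (cmod ((a \<circ> r) n - b))\<^sup>2 * V) \<longlonglongrightarrow> 2 * (cmod (b - b))\<^sup>2 * V"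
      by (intro tendsto_intros r(2))
    then have "\<forall>\<^sub>F n in sequentially. 2 * (cmod ((a \<circ> r) n - b))\<^sup>2 * V < 1" by (intro order_tendstoD(2)) auto
    moreover have "\<forall>\<^sub>F n in sequentially. X \<le> real n" using filterlim_real_sequentially by (simp add: filterlim_at_top)
    ultimately obtain n where n: "2 * (cmod (a (r n) - b))\<^sup>2 * V < 1" "X \<le> real n"
      by (metis (mono_tags, lifting) comp_apply eventually_conj eventually_happens' sequentially_bot)
    have "X \<le> R (r n)" using n(2) seq_suble[OF r(1), of n] x0 by (simp add: R_def)
    have "integral {0..X} (\<lambda>x. (cmod (p x + b * u x))\<^sup>2) \<le> integral {0..X} (\<lambda>x. 2 * (cmod (p x + a (r n) * u x))\<^sup>2 + 2 * (cmod (a (r n) - b))\<^sup>2 * (cmod (u x))\<^sup>2)"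
    proof (rule integral_le)
      fix x
      have "p x + b * u x = (p x + a (r n) * u x) - (a (r n) - b) * u x" by (simp add: algebra_simps)
      then show "(cmod (p x + b * u x))\<^sup>2 \<le> 2 * (cmod (p x + a (r n) * u x))\<^sup>2 + 2 * (cmod (a (r n) - b))\<^sup>2 * (cmod (u x))\<^sup>2"
        using sq[of "p x + a (r n) * u x" "(a (r n) - b) * u x"] by (simp only: norm_mult power_mult_distrib mult.assoc)
    qed (intro integrable_continuous_real continuous_intros cont)+
    also have "\<dots> = 2 * integral {0..X} (\<lambda>x. (cmod (p x + a (r n) * u x))\<^sup>2) + 2 * (cmod (a (r n) - b))\<^sup>2 * V"
      unfolding V_def by (intro integral_unique has_integral_add has_integral_mult_right integrable_integral int)
    also have "\<dots> \<le> 2 * F + 1" using approx[OF \<open>X \<le> R (r n)\<close>] n(1) by simp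
    finally show ?thesis .
  qed
  moreover have der: "((\<lambda>x. p x + b * u x) has_vector_derivative (p1 x + b * u1 x)) (at x within {0..})" if "x \<ge> 0" for x
    by (intro has_vector_derivative_add has_vector_derivative_mult_right p u that)
  then have "continuous_on {0..} (\<lambda>x. p x + b * u x)"
    unfolding continuous_on_eq_continuous_within using has_vector_derivative_continuous by (metis atLeast_iff)
  ultimately have "L2_Rplus (\<lambda>x. p x + b * u x)"
    by (intro L2_Rplus_bounded(1)[OF continuous_on_set_borel_measurable int(1)])
  then show thesis using that[OF bc der sol] by blast
qed

end

section \<open>From the hypotheses on q to a sectorial potential\<close>

text \<open>Clamping from below is monotone: it keeps the interiors of the intervals disjoint and
  does not lengthen them. It serves to extend the phase as a constant to the left of x0.\<close>

lemma abs_cont_on_interval_clamp: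
  assumes ac: "abs_cont_on_interval f c d" and "b \<le> d" "c \<le> d"
  shows "abs_cont_on_interval (\<lambda>x. f (max x c)) a b"
  unfolding abs_cont_on_interval_iff
proof (intro allI impI)
  fix \<epsilon> :: real assume "\<epsilon> > 0"
  then obtain \<delta> where \<delta>: "\<delta> > 0" and ac\<delta>: "\<And>n s t. interval_family c d n s t \<Longrightarrow> (\<Sum>i<n. t i - s i) < \<delta>
      \<Longrightarrow> (\<Sum>i<n. norm (f (t i) - f (s i))) < \<epsilon>"
    using ac unfolding abs_cont_on_interval_iff by meson
  show "\<exists>\<delta>>0. \<forall>n s t. interval_family a b n s t \<longrightarrow> (\<Sum>i<n. t i - s i) < \<delta> \<longrightarrow>
        (\<Sum>i<n. norm (f (max (t i) c) - f (max (s i) c))) < \<epsilon>"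
  proof (intro exI[of _ \<delta>] conjI \<delta> allI impI)
    fix n s t assume fam: "interval_family a b n s t" and l: "(\<Sum>i<n. t i - s i) < \<delta>"
    have F: "s i \<le> t i" "t i \<le> b" if "i < n" for i using fam that by (auto simp: interval_family_def)
    have sub: "{max (s i) c<..<max (t i) c} \<subseteq> {s i<..<t i}" for i by auto
    have "interval_family c d n (\<lambda>i. max (s i) c) (\<lambda>i. max (t i) c)"
      unfolding interval_family_def
    proof (intro conjI allI impI)
      fix i j assume "i < n" "j < n" "i \<noteq> j"
      then have "{s i<..<t i} \<inter> {s j<..<t j} = {}" using fam by (auto simp: interval_family_def)
      then show "{max (s i) c<..<max (t i) c} \<inter> {max (s j) c<..<max (t j) c} = {}"
        using sub[of i] sub[of j] by blast
    next
      fix i assume "i < n"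
      then show "c \<le> max (s i) c" "max (s i) c \<le> max (t i) c" "max (t i) c \<le> d"
        using F[of i] assms(2,3) by auto
    qed
    moreover have "(\<Sum>i<n. max (t i) c - max (s i) c) \<le> (\<Sum>i<n. t i - s i)"
    proof (rule sum_mono)
      fix i assume "i \<in> {..<n}"
      then show "max (t i) c - max (s i) c \<le> t i - s i" using F(1)[of i] by (auto simp: max_def)
    qed
    ultimately show "(\<Sum>i<n. norm (f (max (t i) c) - f (max (s i) c))) < \<epsilon>"
      using ac\<delta> l by (meson le_less_trans)
  qed
qed

text \<open>If windows with integral of |q| below G occurred arbitrarily far out, a disjoint
  sequence of them could be chosen, and sqrt |q| \<le> 1 + |q| would keep all the integrals in
  \<open>intervals\<close> below h + G.\<close>

lemma window_integral_unbounded: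
  assumes q_loc: "L1_loc_Rplus q" and h: "h > 0"
    and intervals: "\<forall>(a::nat \<Rightarrow> real) (h::real).
        h > 0 \<and> (\<forall>n. a n \<ge> 0) \<and>
        (\<forall>m n. m \<noteq> n \<longrightarrow> {a m..a m + h} \<inter> {a n..a n + h} = {})
        \<longrightarrow> filterlim (\<lambda>n. LINT x:{a n..a n + h}|lborel. sqrt (cmod (q x))) at_top sequentially"
  shows "\<exists>X\<ge>0. \<forall>x\<ge>X. G \<le> integral {x..x + h} (\<lambda>x. cmod (q x))"
proof (rule ccontr)
  assume "\<not> ?thesis"
  then have neg: "\<exists>x\<ge>X. integral {x..x + h} (\<lambda>x. cmod (q x)) < G" if "X \<ge> 0" for X
  proof -
    have "\<not> (\<forall>x\<ge>X. G \<le> integral {x..x + h} (\<lambda>x. cmod (q x)))"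
      using \<open>\<not> (\<exists>X\<ge>0. \<forall>x\<ge>X. G \<le> integral {x..x + h} (\<lambda>x. cmod (q x)))\<close> that by blast
    then show ?thesis by (auto simp: not_le)
  qed
  define Pr where "Pr x \<longleftrightarrow> x \<ge> 0 \<and> integral {x..x + h} (\<lambda>x. cmod (q x)) < G" for x
  \<comment> \<open>The gap of 1 between consecutive windows makes the closed intervals
    disjoint.\<close>
  have "\<exists>a. \<forall>n. Pr (a n) \<and> a n + h + 1 \<le> a (Suc n)"
  proof (rule dependent_nat_choice)
    show "\<exists>x. Pr x" using neg[of 0] by (auto simp: Pr_def)
    fix x assume "Pr x"
    then show "\<exists>y. Pr y \<and> x + h + 1 \<le> y" using neg[of "x + h + 1"] h by (auto simp: Pr_def) (metis add.commute le_add_same_cancel1 less_imp_le order_trans zero_le_one add_nonneg_nonneg)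
  qed
  then obtain a where a: "\<And>n. Pr (a n)" "\<And>n. a n + h + 1 \<le> a (Suc n)" by blast
  have mono: "a m + h < a n" if "m < n" for m n
  proof -
    have "a n \<le> a (Suc n)" for n using a(2)[of n] h by simp
    then have "a (Suc m) \<le> a n" by (rule lift_Suc_mono_le) (use that in simp)
    then show ?thesis using a(2)[of m] by simp
  qed
  have disj: "{a m..a m + h} \<inter> {a n..a n + h} = {}" if "m \<noteq> n" for m n
    using that mono[of m n] mono[of n m] by (cases m n rule: linorder_cases) auto
  have "filterlim (\<lambda>n. LINT x:{a n..a n + h}|lborel. sqrt (cmod (q x))) at_top sequentially"
    using intervals[rule_format, of h a] h a(1) disj by (auto simp: Pr_def)
  then have "\<forall>\<^sub>F n in sequentially. h + G \<le> (LINT x:{a n..a n + h}|lborel. sqrt (cmod (q x)))"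
    by (simp add: filterlim_at_top)
  then obtain n where n: "h + G \<le> (LINT x:{a n..a n + h}|lborel. sqrt (cmod (q x)))"
    by (meson eventually_happens' sequentially_bot)
  have an: "a n \<ge> 0" using a(1) by (simp add: Pr_def)
  have "set_integrable lborel {0..a n + h} q" using q_loc an h by (simp add: L1_loc_Rplus_def)
  then have qi: "set_integrable lborel {a n..a n + h} q" by (rule set_integrable_subset) (use an in auto)
  then have nq: "set_integrable lborel {a n..a n + h} (\<lambda>x. cmod (q x))" by (rule set_integrable_norm)
  have one: "set_integrable lborel {a n..a n + h} (\<lambda>x. 1 :: real)" by (rule borel_integrable_atLeastAtMost') simp
  have sum1: "set_integrable lborel {a n..a n + h} (\<lambda>x. 1 + cmod (q x))" using one nq by (rule set_integral_add(1))
  have sqrt_le: "sqrt u < 1 + u" if "u \<ge> 0" for u :: real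
  proof -
    have "0 \<le> (sqrt u - 1)\<^sup>2" by simp
    then have "2 * sqrt u \<le> 1 + u" using that by (simp add: power2_diff)
    then show ?thesis using that by (smt (verit) real_sqrt_ge_zero)
  qed
  have "(LINT x:{a n..a n + h}|lborel. sqrt (cmod (q x))) \<le> (LINT x:{a n..a n + h}|lborel. 1 + cmod (q x))"
  proof (rule set_integral_mono)
    show "set_integrable lborel {a n..a n + h} (\<lambda>x. sqrt (cmod (q x)))"
    proof (rule set_integrable_bound[OF sum1])
      have eq: "(\<lambda>x. indicator {a n..a n + h} x *\<^sub>R sqrt (cmod (q x))) = (\<lambda>x. sqrt (cmod (indicator {a n..a n + h} x *\<^sub>R q x)))"
        by (auto simp: indicator_def)
      have m: "(\<lambda>x. indicator {a n..a n + h} x *\<^sub>R q x) \<in> borel_measurable lborel"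
        using qi unfolding set_integrable_def by (rule borel_measurable_integrable)
      show "set_borel_measurable lborel {a n..a n + h} (\<lambda>x. sqrt (cmod (q x)))"
        unfolding set_borel_measurable_def eq by (rule measurable_compose[OF m, where g="\<lambda>z. sqrt (cmod z)"]) measurable
      show "AE x in lborel. x \<in> {a n..a n + h} \<longrightarrow> norm (sqrt (cmod (q x))) \<le> norm (1 + cmod (q x))"
        using sqrt_le by (auto intro!: AE_I2 less_imp_le)
    qed
  qed (use sum1 sqrt_le in \<open>auto intro: less_imp_le\<close>)
  also have "\<dots> = integral {a n..a n + h} (\<lambda>x. 1 + cmod (q x))"
    by (rule set_borel_integral_eq_integral(2)[OF sum1])
  also have "\<dots> = h + integral {a n..a n + h} (\<lambda>x. cmod (q x))"
    using h set_borel_integral_eq_integral(1)[OF nq] by (subst integral_add) auto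
  also have "\<dots> < h + G" using a(1)[of n] by (simp add: Pr_def)
  finally show False using n by simp
qed

text \<open>P is the half phase of q beyond x0 and is frozen at its value in x0 before, where q is
  only integrable. Beyond x0, |P'| = |Im (q' / q)| / 2 \<le> |q'| / (2 |q|), and
  \<open>q_deriv\<close> turns this into the bound 2 \<delta> sin(\<kappa>/2) |q|^(1/2).\<close>

lemma sectorial_potential_half_phase:
  fixes q :: "real \<Rightarrow> complex" and x0 \<kappa> \<delta> :: real
  assumes q_loc: "L1_loc_Rplus q"
    and x0_pos: "x0 > 0"
    and q_ge1: "\<forall>x\<ge>x0. cmod (q x) \<ge> 1"
    and q_AC: "AC_loc q {x0..}"
    and kappa: "0 < \<kappa>" "\<kappa> < pi"
    and q_arg: "\<forall>x\<ge>x0. - pi + \<kappa> < Arg (q x) \<and> Arg (q x) < pi - \<kappa>"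
    and delta: "0 < \<delta>" "\<delta> < 1"
    and q_deriv: "\<forall>x\<ge>x0. \<forall>d. (q has_vector_derivative d) (at x within {x0..}) \<longrightarrow>
                     cmod d / cmod (q x) powr (3/2) < 4 * \<delta> * sin (\<kappa> / 2)"
  shows "sectorial_potential q (\<lambda>x. half_phase (q (max x x0))) x0 (sin (\<kappa> / 2)) \<delta>"
proof
  define s where "s = sin (\<kappa> / 2)"
  have s: "s > 0" unfolding s_def using kappa by (intro sin_gt_zero) auto
  then show "0 < sin (\<kappa> / 2)" by (simp add: s_def)
  have cos_ge: "s \<le> cos (Arg (q x) / 2)" if "x \<ge> x0" for x
    unfolding s_def using q_arg that kappa by (intro sector_cos) auto
  show "q absolutely_integrable_on {0..R}" for R
  proof (cases "R \<ge> 0")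
    case True
    then have "set_integrable lborel {0..R} q" using q_loc by (simp add: L1_loc_Rplus_def)
    then show ?thesis by (rule set_integrable_lborel_imp_absolutely_integrable)
  qed auto
  have qac: "abs_cont_on_interval q x0 (max R x0)" for R
    using q_AC unfolding AC_loc_def by auto
  have Pac: "abs_cont_on_interval (\<lambda>x. half_phase (q (max x x0))) 0 R" for R
  proof -
    have m: "abs_cont_on_interval (\<lambda>x. q (max x x0)) 0 R"
      by (rule abs_cont_on_interval_clamp[OF qac[of R]]) auto
    have "norm (half_phase (q (max t x0)) - half_phase (q (max u x0)))
        \<le> 1 / s * (norm (q (max t x0) - q (max u x0)) + norm (q (max t x0) - q (max u x0)))" for t u
    proof -
      have "norm (half_phase (q (max t x0)) - half_phase (q (max u x0))) \<le> 1 / s * norm (q (max t x0) - q (max u x0))"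
        using q_ge1 cos_ge by (intro half_phase_Lipschitz s) auto
      also have "\<dots> \<le> 1 / s * (norm (q (max t x0) - q (max u x0)) + norm (q (max t x0) - q (max u x0)))"
        using s by (intro mult_left_mono) auto
      finally show ?thesis .
    qed
    then show ?thesis by (intro abs_cont_on_interval_dominated[OF m m])
  qed
  then show "abs_cont_on_interval (\<lambda>x. half_phase (q (max x x0))) 0 R" for R .
  show "cmod (half_phase (q (max x x0))) = 1" for x by (rule norm_half_phase)
  show "sin (\<kappa> / 2) \<le> Re (half_phase (q (max x x0)))" for x
    using cos_ge[of "max x x0"] by (simp add: Re_half_phase s_def)
  show "sin (\<kappa> / 2) * cmod (q x) \<le> Re (half_phase (q (max x x0)) * cnj (q x))" if "x \<ge> x0" for x
  proof -
    have "q x \<noteq> 0" using q_ge1 that by force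
    then have "Re (half_phase (q (max x x0)) * cnj (q x)) = cmod (q x) * cos (Arg (q x) / 2)"
      using half_phase_cnj[of "q x"] that by (simp add: max_absorb1 Re_half_phase)
    then show ?thesis using mult_left_mono[OF cos_ge[OF that], of "cmod (q x)"] by (simp add: s_def mult.commute)
  qed
  show "\<exists>N. negligible N \<and> (\<forall>x\<in>{0<..<R} - N. \<forall>D. ((\<lambda>x. half_phase (q (max x x0))) has_vector_derivative D) (at x) \<longrightarrow>
        cmod D \<le> 2 * \<delta> * sin (\<kappa> / 2) * sqrt (cmod (q x)))" for R
  proof -
    obtain q' N where "q' absolutely_integrable_on {x0..max R x0}"
      and N: "negligible N" "\<And>x. x \<in> {x0<..<max R x0} - N \<Longrightarrow> (q has_vector_derivative q' x) (at x)"
      and "\<And>x. x \<in> {x0..max R x0} \<Longrightarrow> (q' has_integral q x - q x0) {x0..x}"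
      by (rule abs_cont_on_interval_differentiable[OF qac[of R] max.cobounded2 that])
    show ?thesis
    proof (intro exI[of _ "insert x0 N"] conjI ballI allI impI)
      show "negligible (insert x0 N)" using N(1) by simp
      fix x D assume x: "x \<in> {0<..<R} - insert x0 N"
        and D: "((\<lambda>x. half_phase (q (max x x0))) has_vector_derivative D) (at x)"
      show "cmod D \<le> 2 * \<delta> * sin (\<kappa> / 2) * sqrt (cmod (q x))"
      proof (cases "x < x0")
        case True
        have "((\<lambda>x. half_phase (q x0)) has_vector_derivative D) (at x)"
          by (rule has_vector_derivative_transform_within_open[OF D, of "{..<x0}"]) (use True in \<open>auto simp: max_absorb2\<close>)
        then have "D = 0" using vector_derivative_unique_at[OF _ has_vector_derivative_const] by blast
        then show ?thesis using s delta by (simp add: s_def)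
      next
        case False
        then have xx: "x > x0" using x by auto
        have q1: "cmod (q x) \<ge> 1" using q_ge1 xx by simp
        then have q0: "q x \<noteq> 0" by auto
        have dq: "(q has_vector_derivative q' x) (at x)" using N(2)[of x] x xx by auto
        have "Arg (q x) < pi" using q_arg xx kappa by (smt (verit))
        from half_phase_has_vector_derivative[OF dq q0 this]
        have "((\<lambda>x. half_phase (q (max x x0))) has_vector_derivative half_phase (q x) * (\<i> * of_real (Im (q' x / q x) / 2))) (at x)"
          by (rule has_vector_derivative_transform_within_open[where S="{x0<..}"]) (use xx in \<open>auto simp: max_absorb1\<close>)
        then have "D = half_phase (q x) * (\<i> * of_real (Im (q' x / q x) / 2))"
          using vector_derivative_unique_at[OF D] by blast
        then have "cmod D = \<bar>Im (q' x / q x)\<bar> / 2" by (simp add: norm_mult norm_half_phase del: of_real_divide)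
        also have "\<dots> \<le> cmod (q' x) / cmod (q x) / 2"
          using abs_Im_le_cmod[of "q' x / q x"] by (simp add: norm_divide)
        also have "\<dots> \<le> 2 * \<delta> * s * sqrt (cmod (q x))"
        proof -
          have "(q has_vector_derivative q' x) (at x within {x0..})" using dq by (rule has_vector_derivative_at_within)
          then have "cmod (q' x) / cmod (q x) powr (3/2) < 4 * \<delta> * s" using q_deriv xx by (auto simp: s_def)
          moreover have "cmod (q x) powr (3/2) = cmod (q x) * sqrt (cmod (q x))"
            using q1 powr_add[of "cmod (q x)" 1 "1/2"] by (simp add: powr_half_sqrt)
          moreover have qpos: "cmod (q x) > 0" using q0 by simp
          then have pos: "cmod (q x) * sqrt (cmod (q x)) > 0" by simp
          ultimately have "cmod (q' x) < 4 * \<delta> * s * (cmod (q x) * sqrt (cmod (q x)))"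
            by (simp only: pos_divide_less_eq[OF pos])
          then show ?thesis using qpos by (simp add: field_simps)
        qed
        finally show ?thesis by (simp add: s_def)
      qed
    qed
  qed
qed (use x0_pos kappa delta in auto)

section \<open>The graph of the operator and its resolvent\<close>

context sectorial_potential
begin

text \<open>With mu = -t the relation f + mu y = -y'' + q y becomes y'' = (q + t) y - f. The
  exceptional sets of the two almost-everywhere conditions merge into one null set, which serves for
  every R.\<close>

lemma LU_graph_imp_solves:
  assumes g: "LU_graph q A B y (\<lambda>x. f x + complex_of_real (- t) * y x)" and f: "L2_Rplus f"
  obtains y1 where "\<And>x. x \<ge> 0 \<Longrightarrow> (y has_vector_derivative y1 x) (at x within {0..})"
    "A * y 0 + B * y1 0 = 0" "\<And>R. solves t R y y1 f" "L2_Rplus y"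
proof -
  obtain y1 y2 where y: "L2_Rplus y" "\<And>x. x \<ge> 0 \<Longrightarrow> (y has_vector_derivative y1 x) (at x within {0..})"
    "AC_loc y1 {0..}" "AE x in lborel. x \<ge> 0 \<longrightarrow> (y1 has_vector_derivative y2 x) (at x within {0..})"
    "AE x in lborel. x \<ge> 0 \<longrightarrow> f x + complex_of_real (- t) * y x = - y2 x + q x * y x"
    "A * y 0 + B * y1 0 = 0"
    using g unfolding LU_graph_def by blast
  have "AE x in lborel. x \<ge> 0 \<longrightarrow> (y1 has_vector_derivative ((q x + of_real t) * y x - f x)) (at x within {0..})"
    using y(4,5)
  proof eventually_elim
    case (elim x)
    show ?case
    proof
      assume "x \<ge> 0"
      then have "y2 x = (q x + of_real t) * y x - f x" using elim by (simp add: algebra_simps)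
      then show "(y1 has_vector_derivative ((q x + of_real t) * y x - f x)) (at x within {0..})"
        using elim \<open>x \<ge> 0\<close> by simp
    qed
  qed
  from AE_lborel_imp_negligible[OF this]
  obtain N where N: "negligible N" "\<And>x. x \<notin> N \<Longrightarrow> x \<ge> 0 \<longrightarrow> (y1 has_vector_derivative ((q x + of_real t) * y x - f x)) (at x within {0..})"
    by blast
  have "solves t R y y1 f" for R
    unfolding solves_def
  proof (intro conjI ballI exI[of _ N] N(1))
    show "(y has_vector_derivative y1 x) (at x within {0..R})" if "x \<in> {0..R}" for x
      using has_vector_derivative_within_subset[OF y(2)[of x]] that by auto
    show "abs_cont_on_interval y1 0 R"
    proof (cases "R \<ge> 0")
      case True
      then show ?thesis using y(3) unfolding AC_loc_def by auto
    next
      \<comment> \<open>For R < 0 the only interval family is the empty one, so any \<delta>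
        works.\<close>
      case False
      then have "\<not> interval_family 0 R n s u" if "n > 0" for n s u
        using that unfolding interval_family_def by force
      then have "n = 0" if "interval_family 0 R n s u" for n s u using that by blast
      then show ?thesis unfolding abs_cont_on_interval_iff by (intro allI impI exI[of _ 1]) force
    qed
    show "(y1 has_vector_derivative (q x + of_real t) * y x - f x) (at x)" if "x \<in> {0<..<R} - N" for x
      using N(2)[of x] that at_within_atLeast[of x] by auto
    show "(\<lambda>x. (cmod (f x))\<^sup>2) integrable_on {0..R}" using f by (rule L2_Rplus_integral)
  qed
  then show thesis using that y by blast
qed

text \<open>The null sets belonging to the intervals (0, n) are collected in a countable union,
  together with the point 0, where \<open>solves\<close> says nothing about the derivative of
  \<open>y1\<close>.\<close>

lemma solves_imp_LU_graph:
  assumes y: "L2_Rplus y" and f: "L2_Rplus f" and bc: "A * y 0 + B * y1 0 = 0"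
    and der: "\<And>x. x \<ge> 0 \<Longrightarrow> (y has_vector_derivative y1 x) (at x within {0..})" and sol: "\<And>R. solves t R y y1 f"
  shows "LU_graph q A B y (\<lambda>x. f x + complex_of_real (- t) * y x)"
  unfolding LU_graph_def
proof (intro conjI exI)
  show "L2_Rplus (\<lambda>x. f x + complex_of_real (- t) * y x)"
    using L2_Rplus_linear_combination[OF f y, of 1 "complex_of_real (- t)"] by simp
  have sub: "abs_cont_on_interval g a b" if "\<And>R. abs_cont_on_interval g 0 R" "{a..b} \<subseteq> {0..}" "a \<le> b" for g :: "real \<Rightarrow> complex" and a b
    using abs_cont_on_interval_subset[OF that(1)[of b], of a b] that by auto
  show "AC_loc y {0..}" "AC_loc y1 {0..}"
    unfolding AC_loc_def using sub solvesD(4,5)[OF sol] by blast+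
  have "\<exists>N. negligible N \<and> (\<forall>x\<in>{0<..<real n} - N. (y1 has_vector_derivative ((q x + of_real t) * y x - f x)) (at x))" for n :: nat
    using sol[of "real n"] unfolding solves_def by blast
  then obtain N where N: "\<And>n. negligible (N n)" "\<And>n x. x \<in> {0<..<real n} - N n \<Longrightarrow> (y1 has_vector_derivative ((q x + of_real t) * y x - f x)) (at x)"
    by metis
  show "AE x in lborel. 0 \<le> x \<longrightarrow> (y1 has_vector_derivative ((q x + of_real t) * y x - f x)) (at x within {0..})"
  proof (rule AE_lborel_negligible_UN[of "\<lambda>n. insert 0 (N n)"])
    fix x assume *: "\<And>n. x \<notin> insert 0 (N n)"
    obtain n where "x < real n" using reals_Archimedean2 by blast
    then have "(y1 has_vector_derivative ((q x + of_real t) * y x - f x)) (at x)" if "0 \<le> x"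
      using *[of n] that \<open>x < real n\<close> by (intro N(2)[of x n]) auto
    then show "0 \<le> x \<longrightarrow> (y1 has_vector_derivative ((q x + of_real t) * y x - f x)) (at x within {0..})"
      using has_vector_derivative_at_within by blast
  qed (use N(1) in simp)
  show "AE x in lborel. 0 \<le> x \<longrightarrow> f x + complex_of_real (- t) * y x = - ((q x + of_real t) * y x - f x) + q x * y x"
    by (simp add: algebra_simps)
qed (use y der bc in auto)

text \<open>The point mu = -t serves. Uniqueness is the a priori bound with f = 0; compactness comes
  from the same bound, which controls |y'|^2, |q| |y|^2 and |y|^2 together, as
  \<open>weighted_sobolev_compactness\<close> requires for the weight |q|.\<close>

theorem compact_resolvent:
  assumes AB: "cmod A + cmod B > 0"
    and wG: "\<And>h G. h > 0 \<Longrightarrow> \<exists>X\<ge>0. \<forall>x\<ge>X. G \<le> integral {x..x + h} (\<lambda>x. cmod (q x))"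
  shows "LU_compact_resolvent q A B"
proof -
  obtain t where co: "coercive (cmod (A / B)) t" using coercive_shift[of "cmod (A / B)"] by auto
  have bound: "integral {0..X} (\<lambda>x. c / 2 * (cmod (y1 x))\<^sup>2 + c * (cmod (q x) * (cmod (y x))\<^sup>2) + 1 / 2 * (cmod (y x))\<^sup>2) \<le> 2 * C"
    if f: "L2_Rplus f" "(L2_norm_Rplus f)\<^sup>2 \<le> C" and y: "L2_Rplus y" "A * y 0 + B * y1 0 = 0" "\<And>R. solves t R y y1 f" for f y y1 C X
    using L2_Rplus_integral(2)[OF f(1)] f(2) L2_Rplus_integral(2)[OF y(1)]
    by (intro coercive_a_priori_bound[OF co y(3) boundary_condition_bound[OF y(2) AB]]) (auto intro: order_trans)
  show ?thesis
    unfolding LU_compact_resolvent_def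
  proof (intro exI[of _ "complex_of_real (- t)"] conjI allI impI)
    fix f assume f: "L2_Rplus f"
    obtain y y1 where "A * y 0 + B * y1 0 = 0" "\<And>x. x \<ge> 0 \<Longrightarrow> (y has_vector_derivative y1 x) (at x within {0..})"
      "\<And>R. solves t R y y1 f" "L2_Rplus y"
      using L2_solution_exists[OF co AB f] by blast
    then show "\<exists>y. LU_graph q A B y (\<lambda>x. f x + complex_of_real (- t) * y x)"
      using solves_imp_LU_graph[OF _ f] by blast
  next
    fix y assume g: "LU_graph q A B y (\<lambda>x. complex_of_real (- t) * y x)"
    have z: "L2_Rplus (\<lambda>_. 0)" by (simp add: L2_Rplus_def set_borel_measurable_def set_integrable_def)
    have g0: "LU_graph q A B y (\<lambda>x. 0 + complex_of_real (- t) * y x)" using g by simp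
    obtain y1 where "\<And>x. x \<ge> 0 \<Longrightarrow> (y has_vector_derivative y1 x) (at x within {0..})"
      and y: "A * y 0 + B * y1 0 = 0" "\<And>R. solves t R y y1 (\<lambda>_. 0)" "L2_Rplus y"
      by (rule LU_graph_imp_solves[OF g0 z that])
    have "y x = 0" if "x \<ge> 0" for x
    proof -
      note S = solvesD[OF y(2)[of "x + 1"]]
      have "(L2_norm_Rplus (\<lambda>_. 0))\<^sup>2 \<le> 0" by (simp add: L2_norm_Rplus_def)
      from a_priori_split(3)[OF bound[OF z this y(3,1,2)] S(2,3)]
      have "integral {0..x + 1} (\<lambda>x. (cmod (y x))\<^sup>2) \<le> 0" by simp
      moreover have i: "(\<lambda>x. (cmod (y x))\<^sup>2) integrable_on {0..x + 1}" by (intro integrable_continuous_real continuous_intros S)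
      then have "integral {0..x + 1} (\<lambda>x. (cmod (y x))\<^sup>2) \<ge> 0" by (intro integral_nonneg) auto
      ultimately have "((\<lambda>x. (cmod (y x))\<^sup>2) has_integral 0) (cbox 0 (x + 1))"
        using integrable_integral[OF i] by simp
      then show ?thesis
        using has_integral_0_cbox_imp_0[of 0 "x + 1" "\<lambda>x. (cmod (y x))\<^sup>2" x] S(2) that
        by (simp add: continuous_on_power continuous_on_norm)
    qed
    then show "AE x in lborel. 0 \<le> x \<longrightarrow> y x = 0" by simp
  next
    fix ys fs :: "nat \<Rightarrow> real \<Rightarrow> complex" and C
    assume *: "\<forall>n. L2_Rplus (fs n) \<and> L2_norm_Rplus (fs n) \<le> C \<and> LU_graph q A B (ys n) (\<lambda>x. fs n x + complex_of_real (- t) * ys n x)"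
    have "\<exists>v. (\<forall>x\<ge>0. (ys n has_vector_derivative v x) (at x within {0..})) \<and> A * ys n 0 + B * v 0 = 0 \<and> (\<forall>R. solves t R (ys n) v (fs n)) \<and> L2_Rplus (ys n)" for n
      using LU_graph_imp_solves[of A B "ys n" "fs n" t] * by metis
    then obtain v where v: "\<And>n x. x \<ge> 0 \<Longrightarrow> (ys n has_vector_derivative v n x) (at x within {0..})" "\<And>n. A * ys n 0 + B * v n 0 = 0"
      "\<And>n R. solves t R (ys n) (v n) (fs n)" "\<And>n. L2_Rplus (ys n)" by metis
    define M where "M = 2 * C\<^sup>2"
    have n2: "(L2_norm_Rplus (fs n))\<^sup>2 \<le> C\<^sup>2" for n
      using * by (intro power_mono) (auto simp: L2_norm_Rplus_def set_lebesgue_integral_def intro!: integral_nonneg_AE)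
    have bd: "integral {0..X} (\<lambda>x. c / 2 * (cmod (v n x))\<^sup>2 + c * (cmod (q x) * (cmod (ys n x))\<^sup>2) + 1 / 2 * (cmod (ys n x))\<^sup>2) \<le> M" for X n
      unfolding M_def using * by (intro bound[OF _ n2 v(4,2,3)]) auto
    \<comment> \<open>A common bound for the three integrals: division by c handles the two terms
      that carry c, and 2 M is the bound for |y|^2.\<close>
    define K where "K = max (2 * M) (2 * M / c)"
    have M0: "M \<ge> 0" by (simp add: M_def)
    have split: "integral {0..X} (\<lambda>x. (cmod (ys n x))\<^sup>2) \<le> K" "integral {0..X} (\<lambda>x. (cmod (v n x))\<^sup>2) \<le> K"
      "integral {0..X} (\<lambda>x. cmod (q x) * (cmod (ys n x))\<^sup>2) \<le> K" for n X
    proof -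
      note s = a_priori_split[OF bd[of X n] solvesD(2,3)[OF v(3)]]
      have le: "u \<le> 2 * M / c" if "c * u \<le> 2 * M" for u using that c_pos by (simp add: field_simps)
      show "integral {0..X} (\<lambda>x. (cmod (ys n x))\<^sup>2) \<le> K" using s(3) by (simp add: K_def)
      show "integral {0..X} (\<lambda>x. (cmod (v n x))\<^sup>2) \<le> K" using le[OF s(1)] by (simp add: K_def)
      show "integral {0..X} (\<lambda>x. cmod (q x) * (cmod (ys n x))\<^sup>2) \<le> K"
        using le[of "integral {0..X} (\<lambda>x. cmod (q x) * (cmod (ys n x))\<^sup>2)"] s(2) M0 by (simp add: K_def)
    qed
    have vc: "continuous_on {0..} (v n)" for n
      unfolding continuous_on_eq_continuous_within
    proof
      fix x :: real assume "x \<in> {0..}"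
      then have "continuous (at x within {0..x + 1}) (v n)"
        using solvesD(3)[OF v(3), of "x + 1" n] unfolding continuous_on_eq_continuous_within by auto
      moreover have "at x within {0..x + 1} = at x within {0..}"
        by (rule at_within_nhd[where S="{..<x + 1}"]) auto
      ultimately show "continuous (at x within {0..}) (v n)" by simp
    qed
    have yc: "continuous_on {0..} (ys n)" for n
      unfolding continuous_on_eq_continuous_within using has_vector_derivative_continuous[OF v(1)] by auto
    obtain r :: "nat \<Rightarrow> nat" and z where rz: "strict_mono r" "continuous_on {0..} z" "\<And>R. R \<ge> 0 \<Longrightarrow> integral {0..R} (\<lambda>x. (cmod (z x))\<^sup>2) \<le> K"
      "\<And>\<epsilon>. \<epsilon> > 0 \<Longrightarrow> \<exists>N. \<forall>n\<ge>N. \<forall>R\<ge>0. integral {0..R} (\<lambda>x. (cmod (ys (r n) x - z x))\<^sup>2) \<le> \<epsilon>"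
      by (rule weighted_sobolev_compactness[OF v(1) vc absolutely_integrable_norm[OF q_integrable, unfolded o_def] norm_ge_zero wG split that])
    have ci: "(\<lambda>x. (cmod (g x))\<^sup>2) integrable_on {0..R}" if "continuous_on {0..} g" for g :: "real \<Rightarrow> complex" and R
      by (intro integrable_continuous_real continuous_intros continuous_on_subset[OF that]) auto
    have zL2: "L2_Rplus z"
      by (rule L2_Rplus_bounded(1)[OF continuous_on_set_borel_measurable[OF rz(2)] ci[OF rz(2)] rz(3)])
    have "(\<lambda>n. L2_norm_Rplus (\<lambda>x. ys (r n) x - z x)) \<longlonglongrightarrow> 0"
    proof (rule LIMSEQ_I)
      fix \<epsilon> :: real assume "\<epsilon> > 0"
      \<comment> \<open>Half of \<epsilon> is used because the bound on the norm obtained from these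
        integrals is not strict.\<close>
      then obtain N where N: "\<And>n R. n \<ge> N \<Longrightarrow> R \<ge> 0 \<Longrightarrow> integral {0..R} (\<lambda>x. (cmod (ys (r n) x - z x))\<^sup>2) \<le> (\<epsilon> / 2)\<^sup>2"
        using rz(4)[of "(\<epsilon> / 2)\<^sup>2"] by auto
      have "norm (L2_norm_Rplus (\<lambda>x. ys (r n) x - z x) - 0) < \<epsilon>" if "n \<ge> N" for n
      proof -
        have dc: "continuous_on {0..} (\<lambda>x. ys (r n) x - z x)" by (intro continuous_intros yc rz(2))
        have "(L2_norm_Rplus (\<lambda>x. ys (r n) x - z x))\<^sup>2 \<le> (\<epsilon> / 2)\<^sup>2"
          by (rule L2_Rplus_bounded(2)[OF continuous_on_set_borel_measurable[OF dc] ci[OF dc] N[OF that]])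
        then have "\<bar>L2_norm_Rplus (\<lambda>x. ys (r n) x - z x)\<bar> \<le> \<epsilon> / 2"
          using \<open>\<epsilon> > 0\<close> by (simp add: abs_le_square_iff[symmetric])
        then show ?thesis using \<open>\<epsilon> > 0\<close> by simp
      qed
      then show "\<exists>N. \<forall>n\<ge>N. norm (L2_norm_Rplus (\<lambda>x. ys (r n) x - z x) - 0) < \<epsilon>" by blast
    qed
    with rz(1) zL2 show "\<exists>r z. strict_mono r \<and> L2_Rplus z \<and> (\<lambda>n. L2_norm_Rplus (\<lambda>x. ys (r n) x - z x)) \<longlonglongrightarrow> 0"
      by blast
  qed
qed

end

theorem theorem4:
  fixes q :: "real \<Rightarrow> complex" and x0 \<kappa> \<delta> :: real and A B :: complex
  assumes q_loc: "L1_loc_Rplus q"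
    and x0_pos: "x0 > 0"
    and q_ge1: "\<forall>x\<ge>x0. cmod (q x) \<ge> 1"
    and q_AC: "AC_loc q {x0..}"
    and kappa: "0 < \<kappa>" "\<kappa> < pi"
    and q_arg: "\<forall>x\<ge>x0. - pi + \<kappa> < Arg (q x) \<and> Arg (q x) < pi - \<kappa>"
    and delta: "0 < \<delta>" "\<delta> < 1"
    and q_deriv: "\<forall>x\<ge>x0. \<forall>d. (q has_vector_derivative d) (at x within {x0..}) \<longrightarrow>
                     cmod d / cmod (q x) powr (3/2) < 4 * \<delta> * sin (\<kappa> / 2)"
    and AB: "cmod A + cmod B > 0"
    and intervals: "\<forall>(a::nat \<Rightarrow> real) (h::real).
        h > 0 \<and> (\<forall>n. a n \<ge> 0) \<and>
        (\<forall>m n. m \<noteq> n \<longrightarrow> {a m..a m + h} \<inter> {a n..a n + h} = {})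
        \<longrightarrow> filterlim (\<lambda>n. LINT x:{a n..a n + h}|lborel. sqrt (cmod (q x))) at_top sequentially"
  shows "LU_compact_resolvent q A B"
proof -
  interpret sectorial_potential q "\<lambda>x. half_phase (q (max x x0))" x0 "sin (\<kappa> / 2)" \<delta>
    by (rule sectorial_potential_half_phase[OF q_loc x0_pos q_ge1 q_AC kappa q_arg delta q_deriv])
  show ?thesis
    by (rule compact_resolvent[OF AB window_integral_unbounded[OF q_loc _ intervals]])
qed

end
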